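(* Let $E/F$ be a quadratic extension of non-archimedean local fields of characteristic different from $2$ and residual characteristic $p$, and $\ell\neq p$ an odd prime. Let $\pi$ be an irreducible supercuspidal $\overline{\mathbf{F}}_\ell$-representation of $\mathrm{GL}_2(E)$ distinguished by $\mathrm{SL}_2(F)$, and $\pi^+$ the unique irreducible component of $\pi|_{\mathrm{GL}_2^+(E)}$ that is $\psi_0$-generic. Then $\pi^+$ is distinguished by $\mathrm{SL}_2(F)$. Furthermore, if $\tau$ is an irreducible component of $\pi|_{\mathrm{SL}_2(E)}$ distinguished by $\mathrm{SL}_2(F)$, then $\tau$ is an irreducible component of $\pi^+|_{\mathrm{SL}_2(E)}$.
   Context: $\mathrm{GL}_2^+(E)$ is the subgroup of $\mathrm{GL}_2(E)$ of matrices with determinant in $F^\times E^{\times2}$. $\psi_0$ is a fixed $\overline{\mathbf{F}}_\ell$-character of $E$, nontrivial on the ring of integers $\mathfrak{o}_E$ and trivial on the maximal ideal $\mathfrak{p}_E$ and on $F$; a representation is $\psi_0$-generic if it admits a nonzero linear form $\lambda$ with $\lambda(\pi(u)v)=\psi_0(x)\lambda(v)$ for $u=\left(\begin{smallmatrix}1&x\\0&1\end{smallmatrix}\right)$, $x\in E$. Distinguished by $H$ means $\mathrm{Hom}_H(\cdot,\mathbf{1})\neq0$. *)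

theory Defs
  imports Main "HOL-Computational_Algebra.Polynomial"
begin

section \<open>2x2 matrices over a field, written (a,b,c,d) for the matrix [[a,b],[c,d]]\<close>

type_synonym 'e mat2 = "'e \<times> 'e \<times> 'e \<times> 'e"

fun mmult :: "'e::field mat2 \<Rightarrow> 'e mat2 \<Rightarrow> 'e mat2" where
  "mmult (a,b,c,d) (a',b',c',d') =
     (a*a' + b*c', a*b' + b*d', c*a' + d*c', c*b' + d*d')"

fun mdet :: "'e::field mat2 \<Rightarrow> 'e" where
  "mdet (a,b,c,d) = a*d - b*c"

definition mone :: "'e::field mat2" where
  "mone = (1,0,0,1)"

definition unip :: "'e::field \<Rightarrow> 'e mat2" where
  "unip x = (1,x,0,1)"

definition GL2 :: "'e::field mat2 set" where
  "GL2 = {g. mdet g \<noteq> 0}"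

definition SL2 :: "'e::field set \<Rightarrow> 'e mat2 set" where
  "SL2 S = {(a,b,c,d). a \<in> S \<and> b \<in> S \<and> c \<in> S \<and> d \<in> S \<and> mdet (a,b,c,d) = 1}"

definition GL2plus :: "'e::field set \<Rightarrow> 'e mat2 set" where
  "GL2plus F = {g. \<exists>f e. f \<in> F \<and> f \<noteq> 0 \<and> e \<noteq> 0 \<and> mdet g = f * e * e}"

text \<open>A valuation is a map v on the whole field type (values at 0 irrelevant);
  vge v x n means x = 0 or v(x) \<ge> n.\<close>
definition vge :: "('e::field \<Rightarrow> int) \<Rightarrow> 'e \<Rightarrow> int \<Rightarrow> bool" where
  "vge v x n \<longleftrightarrow> x = 0 \<or> v x \<ge> n"

definition discrete_valuation :: "('e::field \<Rightarrow> int) \<Rightarrow> bool" where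
  "discrete_valuation v \<longleftrightarrow>
     (\<forall>x y. x \<noteq> 0 \<longrightarrow> y \<noteq> 0 \<longrightarrow> v (x*y) = v x + v y) \<and>
     (\<forall>x y. x \<noteq> 0 \<longrightarrow> y \<noteq> 0 \<longrightarrow> x + y \<noteq> 0 \<longrightarrow> v (x+y) \<ge> min (v x) (v y)) \<and>
     (\<exists>x. x \<noteq> 0 \<and> v x = 1)"

definition subfield :: "'e::field set \<Rightarrow> bool" where
  "subfield K \<longleftrightarrow> 0 \<in> K \<and> 1 \<in> K \<and>
     (\<forall>x\<in>K. \<forall>y\<in>K. x + y \<in> K \<and> x * y \<in> K) \<and>
     (\<forall>x\<in>K. - x \<in> K \<and> inverse x \<in> K)"

definition nonarch_local_field :: "'e::field set \<Rightarrow> ('e \<Rightarrow> int) \<Rightarrow> bool" where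
  "nonarch_local_field K v \<longleftrightarrow>
     discrete_valuation v \<and> subfield K \<and>
     (\<exists>x\<in>K. x \<noteq> 0 \<and> v x \<noteq> 0) \<and>
     (\<forall>s :: nat \<Rightarrow> 'e. (\<forall>n. s n \<in> K) \<and>
         (\<forall>N. \<exists>M. \<forall>m\<ge>M. \<forall>n\<ge>M. vge v (s m - s n) N) \<longrightarrow>
         (\<exists>L\<in>K. \<forall>N. \<exists>M. \<forall>m\<ge>M. vge v (s m - L) N)) \<and>
     (\<exists>R. finite R \<and> R \<subseteq> {x\<in>K. vge v x 0} \<and>
          (\<forall>x\<in>K. vge v x 0 \<longrightarrow> (\<exists>r\<in>R. vge v (x - r) 1)))"

definition quadratic_ext :: "'e::field set \<Rightarrow> bool" where
  "quadratic_ext F \<longleftrightarrow> subfield F \<and> F \<noteq> UNIV \<and>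
     (\<exists>a. \<forall>x. \<exists>b c. b \<in> F \<and> c \<in> F \<and> x = b + c * a)"

text \<open>Principal congruence subgroups K_n = 1 + M_2(p^n) (n \<ge> 1); they form a
  neighbourhood basis of 1 in GL_2(E).\<close>
definition congr_subgroup :: "('e::field \<Rightarrow> int) \<Rightarrow> int \<Rightarrow> 'e mat2 set" where
  "congr_subgroup v n = {(a,b,c,d). mdet (a,b,c,d) \<noteq> 0 \<and>
      vge v (a - 1) n \<and> vge v b n \<and> vge v c n \<and> vge v (d - 1) n}"

definition alg_closure_Fl :: "nat \<Rightarrow> 'k::field itself \<Rightarrow> bool" where
  "alg_closure_Fl l _ \<longleftrightarrow> prime l \<and> of_nat l = (0::'k) \<and>
     (\<forall>q :: 'k poly. degree q > 0 \<longrightarrow> (\<exists>x. poly q x = 0)) \<and>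
     (\<forall>x :: 'k. \<exists>n>0. x ^ (l ^ n) = x)"

definition is_rep :: "('k::field \<Rightarrow> 'v::ab_group_add \<Rightarrow> 'v) \<Rightarrow> ('e::field mat2 \<Rightarrow> 'v \<Rightarrow> 'v) \<Rightarrow> bool" where
  "is_rep smul rho \<longleftrightarrow> module smul \<and>
     (\<forall>g\<in>GL2. \<forall>x y. rho g (x + y) = rho g x + rho g y) \<and>
     (\<forall>g\<in>GL2. \<forall>c x. rho g (smul c x) = smul c (rho g x)) \<and>
     (\<forall>x. rho mone x = x) \<and>
     (\<forall>g\<in>GL2. \<forall>h\<in>GL2. \<forall>x. rho (mmult g h) x = rho g (rho h x))"

definition smooth_rep :: "('e::field \<Rightarrow> int) \<Rightarrow> ('e mat2 \<Rightarrow> 'v \<Rightarrow> 'v) \<Rightarrow> bool" where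
  "smooth_rep v rho \<longleftrightarrow> (\<forall>x. \<exists>n\<ge>1. \<forall>g\<in>congr_subgroup v n. rho g x = x)"

definition invariant_subspace :: "('k::field \<Rightarrow> 'v::ab_group_add \<Rightarrow> 'v) \<Rightarrow> ('e::field mat2 \<Rightarrow> 'v \<Rightarrow> 'v)
    \<Rightarrow> 'e mat2 set \<Rightarrow> 'v set \<Rightarrow> bool" where
  "invariant_subspace smul rho H W \<longleftrightarrow> module.subspace smul W \<and>
     (\<forall>h\<in>H. \<forall>w\<in>W. rho h w \<in> W)"

text \<open>W is an irreducible H-subrepresentation (an irreducible component of the
  restriction to H, the restrictions considered being semisimple).\<close>
definition irreducible_on :: "('k::field \<Rightarrow> 'v::ab_group_add \<Rightarrow> 'v) \<Rightarrow> ('e::field mat2 \<Rightarrow> 'v \<Rightarrow> 'v)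
    \<Rightarrow> 'e mat2 set \<Rightarrow> 'v set \<Rightarrow> bool" where
  "irreducible_on smul rho H W \<longleftrightarrow> invariant_subspace smul rho H W \<and> W \<noteq> {0} \<and>
     (\<forall>U. invariant_subspace smul rho H U \<and> U \<subseteq> W \<longrightarrow> U = {0} \<or> U = W)"

definition linear_form_on :: "('k::field \<Rightarrow> 'v::ab_group_add \<Rightarrow> 'v) \<Rightarrow> 'v set \<Rightarrow> ('v \<Rightarrow> 'k) \<Rightarrow> bool" where
  "linear_form_on smul W lam \<longleftrightarrow>
     (\<forall>x\<in>W. \<forall>y\<in>W. lam (x + y) = lam x + lam y) \<and>
     (\<forall>c. \<forall>x\<in>W. lam (smul c x) = c * lam x)"

definition distinguished :: "('k::field \<Rightarrow> 'v::ab_group_add \<Rightarrow> 'v) \<Rightarrow> ('e::field mat2 \<Rightarrow> 'v \<Rightarrow> 'v)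
    \<Rightarrow> 'e mat2 set \<Rightarrow> 'v set \<Rightarrow> bool" where
  "distinguished smul rho D W \<longleftrightarrow> (\<exists>lam. linear_form_on smul W lam \<and>
     (\<exists>w\<in>W. lam w \<noteq> 0) \<and> (\<forall>h\<in>D. \<forall>w\<in>W. lam (rho h w) = lam w))"

definition generic :: "('k::field \<Rightarrow> 'v::ab_group_add \<Rightarrow> 'v) \<Rightarrow> ('e::field mat2 \<Rightarrow> 'v \<Rightarrow> 'v)
    \<Rightarrow> ('e \<Rightarrow> 'k) \<Rightarrow> 'v set \<Rightarrow> bool" where
  "generic smul rho psi W \<longleftrightarrow> (\<exists>lam. linear_form_on smul W lam \<and>
     (\<exists>w\<in>W. lam w \<noteq> 0) \<and> (\<forall>x. \<forall>w\<in>W. lam (rho (unip x) w) = psi x * lam w))"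

definition iso_on :: "('k::field \<Rightarrow> 'v::ab_group_add \<Rightarrow> 'v) \<Rightarrow> ('e::field mat2 \<Rightarrow> 'v \<Rightarrow> 'v)
    \<Rightarrow> 'e mat2 set \<Rightarrow> 'v set \<Rightarrow> 'v set \<Rightarrow> bool" where
  "iso_on smul rho H W W' \<longleftrightarrow> (\<exists>T. bij_betw T W W' \<and>
     (\<forall>x\<in>W. \<forall>y\<in>W. T (x + y) = T x + T y) \<and> (\<forall>c. \<forall>x\<in>W. T (smul c x) = smul c (T x)) \<and>
     (\<forall>h\<in>H. \<forall>w\<in>W. T (rho h w) = rho h (T w)))"

definition psi0_char :: "('e::field \<Rightarrow> int) \<Rightarrow> 'e set \<Rightarrow> ('e \<Rightarrow> 'k::field) \<Rightarrow> bool" where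
  "psi0_char v F psi \<longleftrightarrow> (\<forall>x. psi x \<noteq> 0) \<and> (\<forall>x y. psi (x + y) = psi x * psi y) \<and>
     (\<exists>x. vge v x 0 \<and> psi x \<noteq> 1) \<and> (\<forall>x. vge v x 1 \<longrightarrow> psi x = 1) \<and> (\<forall>x\<in>F. psi x = 1)"

definition smooth_char :: "('e::field \<Rightarrow> int) \<Rightarrow> ('e \<Rightarrow> 'k::field) \<Rightarrow> bool" where
  "smooth_char v chi \<longleftrightarrow> (\<forall>x. x \<noteq> 0 \<longrightarrow> chi x \<noteq> 0) \<and>
     (\<forall>x y. x \<noteq> 0 \<longrightarrow> y \<noteq> 0 \<longrightarrow> chi (x * y) = chi x * chi y) \<and>
     (\<exists>n\<ge>1. \<forall>x. vge v (x - 1) n \<longrightarrow> chi x = 1)"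

text \<open>The (unnormalized) parabolically induced representation Ind_B^G(chi1 \<otimes> chi2),
  realized on functions GL_2(E) \<rightarrow> k (extended by 0 outside GL_2(E)).\<close>
definition ind_space :: "('e::field \<Rightarrow> int) \<Rightarrow> ('e \<Rightarrow> 'k::field) \<Rightarrow> ('e \<Rightarrow> 'k) \<Rightarrow> ('e mat2 \<Rightarrow> 'k) set" where
  "ind_space v chi1 chi2 = {f. (\<forall>g. g \<notin> GL2 \<longrightarrow> f g = 0) \<and>
      (\<forall>a x d g. a \<noteq> 0 \<longrightarrow> d \<noteq> 0 \<longrightarrow> g \<in> GL2 \<longrightarrow>
          f (mmult (a,x,0,d) g) = chi1 a * chi2 d * f g) \<and>
      (\<exists>n\<ge>1. \<forall>k\<in>congr_subgroup v n. \<forall>g\<in>GL2. f (mmult g k) = f g)}"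

definition right_trans :: "'e::field mat2 \<Rightarrow> ('e mat2 \<Rightarrow> 'k) \<Rightarrow> ('e mat2 \<Rightarrow> 'k)" where
  "right_trans g f = (\<lambda>h. f (mmult h g))"

text \<open>pi (on UNIV) is isomorphic to a subquotient of Ind(chi1 \<otimes> chi2): there is a
  GL_2(E)-stable subspace W1 of the induced space and a surjective G-equivariant linear
  map W1 \<rightarrow> V (its kernel W2 then gives pi \<cong> W1/W2).\<close>
definition subquotient_of_ind :: "('e::field \<Rightarrow> int) \<Rightarrow> ('k::field \<Rightarrow> 'v::ab_group_add \<Rightarrow> 'v)
    \<Rightarrow> ('e mat2 \<Rightarrow> 'v \<Rightarrow> 'v) \<Rightarrow> ('e \<Rightarrow> 'k) \<Rightarrow> ('e \<Rightarrow> 'k) \<Rightarrow> bool" where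
  "subquotient_of_ind v smul rho chi1 chi2 \<longleftrightarrow>
     (\<exists>W1 T. W1 \<subseteq> ind_space v chi1 chi2 \<and> (\<lambda>_. 0) \<in> W1 \<and>
        (\<forall>f\<in>W1. \<forall>f'\<in>W1. (\<lambda>h. f h + f' h) \<in> W1) \<and>
        (\<forall>c. \<forall>f\<in>W1. (\<lambda>h. c * f h) \<in> W1) \<and>
        (\<forall>g\<in>GL2. \<forall>f\<in>W1. right_trans g f \<in> W1) \<and>
        (\<forall>f\<in>W1. \<forall>f'\<in>W1. T (\<lambda>h. f h + f' h) = T f + T f') \<and>
        (\<forall>c. \<forall>f\<in>W1. T (\<lambda>h. c * f h) = smul c (T f)) \<and>
        T ` W1 = UNIV \<and>
        (\<forall>g\<in>GL2. \<forall>f\<in>W1. T (right_trans g f) = rho g (T f)))"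

text \<open>Irreducible smooth pi is supercuspidal: not a subquotient of any representation
  parabolically induced from the (only proper) Levi subgroup, the diagonal torus,
  whose irreducible smooth representations are the pairs of smooth characters.\<close>
definition supercuspidal :: "('e::field \<Rightarrow> int) \<Rightarrow> ('k::field \<Rightarrow> 'v::ab_group_add \<Rightarrow> 'v)
    \<Rightarrow> ('e mat2 \<Rightarrow> 'v \<Rightarrow> 'v) \<Rightarrow> bool" where
  "supercuspidal v smul rho \<longleftrightarrow> irreducible_on smul rho GL2 UNIV \<and>
     \<not> (\<exists>chi1 chi2. smooth_char v chi1 \<and> smooth_char v chi2 \<and>
          subquotient_of_ind v smul rho chi1 chi2)"

end

theory Submission
  imports Defs "HOL-Algebra.Sylow"
begin

text \<open>
  Let V be the space of the supercuspidal representation. Restricted to the unipotent radical N(E),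
  it is a sheaf on the dual of E, which \<open>psi0\<close> identifies with E. The stalk at 0 is the Jacquet
  module, which vanishes: otherwise a maximal Borel-stable subspace containing its kernel would, by
  a two-variable Nullstellensatz, have codimension 1, and V would embed in a principal series.

  An \<open>SL2 F\<close>-invariant form is in particular N(F)-invariant, so it is supported on the characters
  \<open>psi0 (b * x)\<close> that are trivial on F, that is on b in F, and b is nonzero by the vanishing
  at 0. Conjugating by diag(b,1), which lies in \<open>GL2plus F\<close>, every subspace on which the
  form does not vanish becomes \<open>psi0\<close>-generic in the same sense as \<open>Wplus\<close>.

  Finally, Whittaker vectors are unique up to G-automorphisms of V. Let P be the projection onto the
  sections supported and constant on 1 + p^N. The anti-involution exchanging the two diagonal
  entries of a matrix preserves all operators P g P, so these commute by Gelfand's trick; since V is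
  irreducible, any two nonzero vectors in the image of P are exchanged by a G-automorphism. It
  carries the given distinguished component into \<open>Wplus\<close>. No admissibility or Schur lemma is
  needed, because the automorphism need not be a scalar.
\<close>

section \<open>Averages over powers of the maximal ideal\<close>

text \<open>The coefficients have characteristic l, so integrals are finite averages over cosets of
  powers of the maximal ideal p; the indices are prime to l, hence invertible. This is why a
  Nullstellensatz enters: it is applied to diag(w,1) and diag(w,w), with w a uniformizer, which
  generate the torus modulo its compact part. The two variables are these two generators. Exchanging
  the diagonal entries fixes every upper unipotent matrix and so respects \<open>psi0\<close>, but
  it sends diag(a,1) to diag(1,a), which is diag(1/a,1) times a scalar matrix. Hence N must be so
  large that the scalars in 1 + p^N act trivially. Functionals are never compared with each other. A
  Whittaker form on a subspace is used only to make \<open>spec 1 N y\<close> nonzero for every N,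
  an invariant form only to make \<open>spec b N w\<close> nonzero for all large N; both become
  vectors in the image of one projection once N is fixed.\<close>

locale valued_field =
  fixes v :: "'e::field \<Rightarrow> int"
  assumes val: "discrete_valuation v"
    and residue_finite: "\<exists>R. finite R \<and> (\<forall>x. vge v x 0 \<longrightarrow> (\<exists>r\<in>R. vge v (x - r) 1))"
begin

definition pp :: "int \<Rightarrow> 'e set" where
  "pp m = {x. x = 0 \<or> v x \<ge> m}"

lemma vge_iff_pp: "vge v x m \<longleftrightarrow> x \<in> pp m"
  by (simp add: vge_def pp_def)

lemma v_mult: "x \<noteq> 0 \<Longrightarrow> y \<noteq> 0 \<Longrightarrow> v (x * y) = v x + v y"
  using val unfolding discrete_valuation_def by blast

lemma v_add: "x \<noteq> 0 \<Longrightarrow> y \<noteq> 0 \<Longrightarrow> x + y \<noteq> 0 \<Longrightarrow> min (v x) (v y) \<le> v (x + y)"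
  using val unfolding discrete_valuation_def by blast

lemma v_one [simp]: "v 1 = 0"
  using v_mult[of 1 1] by simp

lemma v_uminus [simp]: "v (- x) = v x"
proof (cases "x = 0")
  case False
  have "v (-1) + v (-1) = 0"
    using v_mult[of "-1" "-1"] by simp
  then have "v (-1) = 0" by simp
  then show ?thesis
    using v_mult[of "-1" x] False by simp
qed simp

lemma v_inverse: "x \<noteq> 0 \<Longrightarrow> v (inverse x) = - v x"
  using v_mult[of x "inverse x"] by simp

lemma v_divide: "x \<noteq> 0 \<Longrightarrow> y \<noteq> 0 \<Longrightarrow> v (x / y) = v x - v y"
  by (simp add: divide_inverse v_mult v_inverse)

lemma v_power: "x \<noteq> 0 \<Longrightarrow> v (x ^ n) = int n * v x"
  by (induction n) (simp_all add: v_mult algebra_simps)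

lemma pp_zero [simp]: "0 \<in> pp m"
  by (simp add: pp_def)

lemma pp_add: "x \<in> pp m \<Longrightarrow> y \<in> pp m \<Longrightarrow> x + y \<in> pp m"
  using v_add[of x y] by (cases "x = 0"; cases "y = 0"; cases "x + y = 0") (auto simp: pp_def)

lemma pp_uminus [simp]: "- x \<in> pp m \<longleftrightarrow> x \<in> pp m"
  by (simp add: pp_def)

lemma pp_diff: "x \<in> pp m \<Longrightarrow> y \<in> pp m \<Longrightarrow> x - y \<in> pp m"
  using pp_add[of x m "- y"] by simp

lemma pp_add_iff: "y \<in> pp m \<Longrightarrow> x + y \<in> pp m \<longleftrightarrow> x \<in> pp m"
  using pp_add[of x m y] pp_diff[of "x + y" m y] by auto

lemma pp_mono: "m \<le> n \<Longrightarrow> x \<in> pp n \<Longrightarrow> x \<in> pp m"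
  by (auto simp: pp_def)

lemma pp_mult_iff: "a \<noteq> 0 \<Longrightarrow> a * x \<in> pp (v a + m) \<longleftrightarrow> x \<in> pp m"
  by (cases "x = 0") (auto simp: pp_def v_mult)

lemma pp_mult: "x \<in> pp m \<Longrightarrow> y \<in> pp n \<Longrightarrow> x * y \<in> pp (m + n)"
  by (cases "x = 0"; cases "y = 0") (auto simp: pp_def v_mult)

lemma pp_mult_int: "x \<in> pp 0 \<Longrightarrow> y \<in> pp n \<Longrightarrow> x * y \<in> pp n"
  using pp_mult[of x 0 y n] by simp

lemma pp_one [simp]: "1 \<in> pp 0"
  by (simp add: pp_def)

lemma pp_exists: "\<exists>m. x \<in> pp m"
  by (auto simp: pp_def)

lemma uniformizer: "\<exists>z. z \<noteq> 0 \<and> v z = 1"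
  using val unfolding discrete_valuation_def by blast

lemma v_surj: "\<exists>z. z \<noteq> 0 \<and> v z = m"
proof -
  obtain z where z: "z \<noteq> 0" "v z = 1" using uniformizer by blast
  show ?thesis
  proof (cases "m \<ge> 0")
    case True
    then show ?thesis using z v_power[of z "nat m"] by (intro exI[of _ "z ^ nat m"]) simp
  next
    case False
    then show ?thesis using z v_power[of z "nat (- m)"] v_inverse[of "z ^ nat (- m)"]
      by (intro exI[of _ "inverse (z ^ nat (- m))"]) simp
  qed
qed

lemma one_unit_nz:
  assumes "1 \<le> N" "c \<in> pp N"
  shows "1 + c \<noteq> 0"
proof
  assume "1 + c = 0"
  then have "c = - 1" by (simp add: eq_neg_iff_add_eq_0 add.commute)
  then show False using assms by (simp add: pp_def)
qed

lemma one_unit_v: "1 \<le> N \<Longrightarrow> c \<in> pp N \<Longrightarrow> v (1 + c) = 0"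
proof (cases "c = 0")
  case False
  assume a: "1 \<le> N" "c \<in> pp N"
  then have c: "v c \<ge> 1" using False by (simp add: pp_def)
  have nz: "1 + c \<noteq> 0" using one_unit_nz a by blast
  have "v (1 + c) \<ge> 0" using v_add[of 1 c] nz False c by simp
  moreover have "min (v (1 + c)) (v c) \<le> 0"
    using v_add[of "1 + c" "- c"] nz False by simp
  ultimately show ?thesis using c by simp
qed simp

lemma one_unit_mult_iff: "1 \<le> N \<Longrightarrow> c \<in> pp N \<Longrightarrow> (1 + c) * x \<in> pp m \<longleftrightarrow> x \<in> pp m"
  using pp_mult_iff[of "1 + c" x m] one_unit_nz[of N c] one_unit_v[of N c] by simp

lemma one_unit_div_iff: "1 \<le> N \<Longrightarrow> c \<in> pp N \<Longrightarrow> x / (1 + c) \<in> pp m \<longleftrightarrow> x \<in> pp m"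
  using one_unit_mult_iff[of N c "x / (1 + c)" m] one_unit_nz[of N c] by simp

section \<open>Coset representatives of powers of the maximal ideal\<close>

definition transversal :: "int \<Rightarrow> int \<Rightarrow> 'e set \<Rightarrow> bool" where
  "transversal m M C \<longleftrightarrow> finite C \<and> C \<subseteq> pp m \<and> (\<forall>x\<in>pp m. \<exists>!c. c \<in> C \<and> x - c \<in> pp M)"

lemma transversalD:
  assumes "transversal m M C"
  shows "finite C" "C \<subseteq> pp m" "\<And>x. x \<in> pp m \<Longrightarrow> \<exists>c\<in>C. x - c \<in> pp M"
    "\<And>c c'. c \<in> C \<Longrightarrow> c' \<in> C \<Longrightarrow> c - c' \<in> pp M \<Longrightarrow> c = c'"
proof -
  show "finite C" "C \<subseteq> pp m" "\<And>x. x \<in> pp m \<Longrightarrow> \<exists>c\<in>C. x - c \<in> pp M"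
    using assms unfolding transversal_def by blast+
  fix c c' assume "c \<in> C" "c' \<in> C" "c - c' \<in> pp M"
  moreover have "c - c \<in> pp M" by simp
  ultimately show "c = c'" using assms unfolding transversal_def by blast
qed

lemma transversalI:
  assumes "finite C" "C \<subseteq> pp m" "\<And>x. x \<in> pp m \<Longrightarrow> \<exists>c\<in>C. x - c \<in> pp M"
    "\<And>c c'. c \<in> C \<Longrightarrow> c' \<in> C \<Longrightarrow> c - c' \<in> pp M \<Longrightarrow> c = c'"
  shows "transversal m M C"
  unfolding transversal_def
proof (intro conjI assms(1,2) ballI)
  fix x assume "x \<in> pp m"
  then obtain c where c: "c \<in> C" "x - c \<in> pp M" using assms(3) by blast
  show "\<exists>!c. c \<in> C \<and> x - c \<in> pp M"
  proof (rule ex1I[of _ c])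
    fix d assume d: "d \<in> C \<and> x - d \<in> pp M"
    then have "d - c \<in> pp M" using pp_diff[OF c(2), of "x - d"] by simp
    then show "d = c" using assms(4) c d by blast
  qed (use c in blast)
qed

lemma transversal_nonempty: "transversal m M C \<Longrightarrow> C \<noteq> {}"
  using transversalD(3)[of m M C 0] by auto

text \<open>Residue representatives, scaled by an element of valuation \<open>m + int j\<close>,
  refine a cover by one step. Distinctness of the points is left to
  \<open>transversal_exists\<close>.\<close>

lemma pp_finite_cover: "\<exists>S. finite S \<and> (\<forall>x\<in>pp m. \<exists>s\<in>S. x - s \<in> pp (m + int j))"
proof (induction j)
  case 0
  show ?case by (intro exI[of _ "{0}"]) simp
next
  case (Suc j)
  obtain S where S: "finite S" "\<And>x. x \<in> pp m \<Longrightarrow> \<exists>s\<in>S. x - s \<in> pp (m + int j)"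
    using Suc.IH by blast
  obtain R where R: "finite R" "\<And>x. x \<in> pp 0 \<Longrightarrow> \<exists>r\<in>R. x - r \<in> pp 1"
    using residue_finite unfolding vge_iff_pp by blast
  obtain z where z: "z \<noteq> 0" "v z = m + int j" using v_surj by blast
  show ?case
  proof (intro exI[of _ "(\<lambda>(s, r). s + z * r) ` (S \<times> R)"] conjI ballI)
    show "finite ((\<lambda>(s, r). s + z * r) ` (S \<times> R))" using S(1) R(1) by simp
    fix x assume "x \<in> pp m"
    then obtain s where s: "s \<in> S" "x - s \<in> pp (m + int j)" using S(2) by blast
    then have "(x - s) / z \<in> pp 0" using pp_mult_iff[of z "(x - s) / z" 0] z by simp
    then obtain r where r: "r \<in> R" "(x - s) / z - r \<in> pp 1" using R(2) by blast
    have "z * ((x - s) / z - r) \<in> pp (v z + 1)" using r pp_mult_iff z by blast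
    moreover have "z * ((x - s) / z - r) = x - (s + z * r)" using z by (simp add: field_simps)
    ultimately have "x - (s + z * r) \<in> pp (m + int (Suc j))"
      using z by (metis (no_types) add.assoc add.commute of_nat_Suc)
    then show "\<exists>s\<in>(\<lambda>(s, r). s + z * r) ` (S \<times> R). x - s \<in> pp (m + int (Suc j))"
      using s(1) r(1) by (intro bexI[of _ "s + z * r"]) auto
  qed
qed

lemma transversal_exists:
  assumes "m \<le> M"
  shows "\<exists>C. transversal m M C"
proof -
  obtain S where S: "finite S" "\<And>x. x \<in> pp m \<Longrightarrow> \<exists>s\<in>S. x - s \<in> pp M"
    using pp_finite_cover[of m "nat (M - m)"] assms by auto
  \<comment> \<open>Points of one coset modulo p^M give \<open>SOME\<close> the same predicate, so
    \<open>r\<close> is constant on cosets and its values are representatives.\<close>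
  define r where "r x = (SOME y. y - x \<in> pp M)" for x
  have r1: "r x - x \<in> pp M" for x
    unfolding r_def by (rule someI[of _ x]) simp
  have r2: "r x = r y" if "x - y \<in> pp M" for x y
  proof -
    have "z - x \<in> pp M \<longleftrightarrow> z - y \<in> pp M" for z
      using pp_add_iff[OF that, of "z - x"] by simp
    then show ?thesis unfolding r_def by presburger
  qed
  have r3: "x - r x \<in> pp M" for x using r1[of x] pp_uminus[of "r x - x" M] by simp
  show ?thesis
  proof (intro exI[of _ "r ` pp m"] transversalI)
    have "r ` pp m \<subseteq> r ` S" using S(2) r2 by blast
    then show "finite (r ` pp m)" using S(1) finite_surj by blast
    show "r ` pp m \<subseteq> pp m"
    proof
      fix y assume "y \<in> r ` pp m"
      then obtain x where x: "x \<in> pp m" "y = r x" by blast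
      show "y \<in> pp m" using pp_add[OF pp_mono[OF assms r1[of x]] x(1)] x(2) by simp
    qed
    show "\<exists>c\<in>r ` pp m. x - c \<in> pp M" if "x \<in> pp m" for x using r3 that by blast
    fix c c' assume "c \<in> r ` pp m" "c' \<in> r ` pp m" and cc: "c - c' \<in> pp M"
    then obtain x x' where x: "c = r x" "c' = r x'" by blast
    have "x - x' = (x - r x) + (c - c') + (r x' - x')" using x by simp
    then have "x - x' \<in> pp M" using r1 r3 cc pp_add by presburger
    then show "c = c'" using r2 x by simp
  qed
qed

lemma pp_finite_image:
  assumes "\<And>x y. x \<in> pp m \<Longrightarrow> y \<in> pp m \<Longrightarrow> x - y \<in> pp M \<Longrightarrow> f x = f y"
  shows "finite (f ` pp m)"
proof -
  obtain C where C: "transversal m (max m M) C" using transversal_exists[of m "max m M"] by auto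
  have "f ` pp m \<subseteq> f ` C"
  proof
    fix y assume "y \<in> f ` pp m"
    then obtain x where x: "x \<in> pp m" "y = f x" by blast
    obtain c where c: "c \<in> C" "x - c \<in> pp (max m M)" using transversalD(3)[OF C x(1)] by blast
    have "f x = f c"
      using assms[of x c] x c transversalD(2)[OF C] pp_mono[of M "max m M"] by auto
    then show "y \<in> f ` C" using x c by blast
  qed
  then show ?thesis using transversalD(1)[OF C] finite_surj by blast
qed

lemma transversal_sum_eq:
  assumes C: "transversal m M C" and C': "transversal m M C'"
    and f: "\<And>x y. x \<in> pp m \<Longrightarrow> y \<in> pp m \<Longrightarrow> x - y \<in> pp M \<Longrightarrow> f x = f y"
  shows "sum f C = sum f C'"
proof -
  define h where "h x = (THE c. c \<in> C' \<and> x - c \<in> pp M)" for x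
  have h: "h x \<in> C' \<and> x - h x \<in> pp M" if "x \<in> pp m" for x
    unfolding h_def by (rule theI') (use C' that in \<open>auto simp: transversal_def\<close>)
  note D = transversalD[OF C] and D' = transversalD[OF C']
  have sw: "x - y \<in> pp M \<longleftrightarrow> y - x \<in> pp M" for x y
    using pp_uminus[of "x - y" M] by simp
  have "inj_on h C"
  proof (rule inj_onI)
    fix x y assume a: "x \<in> C" "y \<in> C" "h x = h y"
    then have "x - h x - (y - h y) \<in> pp M" using pp_diff h D(2) by blast
    then show "x = y" using a D(4)[of x y] by simp
  qed
  moreover have "h ` C = C'"
  proof
    show "h ` C \<subseteq> C'" using h D(2) by blast
    show "C' \<subseteq> h ` C"
    proof
      fix c assume c: "c \<in> C'"
      then obtain d where d: "d \<in> C" "c - d \<in> pp M" using D(3) D'(2) by blast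
      have "h d - c = - (d - h d) - (c - d)" by simp
      moreover have "- (d - h d) \<in> pp M" using h[of d] d(1) D(2) pp_uminus by blast
      ultimately have "h d - c \<in> pp M" using pp_diff d(2) by presburger
      then have "h d = c" using D'(4) c h[of d] d D(2) by blast
      then show "c \<in> h ` C" using d by blast
    qed
  qed
  ultimately have "sum f C' = sum (\<lambda>x. f (h x)) C"
    using sum.reindex[of h C f] by (simp add: o_def)
  also have "\<dots> = sum f C"
    by (rule sum.cong) (use h D(2) D'(2) f sw in \<open>blast+\<close>)
  finally show ?thesis by simp
qed

lemma transversal_card_eq:
  assumes "transversal m M C" "transversal m M C'"
  shows "card C = card C'"
  using transversal_sum_eq[OF assms, of "\<lambda>_. 1::nat"] by simp

text \<open>Representatives multiply like indices in the tower p^m, p^M, p^M'. This is what makes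
  averages independent of the level at which they are computed.\<close>

lemma transversal_prod:
  assumes C: "transversal m M C" and D: "transversal M M' D" and "m \<le> M" "M \<le> M'"
  shows "transversal m M' ((\<lambda>(c, d). c + d) ` (C \<times> D))" "inj_on (\<lambda>(c, d). c + d) (C \<times> D)"
proof -
  note C' = transversalD[OF C] and D' = transversalD[OF D]
  have key: "c = c' \<and> d = d'"
    if "c \<in> C" "c' \<in> C" "d \<in> D" "d' \<in> D" "(c + d) - (c' + d') \<in> pp M'" for c c' d d'
  proof -
    have "d' - d \<in> pp M" using that D'(2) pp_diff by blast
    then have "c - c' \<in> pp M" using pp_add[OF pp_mono[OF assms(4) that(5)], of "d' - d"] by simp
    then have "c = c'" using C'(4) that by blast
    then show ?thesis using D'(4) that by simp
  qed
  show "inj_on (\<lambda>(c, d). c + d) (C \<times> D)"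
    unfolding inj_on_def using key by fastforce
  show "transversal m M' ((\<lambda>(c, d). c + d) ` (C \<times> D))"
  proof (rule transversalI)
    show "finite ((\<lambda>(c, d). c + d) ` (C \<times> D))" using C'(1) D'(1) by simp
    show "(\<lambda>(c, d). c + d) ` (C \<times> D) \<subseteq> pp m"
      using C'(2) D'(2) pp_add pp_mono[OF assms(3)] by fastforce
    show "\<exists>c\<in>(\<lambda>(c, d). c + d) ` (C \<times> D). x - c \<in> pp M'" if x: "x \<in> pp m" for x
    proof -
      obtain c where c: "c \<in> C" "x - c \<in> pp M" using C'(3) x by blast
      then obtain d where d: "d \<in> D" "x - c - d \<in> pp M'" using D'(3) by blast
      then show ?thesis using c by (intro bexI[of _ "c + d"]) (auto simp: algebra_simps)
    qed
    show "c = c'" if "c \<in> (\<lambda>(c, d). c + d) ` (C \<times> D)" "c' \<in> (\<lambda>(c, d). c + d) ` (C \<times> D)"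
      "c - c' \<in> pp M'" for c c'
      using that key by auto
  qed
qed

lemma transversal_image:
  assumes C: "transversal m M C"
    and b1: "\<And>x. x \<in> pp m \<Longrightarrow> b x \<in> pp m'" and b2: "\<And>y. y \<in> pp m' \<Longrightarrow> \<exists>x\<in>pp m. b x = y"
    and b3: "\<And>x y. x \<in> pp m \<Longrightarrow> y \<in> pp m \<Longrightarrow> b x - b y \<in> pp M' \<longleftrightarrow> x - y \<in> pp M"
  shows "transversal m' M' (b ` C)" "inj_on b C"
proof -
  note C' = transversalD[OF C]
  show "inj_on b C"
  proof (rule inj_onI)
    fix x y assume a: "x \<in> C" "y \<in> C" "b x = b y"
    then have "x - y \<in> pp M" using b3[of x y] C'(2) by auto
    then show "x = y" using C'(4) a by blast
  qed
  show "transversal m' M' (b ` C)"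
  proof (rule transversalI)
    show "finite (b ` C)" "b ` C \<subseteq> pp m'" using C'(1,2) b1 by auto
    show "\<exists>c\<in>b ` C. x - c \<in> pp M'" if x: "x \<in> pp m'" for x
    proof -
      obtain y where y: "y \<in> pp m" "b y = x" using b2 x by blast
      obtain c where c: "c \<in> C" "y - c \<in> pp M" using C'(3) y(1) by blast
      then have "b y - b c \<in> pp M'" using b3[of y c] y(1) C'(2) by blast
      then show ?thesis using c(1) y(2) by blast
    qed
    show "c = c'" if "c \<in> b ` C" "c' \<in> b ` C" "c - c' \<in> pp M'" for c c'
      using that C'(2,4) b3 by blast
  qed
qed

text \<open>If l divided the index, \<open>C\<close> with addition modulo p^M would be a finite
  group with a subgroup of order l by Sylow. A nontrivial element of it is killed by l and, since p
  lies in the maximal ideal, by a power of p, which contradicts Bezout.\<close>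

lemma transversal_card_coprime:
  assumes C: "transversal m M C" and l: "prime (l::nat)" and p: "of_nat p \<in> pp 1"
    and lp: "coprime l p" and le: "m \<le> M"
  shows "\<not> l dvd card C"
proof
  assume "l dvd card C"
  then obtain k where k: "card C = l * k" by blast
  note D = transversalD[OF C]
  define h where "h x = (THE c. c \<in> C \<and> x - c \<in> pp M)" for x
  have h: "h x \<in> C" "x - h x \<in> pp M" if "x \<in> pp m" for x
    unfolding h_def using theI'[of "\<lambda>c. c \<in> C \<and> x - c \<in> pp M"] C that
    by (auto simp: transversal_def)
  have heq: "h x = c" if "x \<in> pp m" "c \<in> C" "x - c \<in> pp M" for x c
    using D(4)[of "h x" c] h[OF that(1)] that pp_diff[of "x - c" M "x - h x"] by simp
  have hcong: "h a = h b" if "a \<in> pp m" "b \<in> pp m" "b - a \<in> pp M" for a b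
    by (rule heq[OF that(1) h(1)[OF that(2)]])
      (use pp_diff[OF h(2)[OF that(2)] that(3)] in simp)
  define G where "G = \<lparr>carrier = C, monoid.mult = (\<lambda>x y. h (x + y)), one = h 0\<rparr>"
  have cm: "x \<in> pp m" if "x \<in> C" for x using D(2) that by blast
  have G: "group G"
  proof (rule groupI)
    fix x y z assume "x \<in> carrier G" "y \<in> carrier G" "z \<in> carrier G"
    then have xyz: "x \<in> C" "y \<in> C" "z \<in> C" by (auto simp: G_def)
    show "x \<otimes>\<^bsub>G\<^esub> y \<in> carrier G" using xyz cm h pp_add by (simp add: G_def)
    have pm: "x \<in> pp m" "y \<in> pp m" "z \<in> pp m" "x + y \<in> pp m" "y + z \<in> pp m" "- x \<in> pp m"
      using xyz cm pp_add by simp_all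
    have hm: "h (x + y) \<in> pp m" "h (y + z) \<in> pp m" "h (- x) \<in> pp m" using pm h(1) cm by blast+
    have e1: "h (h (x + y) + z) = h (x + y + z)"
      by (rule hcong) (use pp_add[OF hm(1) pm(3)] pp_add[OF pm(4,3)] h(2)[OF pm(4)] in simp_all)
    have e2: "h (x + h (y + z)) = h (x + y + z)"
      by (rule hcong)
        (use pp_add[OF pm(1) hm(2)] pp_add[OF pm(4,3)] h(2)[OF pm(5)] in \<open>simp_all add: algebra_simps\<close>)
    show "x \<otimes>\<^bsub>G\<^esub> y \<otimes>\<^bsub>G\<^esub> z = x \<otimes>\<^bsub>G\<^esub> (y \<otimes>\<^bsub>G\<^esub> z)"
      using e1 e2 by (simp add: G_def)
    have "h (h 0 + x) = x"
    proof (rule heq)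
      show "h 0 + x \<in> pp m" "x \<in> C" using xyz cm h(1)[of 0] pp_add by auto
      show "h 0 + x - x \<in> pp M" using h(2)[of 0] by simp
    qed
    then show "\<one>\<^bsub>G\<^esub> \<otimes>\<^bsub>G\<^esub> x = x" by (simp add: G_def)
    have "h (h (- x) + x) = h 0"
      by (rule hcong) (use pp_add[OF hm(3) pm(1)] h(2)[OF pm(6)] in \<open>simp_all add: algebra_simps\<close>)
    then show "\<exists>y\<in>carrier G. y \<otimes>\<^bsub>G\<^esub> x = \<one>\<^bsub>G\<^esub>"
      using xyz cm h by (intro bexI[of _ "h (- x)"]) (auto simp: G_def)
  next
    show "\<one>\<^bsub>G\<^esub> \<in> carrier G" using h(1)[of 0] by (simp add: G_def)
  qed
  then interpret group G .
  have "order G = l ^ 1 * k" using k by (simp add: order_def G_def)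
  moreover have "finite (carrier G)" using D(1) by (simp add: G_def)
  ultimately obtain H where H: "subgroup H G" "card H = l ^ 1"
    using sylow_thm[OF l G] by blast
  have "\<exists>x\<in>H. x \<noteq> \<one>\<^bsub>G\<^esub>"
  proof (rule ccontr)
    assume "\<not> ?thesis"
    then have "H \<subseteq> {\<one>\<^bsub>G\<^esub>}" by blast
    then have "card H \<le> 1" by (metis card_mono card.empty card_insert_disjoint finite.emptyI
          finite_insert empty_iff One_nat_def)
    then show False using H(2) prime_gt_1_nat[OF l] by simp
  qed
  then obtain x where x: "x \<in> H" "x \<noteq> \<one>\<^bsub>G\<^esub>" by blast
  have xG: "x \<in> carrier G" using x H subgroup.subset by blast
  then have xC: "x \<in> C" by (simp add: G_def)
  have npp: "of_nat n * y \<in> pp j" if "y \<in> pp j" for n y j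
    using that by (induction n) (auto simp: algebra_simps pp_add)
  have HC: "H \<subseteq> C" using subgroup.subset[OF H(1)] by (simp add: G_def)
  have finH: "finite H" using HC D(1) finite_subset by blast
  \<comment> \<open>Translation by x permutes \<open>H\<close>. Comparing the sums over
    \<open>H\<close> before and after the translation puts l * x into p^M: Lagrange's theorem for x,
    written in the field.\<close>
  have inj: "inj_on (\<lambda>y. h (x + y)) H"
  proof (rule inj_onI)
    fix y z assume "y \<in> H" "z \<in> H" "h (x + y) = h (x + z)"
    then show "y = z" using Units_l_cancel[of x y z, unfolded Units_eq] xG HC by (auto simp: G_def)
  qed
  moreover have "(\<lambda>y. h (x + y)) ` H \<subseteq> H"
    using subgroup.m_closed[OF H(1) x(1)] by (auto simp: G_def)
  ultimately have "(\<lambda>y. h (x + y)) ` H = H"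
    using finH by (simp add: endo_inj_surj)
  then have "(\<Sum>y\<in>H. h (x + y)) = (\<Sum>y\<in>H. y)"
    using sum.reindex[OF inj, of "\<lambda>y. y"] by (simp add: o_def)
  then have "(\<Sum>y\<in>H. x + y - h (x + y)) = of_nat (card H) * x"
    unfolding sum_subtractf sum.distrib sum_constant by simp
  then have "(\<Sum>y\<in>H. x + y - h (x + y)) = of_nat l * x"
    using H(2) by simp
  moreover have "(\<Sum>y\<in>H. x + y - h (x + y)) \<in> pp M"
  proof -
    have sumpp: "sum f A \<in> pp M" if "finite A" "\<And>y. y \<in> A \<Longrightarrow> f y \<in> pp M" for A and f :: "'e \<Rightarrow> 'e"
      using that by (induction A) (auto simp: pp_add)
    show ?thesis
    proof (rule sumpp[OF finH])
      fix y assume "y \<in> H"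
      then have "x + y \<in> pp m" using HC cm xC pp_add by blast
      then show "x + y - h (x + y) \<in> pp M" by (rule h(2))
    qed
  qed
  ultimately have lx: "of_nat l * x \<in> pp M" by simp
  have ppow: "of_nat (p ^ j) * x \<in> pp (m + int j)" for j
  proof (induction j)
    case (Suc j)
    have "of_nat p * (of_nat (p ^ j) * x) \<in> pp (1 + (m + int j))"
      using pp_mult[OF p Suc] .
    then show ?case by (simp add: algebra_simps)
  qed (use cm xC in simp)
  \<comment> \<open>Each factor p raises the valuation by at least 1, so \<open>M - m\<close>
    factors carry p^m into p^M.\<close>
  define j where "j = nat (M - m)"
  have px: "of_nat (p ^ j) * x \<in> pp M" using ppow[of j] le by (simp add: j_def)
  have "coprime (int l) (int (p ^ j))" using lp by simp
  then obtain a b where "a * int l + b * int (p ^ j) = 1"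
    by (metis bezout_int coprime_imp_gcd_eq_1)
  then have "of_int (a * int l + b * int (p ^ j)) * x = x" by simp
  then have e: "of_int a * (of_nat l * x) + of_int b * (of_nat (p ^ j) * x) = x"
    by (simp add: algebra_simps)
  have ipp: "of_int i * y \<in> pp n" if "y \<in> pp n" for i y n
  proof (cases i rule: int_cases2)
    case (nonneg k) then show ?thesis using npp that by simp
  next
    case (nonpos k) then show ?thesis using npp[OF that, of k] by simp
  qed
  have "x \<in> pp M" using pp_add[OF ipp[OF lx] ipp[OF px]] e by metis
  then have "h 0 = x" using heq[of 0 x] xC by simp
  then show False using x(2) by (simp add: G_def)
qed

end

section \<open>Normalised averages of locally constant functions\<close>

definition (in valued_field) lconst :: "int \<Rightarrow> int \<Rightarrow> ('e \<Rightarrow> 'z) \<Rightarrow> bool" where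
  "lconst m M f \<longleftrightarrow> m \<le> M \<and> (\<forall>x\<in>pp m. \<forall>y\<in>pp m. x - y \<in> pp M \<longrightarrow> f x = f y)"

locale avg_space = valued_field v + vector_space smul
  for v :: "'e::field \<Rightarrow> int" and smul :: "'k::field \<Rightarrow> 'v::ab_group_add \<Rightarrow> 'v" (infixr \<open>*s\<close> 75) +
  assumes card_nz: "transversal m M C \<Longrightarrow> m \<le> M \<Longrightarrow> of_nat (card C) \<noteq> (0::'k)"
begin

lemma lconstI: "m \<le> M \<Longrightarrow> (\<And>x y. x \<in> pp m \<Longrightarrow> y \<in> pp m \<Longrightarrow> x - y \<in> pp M \<Longrightarrow> f x = f y) \<Longrightarrow> lconst m M f"
  unfolding lconst_def by blast

lemma lconstD: "lconst m M f \<Longrightarrow> x \<in> pp m \<Longrightarrow> y \<in> pp m \<Longrightarrow> x - y \<in> pp M \<Longrightarrow> f x = f y"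
  unfolding lconst_def by blast

lemma lconst_le: "lconst m M f \<Longrightarrow> m \<le> M"
  by (simp add: lconst_def)

lemma lconst_mono:
  assumes "lconst m M f" "M \<le> M'"
  shows "lconst m M' f"
proof (rule lconstI)
  show "m \<le> M'" using lconst_le[OF assms(1)] assms(2) by simp
  show "f x = f y" if "x \<in> pp m" "y \<in> pp m" "x - y \<in> pp M'" for x y
    by (rule lconstD[OF assms(1) that(1,2) pp_mono[OF assms(2) that(3)]])
qed

lemma lconst_comp:
  assumes "lconst m M f"
  shows "lconst m M (\<lambda>x. h (f x))"
  by (rule lconstI[OF lconst_le[OF assms]], rule arg_cong[of _ _ h], rule lconstD[OF assms])

lemma lconst_comp2:
  assumes "lconst m M f" "lconst m M g"
  shows "lconst m M (\<lambda>x. h (f x) (g x))"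
  by (rule lconstI[OF lconst_le[OF assms(1)]], rule arg_cong2[of _ _ _ _ h])
    (blast intro: lconstD[OF assms(1)] lconstD[OF assms(2)])+

text \<open>The normalised Haar integral over p^m. \<open>THE\<close> ranges over the value and not
  over the level; \<open>transversal_sum_refine\<close> makes the value unique when the function is
  locally constant on p^m.\<close>

definition avg :: "int \<Rightarrow> ('e \<Rightarrow> 'v) \<Rightarrow> 'v" where
  "avg m f = (THE y. \<exists>M C. lconst m M f \<and> transversal m M C \<and> y = inverse (of_nat (card C)) *s sum f C)"

lemma sum_const_scale: "(\<Sum>x\<in>A. y) = of_nat (card A) *s y"
  by (induction A rule: infinite_finite_induct) (auto simp: scale_left_distrib)

lemma transversal_sum_refine:
  assumes f: "lconst m M f" and C: "transversal m M C" and C': "transversal m M' C'" and le: "M \<le> M'"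
  shows "inverse (of_nat (card C)) *s sum f C = inverse (of_nat (card C')) *s sum f C'"
proof -
  have m: "m \<le> M" using f by (simp add: lconst_def)
  obtain D where D: "transversal M M' D" using transversal_exists[OF le] by blast
  note pr = transversal_prod[OF C D m le]
  have "card C' = card ((\<lambda>(c, d). c + d) ` (C \<times> D))" by (rule transversal_card_eq[OF C' pr(1)])
  then have card: "card C' = card C * card D"
    by (simp add: card_image[OF pr(2)] card_cartesian_product)
  have "sum f C' = sum f ((\<lambda>(c, d). c + d) ` (C \<times> D))"
    by (rule transversal_sum_eq[OF C' pr(1)])
      (use lconst_mono[OF f le] in \<open>blast dest: lconstD\<close>)
  also have "\<dots> = (\<Sum>(c, d)\<in>C \<times> D. f (c + d))"
    unfolding sum.reindex[OF pr(2)] by (rule sum.cong) auto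
  also have "\<dots> = (\<Sum>c\<in>C. \<Sum>d\<in>D. f (c + d))"
    by (simp add: sum.cartesian_product)
  also have "\<dots> = (\<Sum>c\<in>C. \<Sum>d\<in>D. f c)"
  proof (intro sum.cong refl)
    fix c d assume "c \<in> C" "d \<in> D"
    then have cd: "c \<in> pp m" "d \<in> pp M" using transversalD(2)[OF C] transversalD(2)[OF D] by auto
    show "f (c + d) = f c"
      by (rule lconstD[OF f]) (use cd pp_mono[OF m] pp_add in auto)
  qed
  also have "\<dots> = of_nat (card D) *s sum f C"
    by (simp only: sum_const_scale scale_sum_right)
  finally have "sum f C' = of_nat (card D) *s sum f C" .
  then show ?thesis using card card_nz[OF D le] card_nz[OF C m] by (simp add: mult.assoc)
qed

lemma avg_eq:
  assumes f: "lconst m M f" and C: "transversal m M C"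
  shows "avg m f = inverse (of_nat (card C)) *s sum f C"
  unfolding avg_def
proof (rule the_equality)
  show "\<exists>M' C'. lconst m M' f \<and> transversal m M' C' \<and>
      inverse (of_nat (card C)) *s sum f C = inverse (of_nat (card C')) *s sum f C'"
    using f C by blast
  fix y assume "\<exists>M C. lconst m M f \<and> transversal m M C \<and> y = inverse (of_nat (card C)) *s sum f C"
  then obtain M' C' where f': "lconst m M' f" and C': "transversal m M' C'"
    and y: "y = inverse (of_nat (card C')) *s sum f C'" by blast
  show "y = inverse (of_nat (card C)) *s sum f C"
    using transversal_sum_refine[OF f C C'] transversal_sum_refine[OF f' C' C] y
    by (cases "M \<le> M'") auto
qed

lemma avg_obtain:
  assumes "lconst m M f"
  obtains C where "transversal m M C" "finite C" "C \<noteq> {}" "C \<subseteq> pp m" "of_nat (card C) \<noteq> (0::'k)"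
    "avg m f = inverse (of_nat (card C)) *s sum f C"
proof -
  have le: "m \<le> M" using assms by (simp add: lconst_def)
  then obtain C where C: "transversal m M C" using transversal_exists by blast
  show ?thesis
    by (rule that[OF C transversalD(1)[OF C] transversal_nonempty[OF C] transversalD(2)[OF C]
          card_nz[OF C le] avg_eq[OF assms C]])
qed

lemma avg_cong:
  assumes "\<And>x. x \<in> pp m \<Longrightarrow> f x = g x"
  shows "avg m f = avg m g"
proof -
  have "lconst m M f \<longleftrightarrow> lconst m M g" for M unfolding lconst_def using assms by auto
  moreover have "sum f C = sum g C" if "transversal m M C" for C M
    by (rule sum.cong) (use assms transversalD(2)[OF that] in auto)
  ultimately have "(\<exists>M C. lconst m M f \<and> transversal m M C \<and> y = inverse (of_nat (card C)) *s sum f C)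
    \<longleftrightarrow> (\<exists>M C. lconst m M g \<and> transversal m M C \<and> y = inverse (of_nat (card C)) *s sum g C)" for y
    by metis
  then show ?thesis unfolding avg_def by presburger
qed

lemma avg_const [simp]: "avg m (\<lambda>_. y) = y"
proof -
  have "lconst m m (\<lambda>_. y)" by (simp add: lconst_def)
  then show ?thesis
    by (rule avg_obtain) (simp add: sum_const_scale)
qed

lemma avg_const': "(\<And>x. x \<in> pp m \<Longrightarrow> f x = y) \<Longrightarrow> avg m f = y"
  using avg_cong[of m f "\<lambda>_. y"] by simp

definition linmap :: "('v \<Rightarrow> 'v) \<Rightarrow> bool" where
  "linmap L \<longleftrightarrow> (\<forall>x y. L (x + y) = L x + L y) \<and> (\<forall>c x. L (c *s x) = c *s L x)"

lemma linmap_add: "linmap L \<Longrightarrow> L (x + y) = L x + L y"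
  and linmap_scale: "linmap L \<Longrightarrow> L (c *s x) = c *s L x"
  unfolding linmap_def by blast+

lemma linmap_0: "linmap L \<Longrightarrow> L 0 = 0"
  using linmap_scale[of L 0 0] by simp

lemma linmap_sum: "linmap L \<Longrightarrow> L (sum f A) = (\<Sum>x\<in>A. L (f x))"
  by (induction A rule: infinite_finite_induct) (simp_all add: linmap_0 linmap_add)

lemma linmap_uminus: "linmap L \<Longrightarrow> L (- x) = - L x"
  using linmap_scale[of L "-1" x] by simp

lemma linmap_diff: "linmap L \<Longrightarrow> L (x - y) = L x - L y"
  using linmap_add[of L x "- y"] linmap_uminus[of L y] by simp

lemma linmap_comp: "linmap L \<Longrightarrow> linmap L' \<Longrightarrow> linmap (\<lambda>x. L (L' x))"
  unfolding linmap_def by auto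

lemma avg_linmap:
  assumes L: "linmap L" and f: "lconst m M f"
  shows "avg m (\<lambda>x. L (f x)) = L (avg m f)"
proof -
  obtain C where C: "transversal m M C" "avg m f = inverse (of_nat (card C)) *s sum f C"
    using avg_obtain[OF f] .
  have "lconst m M (\<lambda>x. L (f x))" by (rule lconst_comp[OF f])
  then show ?thesis
    using avg_eq[of m M "\<lambda>x. L (f x)" C] C by (simp add: linmap_scale[OF L] linmap_sum[OF L])
qed

lemma linmap_smul: "linmap ((*s) c)"
  by (simp add: linmap_def scale_right_distrib mult.commute)

lemma avg_scale: "lconst m M f \<Longrightarrow> avg m (\<lambda>x. c *s f x) = c *s avg m f"
  by (rule avg_linmap[OF linmap_smul])

lemma avg_add:
  assumes f: "lconst m M f" and g: "lconst m M g"
  shows "avg m (\<lambda>x. f x + g x) = avg m f + avg m g"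
proof -
  obtain C where C: "transversal m M C" "avg m f = inverse (of_nat (card C)) *s sum f C"
    using avg_obtain[OF f] .
  have "lconst m M (\<lambda>x. f x + g x)" by (rule lconst_comp2[OF f g])
  then show ?thesis
    using avg_eq[of m M "\<lambda>x. f x + g x" C] avg_eq[OF g C(1)] C
    by (simp add: sum.distrib scale_right_distrib)
qed

text \<open>The level at which t |-> \<open>L t x\<close> is constant may depend on x; two vectors
  are compared at the larger of their levels.\<close>

lemma linmap_avg:
  assumes L: "\<And>t. t \<in> pp m \<Longrightarrow> linmap (L t)" and lc: "\<And>x. \<exists>M. lconst m M (\<lambda>t. L t x)"
  shows "linmap (\<lambda>x. avg m (\<lambda>t. L t x))"
  unfolding linmap_def
proof (intro conjI allI)
  fix x y c
  obtain M1 where M1: "lconst m M1 (\<lambda>t. L t x)" using lc by blast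
  obtain M2 where M2: "lconst m M2 (\<lambda>t. L t y)" using lc by blast
  have "avg m (\<lambda>t. L t (x + y)) = avg m (\<lambda>t. L t x + L t y)"
    by (rule avg_cong) (rule linmap_add[OF L])
  also have "\<dots> = avg m (\<lambda>t. L t x) + avg m (\<lambda>t. L t y)"
    by (rule avg_add[of _ "max M1 M2"]) (rule lconst_mono[OF M1], simp, rule lconst_mono[OF M2], simp)
  finally show "avg m (\<lambda>t. L t (x + y)) = avg m (\<lambda>t. L t x) + avg m (\<lambda>t. L t y)" .
  have "avg m (\<lambda>t. L t (c *s x)) = avg m (\<lambda>t. c *s L t x)"
    by (rule avg_cong) (rule linmap_scale[OF L])
  also have "\<dots> = c *s avg m (\<lambda>t. L t x)" by (rule avg_scale[OF M1])
  finally show "avg m (\<lambda>t. L t (c *s x)) = c *s avg m (\<lambda>t. L t x)" .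
qed

lemma subspace_linmap_vimage: "linmap L \<Longrightarrow> subspace S \<Longrightarrow> subspace {x. L x \<in> S}"
  by (auto simp: subspace_def linmap_0 linmap_add linmap_scale)

lemma subspace_linmap_image:
  assumes L: "linmap L" and S: "subspace S"
  shows "subspace (L ` S)"
  unfolding subspace_def
proof (intro conjI ballI allI)
  show "0 \<in> L ` S" using subspace_0[OF S] linmap_0[OF L] by force
  show "x + y \<in> L ` S" if xy: "x \<in> L ` S" "y \<in> L ` S" for x y
  proof -
    obtain a b where "a \<in> S" "b \<in> S" "x = L a" "y = L b" using xy by blast
    then show ?thesis using subspace_add[OF S] linmap_add[OF L, symmetric] by simp
  qed
  show "c *s x \<in> L ` S" if x: "x \<in> L ` S" for c x
  proof -
    obtain a where "a \<in> S" "x = L a" using x by blast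
    then show ?thesis using subspace_scale[OF S] linmap_scale[OF L, symmetric] by simp
  qed
qed

lemma subspace_range_mod:
  assumes L: "linmap L" and S: "subspace S"
  shows "subspace {y. \<exists>x. L x - y \<in> S}"
proof -
  have "(\<exists>x. L x - y \<in> S) \<longleftrightarrow> y \<in> {x + z |x z. x \<in> range L \<and> z \<in> S}" for y
  proof
    assume "\<exists>x. L x - y \<in> S"
    then obtain x where "- (L x - y) \<in> S" using subspace_neg[OF S] by blast
    moreover have "y = L x + - (L x - y)" by simp
    ultimately show "y \<in> {x + z |x z. x \<in> range L \<and> z \<in> S}" by blast
  next
    assume "y \<in> {x + z |x z. x \<in> range L \<and> z \<in> S}"
    then obtain x z where "z \<in> S" "y = L x + z" by blast
    then have "L x - y \<in> S" using subspace_neg[OF S] by simp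
    then show "\<exists>x. L x - y \<in> S" ..
  qed
  then have "{y. \<exists>x. L x - y \<in> S} = {x + z |x z. x \<in> range L \<and> z \<in> S}" by blast
  then show ?thesis
    using subspace_sums[OF subspace_linmap_image[OF L subspace_UNIV] S] by simp
qed

text \<open>Change of variables: a bijection that matches cosets at one depth \<open>j\<close>,
  where f is already constant, carries transversals to transversals of the same size.\<close>

lemma avg_bij:
  assumes f: "lconst m' (m' + int j) f"
    and b1: "\<And>x. x \<in> pp m \<Longrightarrow> b x \<in> pp m'" and b2: "\<And>y. y \<in> pp m' \<Longrightarrow> \<exists>x\<in>pp m. b x = y"
    and b3: "\<And>x y. x \<in> pp m \<Longrightarrow> y \<in> pp m \<Longrightarrow> b x - b y \<in> pp (m' + int j) \<longleftrightarrow> x - y \<in> pp (m + int j)"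
  shows "avg m (\<lambda>x. f (b x)) = avg m' f"
proof -
  obtain C where C: "transversal m (m + int j) C"
    using transversal_exists[of m "m + int j"] by auto
  note I = transversal_image[OF C b1 b2 b3]
  have "lconst m (m + int j) (\<lambda>x. f (b x))"
    by (rule lconstI, simp, rule lconstD[OF f]) (use b1 b3 in auto)
  then have "avg m (\<lambda>x. f (b x)) = inverse (of_nat (card C)) *s (\<Sum>x\<in>C. f (b x))"
    using C avg_eq by blast
  also have "\<dots> = inverse (of_nat (card (b ` C))) *s sum f (b ` C)"
    using I(2) by (simp add: sum.reindex card_image)
  also have "\<dots> = avg m' f" using avg_eq[OF f I(1)] by simp
  finally show ?thesis .
qed

text \<open>Both averages are normalised, so scaling by r produces no modulus factor.\<close>

lemma avg_affine:
  assumes f: "lconst m' M f" and r: "r \<noteq> 0" "m' = v r + m" and s: "s \<in> pp m'"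
  shows "avg m (\<lambda>x. f (r * x + s)) = avg m' f"
proof (rule avg_bij)
  have "m' \<le> M" using f by (simp add: lconst_def)
  then show "lconst m' (m' + int (nat (M - m'))) f" using f by simp
  show "r * x + s \<in> pp m'" if "x \<in> pp m" for x
    using that pp_mult_iff[OF r(1), of x m] r(2) pp_add s by simp
  show "\<exists>x\<in>pp m. r * x + s = y" if "y \<in> pp m'" for y
    using that pp_mult_iff[OF r(1), of "(y - s) / r" m] r pp_diff[OF that s]
    by (intro bexI[of _ "(y - s) / r"]) auto
  have e: "r * x + s - (r * y + s) = r * (x - y)" for x y by (simp add: algebra_simps)
  show "r * x + s - (r * y + s) \<in> pp (m' + int (nat (M - m')))
     \<longleftrightarrow> x - y \<in> pp (m + int (nat (M - m')))" for x y
    unfolding e using pp_mult_iff[OF r(1), of "x - y" "m + int (nat (M - m'))"] r(2)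
    by (simp add: algebra_simps)
qed

lemma avg_shift: "lconst m M f \<Longrightarrow> s \<in> pp m \<Longrightarrow> avg m (\<lambda>x. f (x + s)) = avg m f"
  using avg_affine[of m M f 1 m s] by simp

text \<open>In the coordinate c, inversion on 1 + p^N is c |-> - c / (1 + c). It is an involution,
  and an isometry because two values differ by (y - x) / ((1 + x) (1 + y)).\<close>

lemma avg_units_inverse:
  assumes f: "lconst N M (\<lambda>c. f (1 + c))" and N: "1 \<le> N"
  shows "avg N (\<lambda>c. f (1 / (1 + c))) = avg N (\<lambda>c. f (1 + c))"
proof -
  define b where "b c = - c / (1 + c)" for c :: 'e
  have nz: "1 + c \<noteq> 0" if "c \<in> pp N" for c using one_unit_nz N that by blast
  have e: "1 / (1 + c) = 1 + b c" if "c \<in> pp N" for c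
    using nz[OF that] by (simp add: b_def field_simps)
  have "avg N (\<lambda>c. f (1 / (1 + c))) = avg N (\<lambda>c. f (1 + b c))"
    by (rule avg_cong) (simp add: e)
  also have "\<dots> = avg N (\<lambda>c. f (1 + c))"
  proof (rule avg_bij[where f = "\<lambda>c. f (1 + c)"])
    have "N \<le> M" using f by (simp add: lconst_def)
    then show "lconst N (N + int (nat (M - N))) (\<lambda>c. f (1 + c))" using f by simp
    show bN: "b x \<in> pp N" if "x \<in> pp N" for x
      using that one_unit_div_iff[OF N that, of "- x" N] by (simp add: b_def)
    show "\<exists>x\<in>pp N. b x = y" if "y \<in> pp N" for y
    proof (intro bexI[of _ "b y"])
      have "1 + b y = 1 / (1 + y)" using e that by simp
      then have "b (b y) = - b y * (1 + y)" unfolding b_def[of "b y"] by simp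
      then show "b (b y) = y" using nz[OF that] by (simp add: b_def)
      show "b y \<in> pp N" using bN that .
    qed
    show "b x - b y \<in> pp (N + int (nat (M - N))) \<longleftrightarrow> x - y \<in> pp (N + int (nat (M - N)))"
      if "x \<in> pp N" "y \<in> pp N" for x y
    proof -
      have "b x - b y = ((y - x) / (1 + x)) / (1 + y)"
        using nz[OF that(1)] nz[OF that(2)] unfolding b_def by (simp add: field_simps)
      moreover have "y - x \<in> pp i \<longleftrightarrow> x - y \<in> pp i" for i
        using pp_uminus[of "x - y" i] by simp
      ultimately show ?thesis
        using one_unit_div_iff[OF N that(1), of "y - x"]
          one_unit_div_iff[OF N that(2), of "(y - x) / (1 + x)"] by simp
    qed
  qed
  finally show ?thesis .
qed

lemma avg_fubini:
  assumes m: "m \<le> M" "m' \<le> M"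
    and f: "\<And>x x' y y'. x \<in> pp m \<Longrightarrow> x' \<in> pp m \<Longrightarrow> y \<in> pp m' \<Longrightarrow> y' \<in> pp m' \<Longrightarrow>
      x - x' \<in> pp M \<Longrightarrow> y - y' \<in> pp M \<Longrightarrow> f x y = f x' y'"
  shows "avg m (\<lambda>x. avg m' (f x)) = avg m' (\<lambda>y. avg m (\<lambda>x. f x y))"
proof -
  obtain C where C: "transversal m M C" using transversal_exists m by blast
  obtain D where D: "transversal m' M D" using transversal_exists m by blast
  have l1: "lconst m' M (f x)" if "x \<in> pp m" for x
    by (rule lconstI, use m in simp, rule f, use that in simp_all)
  have l2: "lconst m M (\<lambda>x. f x y)" if "y \<in> pp m'" for y
    by (rule lconstI, use m in simp, rule f, use that in simp_all)
  have "lconst m M (\<lambda>x. avg m' (f x))"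
    by (rule lconstI[OF m(1)], rule avg_cong, rule f) simp_all
  then have "avg m (\<lambda>x. avg m' (f x)) = inverse (of_nat (card C)) *s (\<Sum>x\<in>C. avg m' (f x))"
    by (rule avg_eq[OF _ C])
  also have "(\<Sum>x\<in>C. avg m' (f x)) = (\<Sum>x\<in>C. inverse (of_nat (card D)) *s sum (f x) D)"
    by (rule sum.cong) (use avg_eq[OF l1 D] transversalD(2)[OF C] in auto)
  finally have 1: "avg m (\<lambda>x. avg m' (f x))
    = (inverse (of_nat (card C)) * inverse (of_nat (card D))) *s (\<Sum>x\<in>C. \<Sum>y\<in>D. f x y)"
    by (simp flip: scale_sum_right)
  have "lconst m' M (\<lambda>y. avg m (\<lambda>x. f x y))"
    by (rule lconstI[OF m(2)], rule avg_cong, rule f) simp_all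
  then have "avg m' (\<lambda>y. avg m (\<lambda>x. f x y)) = inverse (of_nat (card D)) *s (\<Sum>y\<in>D. avg m (\<lambda>x. f x y))"
    by (rule avg_eq[OF _ D])
  also have "(\<Sum>y\<in>D. avg m (\<lambda>x. f x y)) = (\<Sum>y\<in>D. inverse (of_nat (card C)) *s (\<Sum>x\<in>C. f x y))"
    by (rule sum.cong) (use avg_eq[OF l2 C] transversalD(2)[OF D] in auto)
  finally have "avg m' (\<lambda>y. avg m (\<lambda>x. f x y))
    = (inverse (of_nat (card D)) * inverse (of_nat (card C))) *s (\<Sum>y\<in>D. \<Sum>x\<in>C. f x y)"
    by (simp flip: scale_sum_right)
  then show ?thesis using 1 sum.swap[of "\<lambda>x y. f x y" D C] by (simp add: mult.commute)
qed

text \<open>The constant is the inverse of the index of p^m' in p^m: among the cosets of p^m', only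
  that of \<open>d0\<close>, the one containing 0, contributes.\<close>

lemma avg_restrict:
  assumes m: "m \<le> m'"
  shows "\<exists>k. k \<noteq> 0 \<and> (\<forall>f M. lconst m' M f \<longrightarrow> avg m (\<lambda>x. if x \<in> pp m' then f x else 0) = k *s avg m' f)"
proof -
  obtain D where D: "transversal m m' D" using transversal_exists[OF m] by blast
  note D' = transversalD[OF D]
  obtain d0 where d0: "d0 \<in> D" "d0 \<in> pp m'"
    using D'(3)[of 0] by auto
  have "avg m (\<lambda>x. if x \<in> pp m' then f x else 0) = inverse (of_nat (card D)) *s avg m' f"
    if f: "lconst m' M f" for f M
  proof -
    define g where "g x = (if x \<in> pp m' then f x else 0)" for x
    have m': "m' \<le> M" using f by (simp add: lconst_def)
    obtain C where C: "transversal m' M C" using transversal_exists[OF m'] by blast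
    have Cpp: "c \<in> pp m'" if "c \<in> C" for c using transversalD(2)[OF C] that by blast
    note pr = transversal_prod[OF D C m m']
    have "lconst m M g"
    proof (rule lconstI)
      fix x y assume a: "x \<in> pp m" "y \<in> pp m" "x - y \<in> pp M"
      then have "x \<in> pp m' \<longleftrightarrow> y \<in> pp m'"
        using pp_add_iff[OF pp_mono[OF m' a(3)], of y] by simp
      then show "g x = g y" using lconstD[OF f _ _ a(3)] by (auto simp: g_def)
    qed (use m m' in simp)
    then have "avg m g = inverse (of_nat (card ((\<lambda>(c, d). c + d) ` (D \<times> C))))
        *s sum g ((\<lambda>(c, d). c + d) ` (D \<times> C))"
      using avg_eq[OF _ pr(1)] by blast
    also have "card ((\<lambda>(c, d). c + d) ` (D \<times> C)) = card D * card C"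
      by (simp add: card_image[OF pr(2)] card_cartesian_product)
    also have "sum g ((\<lambda>(c, d). c + d) ` (D \<times> C)) = (\<Sum>d\<in>D. \<Sum>c\<in>C. g (d + c))"
      unfolding sum.reindex[OF pr(2)] sum.cartesian_product by (rule sum.cong) auto
    also have "\<dots> = (\<Sum>d\<in>D. if d = d0 then \<Sum>c\<in>C. f (d0 + c) else 0)"
    proof (rule sum.cong[OF refl])
      fix d assume d: "d \<in> D"
      show "(\<Sum>c\<in>C. g (d + c)) = (if d = d0 then \<Sum>c\<in>C. f (d0 + c) else 0)"
      proof (cases "d = d0")
        case True
        then show ?thesis using d0 Cpp pp_add by (auto simp: g_def intro!: sum.cong)
      next
        case False
        then have "d \<notin> pp m'" using D'(4)[OF d d0(1)] pp_diff[OF _ d0(2)] by blast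
        then have "g (d + c) = 0" if "c \<in> C" for c
          using pp_add_iff[OF Cpp[OF that], of d] by (simp add: g_def)
        then show ?thesis using False by simp
      qed
    qed
    also have "\<dots> = (\<Sum>c\<in>C. f (d0 + c))" using d0(1) D'(1) by simp
    finally have "avg m g = inverse (of_nat (card D)) *s (inverse (of_nat (card C)) *s (\<Sum>c\<in>C. f (c + d0)))"
      by (simp add: mult.commute add.commute)
    also have "lconst m' M (\<lambda>x. f (x + d0))"
      by (rule lconstI[OF m'], rule lconstD[OF f]) (use d0(2) pp_add in auto)
    then have "inverse (of_nat (card C)) *s (\<Sum>c\<in>C. f (c + d0)) = avg m' (\<lambda>x. f (x + d0))"
      using avg_eq[OF _ C] by metis
    also have "\<dots> = avg m' f" using avg_shift[OF f d0(2)] .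
    finally show ?thesis unfolding g_def .
  qed
  then show ?thesis using card_nz[OF D m] by (intro exI[of _ "inverse (of_nat (card D))"]) auto
qed

text \<open>A translation scales the integrand by a value of the character different from 1.\<close>

lemma avg_character_zero:
  assumes chi: "lconst m M chi" "\<And>x y. x \<in> pp m \<Longrightarrow> y \<in> pp m \<Longrightarrow> chi (x + y) = chi x * chi y"
    and s: "s \<in> pp m" "chi s \<noteq> (1::'k)"
  shows "avg m (\<lambda>x. chi x *s y) = 0"
proof -
  define a where "a = avg m (\<lambda>x. chi x *s y)"
  have l: "lconst m M (\<lambda>x. chi x *s y)" by (rule lconst_comp[OF chi(1)])
  have "a = avg m (\<lambda>x. chi (x + s) *s y)" unfolding a_def using avg_shift[OF l s(1)] by simp
  also have "\<dots> = avg m (\<lambda>x. chi s *s (chi x *s y))"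
    by (rule avg_cong) (simp add: chi(2) s(1) mult.commute)
  also have "\<dots> = chi s *s a" unfolding a_def by (rule avg_scale[OF l])
  finally have "(chi s - 1) *s a = 0" by (simp add: scale_left_diff_distrib)
  then show ?thesis using s(2) by (simp add: a_def)
qed

end

section \<open>Spectral projections for the unipotent radical\<close>

lemma mdet_mmult: "mdet (mmult g h) = mdet g * mdet h"
  by (cases g; cases h) (simp add: algebra_simps)

locale gl2_rep = avg_space v smul
  for v :: "'e::field \<Rightarrow> int" and smul :: "'k::field \<Rightarrow> 'v::ab_group_add \<Rightarrow> 'v" (infixr \<open>*s\<close> 75) +
  fixes rho :: "'e mat2 \<Rightarrow> 'v \<Rightarrow> 'v" and psi :: "'e \<Rightarrow> 'k"
  assumes rep: "is_rep smul rho" and smooth: "smooth_rep v rho"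
    and irr: "\<And>S. invariant_subspace smul rho GL2 S \<Longrightarrow> S = {0} \<or> S = UNIV"
    and psi_add: "psi (x + y) = psi x * psi y" and psi_nz: "psi x \<noteq> 0"
    and psi_triv: "x \<in> pp 1 \<Longrightarrow> psi x = 1" and psi_nontriv: "\<exists>x\<in>pp 0. psi x \<noteq> 1"
begin

lemma GL2_iff [simp]: "(a, b, c, d) \<in> GL2 \<longleftrightarrow> a * d - b * c \<noteq> 0"
  by (simp add: GL2_def)

lemma GL2_mmult [simp]: "g \<in> GL2 \<Longrightarrow> h \<in> GL2 \<Longrightarrow> mmult g h \<in> GL2"
  by (simp add: GL2_def mdet_mmult)

lemma rho_linmap [simp]: "g \<in> GL2 \<Longrightarrow> linmap (rho g)"
  using rep unfolding is_rep_def linmap_def by blast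

lemma rho_0 [simp]: "g \<in> GL2 \<Longrightarrow> rho g 0 = 0"
  by (rule linmap_0) simp

lemma rho_mmult: "g \<in> GL2 \<Longrightarrow> h \<in> GL2 \<Longrightarrow> rho g (rho h x) = rho (mmult g h) x"
  using rep unfolding is_rep_def by simp

lemma rho_one [simp]: "rho (1, 0, 0, 1) x = x"
  using rep unfolding is_rep_def mone_def by simp

lemma irr_eq_UNIV:
  assumes "subspace S" "\<And>g x. g \<in> GL2 \<Longrightarrow> x \<in> S \<Longrightarrow> rho g x \<in> S" "x \<in> S" "x \<noteq> 0"
  shows "S = UNIV"
  using irr[of S] assms unfolding invariant_subspace_def by blast

section \<open>Unipotent, torus, central and Weyl operators\<close>

definition rU :: "'e \<Rightarrow> 'v \<Rightarrow> 'v" where "rU t = rho (1, t, 0, 1)"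
definition rT :: "'e \<Rightarrow> 'v \<Rightarrow> 'v" where "rT a = rho (a, 0, 0, 1)"
definition rZ :: "'e \<Rightarrow> 'v \<Rightarrow> 'v" where "rZ a = rho (a, 0, 0, a)"
definition rW :: "'v \<Rightarrow> 'v" where "rW = rho (0, 1, -1, 0)"

lemma linmap_U [simp]: "linmap (rU t)"
  and linmap_T [simp]: "a \<noteq> 0 \<Longrightarrow> linmap (rT a)"
  and linmap_Z [simp]: "a \<noteq> 0 \<Longrightarrow> linmap (rZ a)"
  and linmap_W [simp]: "linmap rW"
  by (simp_all add: rU_def rT_def rZ_def rW_def)

lemma U_add: "rU s (rU t x) = rU (s + t) x"
  by (simp add: rU_def rho_mmult add.commute)

lemma T_1 [simp]: "rT 1 x = x"
  by (simp add: rT_def)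

lemma T_mult: "a \<noteq> 0 \<Longrightarrow> b \<noteq> 0 \<Longrightarrow> rT a (rT b x) = rT (a * b) x"
  by (simp add: rT_def rho_mmult)

lemma T_U: "a \<noteq> 0 \<Longrightarrow> rT a (rU t x) = rU (a * t) (rT a x)"
  by (simp add: rU_def rT_def rho_mmult)

text \<open>The Weyl element turns diag(a,1) into diag(1,a), which is diag(1/a,1) times the scalar
  matrix a. The torus parameter is inverted at the price of a central factor.\<close>

lemma W_T: "a \<noteq> 0 \<Longrightarrow> rW (rT a x) = rT (1 / a) (rZ a (rW x))"
  by (simp add: rW_def rT_def rZ_def rho_mmult)

lemma Z_rho: "a \<noteq> 0 \<Longrightarrow> g \<in> GL2 \<Longrightarrow> rZ a (rho g x) = rho g (rZ a x)"
proof -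
  assume a: "a \<noteq> 0" "g \<in> GL2"
  have "mmult (a, 0, 0, a) g = mmult g (a, 0, 0, a)"
    by (cases g) (simp add: mult.commute)
  then show ?thesis using a by (simp add: rZ_def rho_mmult)
qed

lemma psi_0 [simp]: "psi 0 = 1"
  by (rule psi_triv) simp

lemma psi_uminus: "psi (- x) = inverse (psi x)"
  using psi_add[of x "- x"] psi_nz[of x] by (simp add: field_simps)

lemma psi_eq: "x - y \<in> pp 1 \<Longrightarrow> psi x = psi y"
  using psi_add[of "x - y" y] psi_triv[of "x - y"] by simp

definition fixed_at :: "int \<Rightarrow> 'v \<Rightarrow> bool" where
  "fixed_at n x \<longleftrightarrow> 1 \<le> n \<and> (\<forall>g\<in>congr_subgroup v n. rho g x = x)"

lemma fixed_at_exists: "\<exists>n. fixed_at n x"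
  using smooth unfolding smooth_rep_def fixed_at_def by blast

lemma fixed_at_mono: "fixed_at n x \<Longrightarrow> n \<le> n' \<Longrightarrow> fixed_at n' x"
proof -
  assume a: "fixed_at n x" "n \<le> n'"
  have "congr_subgroup v n' \<subseteq> congr_subgroup v n"
    unfolding congr_subgroup_def vge_iff_pp using pp_mono[OF a(2)] by auto
  then show ?thesis using a unfolding fixed_at_def by auto
qed

text \<open>The determinant is congruent to 1 modulo p^n and therefore nonzero, so the entrywise
  congruences already put the matrix into \<open>congr_subgroup v n\<close>.\<close>

lemma fixed_atD:
  assumes "fixed_at n x" "a - 1 \<in> pp n" "b \<in> pp n" "c \<in> pp n" "d - 1 \<in> pp n"
  shows "rho (a, b, c, d) x = x"
proof -
  have n: "1 \<le> n" using assms(1) by (simp add: fixed_at_def)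
  have mult: "y * z \<in> pp n" if "y \<in> pp n" "z \<in> pp n" for y z
    using pp_mult_int[OF pp_mono[of 0 n] that(2)] that(1) n by simp
  have "(a - 1) * (d - 1) + (a - 1) + (d - 1) - b * c \<in> pp n"
    using assms mult pp_add pp_diff by presburger
  moreover have "a * d - b * c = 1 + ((a - 1) * (d - 1) + (a - 1) + (d - 1) - b * c)"
    by (simp add: algebra_simps)
  ultimately have "a * d - b * c \<noteq> 0" using one_unit_nz[OF n] by metis
  then have "(a, b, c, d) \<in> congr_subgroup v n"
    using assms unfolding congr_subgroup_def vge_iff_pp by simp
  then show ?thesis using assms(1) unfolding fixed_at_def by blast
qed

lemma fixed_at_ge_1: "fixed_at n x \<Longrightarrow> 1 \<le> n"
  by (simp add: fixed_at_def)

lemma fixed_at_U: "fixed_at n x \<Longrightarrow> t \<in> pp n \<Longrightarrow> rU t x = x"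
  unfolding rU_def by (rule fixed_atD) auto

lemma fixed_at_T: "fixed_at n x \<Longrightarrow> c \<in> pp n \<Longrightarrow> rT (1 + c) x = x"
  unfolding rT_def by (rule fixed_atD) auto

lemma fixed_at_Z: "fixed_at n x \<Longrightarrow> c \<in> pp n \<Longrightarrow> rZ (1 + c) x = x"
  unfolding rZ_def by (rule fixed_atD) auto

lemma lconst_U:
  assumes "fixed_at n x"
  shows "lconst m (max m n) (\<lambda>t. rU t x)"
proof (rule lconstI)
  fix s t assume "s - t \<in> pp (max m n)"
  then have "rU (s - t) x = x" using fixed_at_U[OF assms] pp_mono[of n "max m n"] by simp
  then show "rU s x = rU t x" using U_add[of t "s - t" x] by simp
qed simp

lemma lconst_psi: "\<exists>M. lconst m M (\<lambda>t. psi (b * t))"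
proof -
  obtain k where k: "b \<in> pp k" using pp_exists by blast
  have "lconst m (max m (1 - k)) (\<lambda>t. psi (b * t))"
  proof (rule lconstI)
    fix x y assume "x - y \<in> pp (max m (1 - k))"
    then have "x - y \<in> pp (1 - k)" using pp_mono[of "1 - k" "max m (1 - k)"] by simp
    then have "b * (x - y) \<in> pp 1" using pp_mult[OF k, of "x - y" "1 - k"] by simp
    then show "psi (b * x) = psi (b * y)" by (intro psi_eq) (simp add: algebra_simps)
  qed simp
  then show ?thesis by blast
qed

lemma lconst_psiU: "\<exists>M. lconst m M (\<lambda>t. psi (- (b * t)) *s rU t x)"
proof -
  obtain n where "fixed_at n x" using fixed_at_exists by blast
  then obtain M1 where M1: "lconst m M1 (\<lambda>t. rU t x)" using lconst_U by blast
  obtain M2 where M2: "lconst m M2 (\<lambda>t. psi (- b * t))" using lconst_psi by blast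
  have "lconst m (max M1 M2) (\<lambda>t. psi (- b * t) *s rU t x)"
    by (rule lconst_comp2) (rule lconst_mono[OF M2], simp, rule lconst_mono[OF M1], simp)
  then show ?thesis by auto
qed

lemma lconst_T:
  assumes x: "fixed_at n x" and N: "1 \<le> N"
  shows "lconst N (max N n) (\<lambda>c. rT (1 + c) x)"
proof (rule lconstI)
  fix c d assume cd: "c \<in> pp N" "d \<in> pp N" "c - d \<in> pp (max N n)"
  have nz: "1 + c \<noteq> 0" "1 + d \<noteq> 0" using one_unit_nz[OF N] cd by auto
  have "(c - d) / (1 + d) \<in> pp (max N n)" using one_unit_div_iff[OF N cd(2)] cd(3) by simp
  then have "rT (1 + (c - d) / (1 + d)) x = x"
    using fixed_at_T[OF x] pp_mono[of n "max N n"] by simp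
  moreover have e: "1 + (c - d) / (1 + d) = (1 + c) / (1 + d)" using nz by (simp add: field_simps)
  moreover have "rT (1 + d) (rT ((1 + c) / (1 + d)) x) = rT (1 + c) x"
    using nz by (subst T_mult) auto
  ultimately show "rT (1 + c) x = rT (1 + d) x" by simp
qed simp

text \<open>If the restriction of the representation to the unipotent radical is viewed as a sheaf on the
  dual group, identified with the field by means of psi, then this operator is the
  restriction of sections to the ball of radius N around b.\<close>

definition spec :: "'e \<Rightarrow> int \<Rightarrow> 'v \<Rightarrow> 'v" where
  "spec b N x = avg (1 - N) (\<lambda>t. psi (- (b * t)) *s rU t x)"

lemma linmap_spec [simp]: "linmap (spec b N)"
  unfolding spec_def[abs_def]
  by (rule linmap_avg[OF linmap_comp[OF linmap_smul linmap_U] lconst_psiU])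

lemma linmap_of_spec: "linmap L \<Longrightarrow> L (spec b N x) = avg (1 - N) (\<lambda>t. psi (- (b * t)) *s L (rU t x))"
proof -
  assume L: "linmap L"
  obtain M where M: "lconst (1 - N) M (\<lambda>t. psi (- (b * t)) *s rU t x)" using lconst_psiU by blast
  show ?thesis unfolding spec_def using avg_linmap[OF L M] by (simp add: linmap_scale[OF L])
qed

lemma Z_spec: "a \<noteq> 0 \<Longrightarrow> rZ a (spec b N x) = spec b N (rZ a x)"
  by (simp add: linmap_of_spec[OF linmap_Z]) (simp add: spec_def rU_def Z_rho)

lemma U_spec_commute: "rU s (spec b N x) = spec b N (rU s x)"
  by (simp add: linmap_of_spec[OF linmap_U] U_add) (simp add: spec_def U_add add.commute)

lemma spec_U:
  assumes "s \<in> pp (1 - N)"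
  shows "spec b N (rU s x) = psi (b * s) *s spec b N x"
proof -
  obtain M where M: "lconst (1 - N) M (\<lambda>t. psi (- (b * t)) *s rU t x)" using lconst_psiU by blast
  have "spec b N (rU s x) = avg (1 - N) (\<lambda>t. psi (b * s) *s (psi (- (b * (t + s))) *s rU (t + s) x))"
    unfolding spec_def
    by (rule avg_cong) (simp add: U_add psi_add[symmetric] algebra_simps)
  also have "\<dots> = psi (b * s) *s avg (1 - N) (\<lambda>t. psi (- (b * (t + s))) *s rU (t + s) x)"
  proof (rule avg_scale)
    show "lconst (1 - N) M (\<lambda>t. psi (- (b * (t + s))) *s rU (t + s) x)"
      by (rule lconstI[OF lconst_le[OF M]], rule lconstD[OF M]) (use assms pp_add in auto)
  qed
  also have "avg (1 - N) (\<lambda>t. psi (- (b * (t + s))) *s rU (t + s) x) = spec b N x"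
    unfolding spec_def by (rule avg_shift[OF M assms])
  finally show ?thesis .
qed

lemma U_spec: "s \<in> pp (1 - N) \<Longrightarrow> rU s (spec b N x) = psi (b * s) *s spec b N x"
  by (simp add: U_spec_commute spec_U)

lemma spec_eigen:
  assumes "\<And>t. t \<in> pp (1 - N) \<Longrightarrow> rU t x = psi (b * t) *s x"
  shows "spec b N x = x"
  unfolding spec_def by (rule avg_const') (simp add: assms psi_uminus psi_nz)

lemma spec_idem: "spec b N (spec b N x) = spec b N x"
  by (rule spec_eigen) (rule U_spec)

text \<open>Since \<open>psi\<close> is trivial on p^1, characters with parameters in p^N are
  trivial on p^(1-N). This is the origin of the index \<open>1 - N\<close> in
  \<open>spec\<close>.\<close>

lemma spec_center: "b - b' \<in> pp N \<Longrightarrow> spec b N x = spec b' N x"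
  unfolding spec_def
proof (rule avg_cong)
  fix t assume b: "b - b' \<in> pp N" and t: "t \<in> pp (1 - N)"
  have "(b - b') * t \<in> pp 1" using pp_mult[OF b t] by simp
  then have "psi (- (b * t)) = psi (- (b' * t))"
    by (intro psi_eq) (simp add: algebra_simps flip: pp_uminus[of "b' * t - b * t"])
  then show "psi (- (b * t)) *s rU t x = psi (- (b' * t)) *s rU t x" by simp
qed

text \<open>Conjugation by diag(a,1) scales the unipotent parameter by a, so on the dual side the
  centre b moves to b / a and the exponent N of the ball to N - v a.\<close>

lemma T_spec:
  assumes a: "a \<noteq> 0"
  shows "rT a (spec b N x) = spec (b / a) (N - v a) (rT a x)"
proof -
  obtain M where M: "lconst (1 - (N - v a)) M (\<lambda>t. psi (- (b / a * t)) *s rU t (rT a x))"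
    using lconst_psiU by blast
  have "rT a (spec b N x) = avg (1 - N) (\<lambda>t. psi (- (b / a * (a * t + 0))) *s rU (a * t + 0) (rT a x))"
    by (simp add: linmap_of_spec[OF linmap_T[OF a]] T_U a)
  also have "\<dots> = spec (b / a) (N - v a) (rT a x)"
    unfolding spec_def by (rule avg_affine[OF M a]) simp_all
  finally show ?thesis .
qed

text \<open>A point of the integers at which \<open>psi\<close> is nontrivial is rescaled by 1 / x.
  With \<open>psi_triv\<close> this makes p^N the exact annihilator of p^(1-N).\<close>

lemma psi_detect:
  assumes "x \<notin> pp N"
  shows "\<exists>t\<in>pp (1 - N). psi (x * t) \<noteq> 1"
proof -
  obtain y where y: "y \<in> pp 0" "psi y \<noteq> 1" using psi_nontriv by blast
  have x: "x \<noteq> 0" "v x < N" using assms by (auto simp: pp_def)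
  have "y / x \<in> pp (- v x)" using pp_mult_iff[OF x(1), of "y / x" "- v x"] y(1) x(1) by simp
  then have "y / x \<in> pp (1 - N)" by (rule pp_mono[rotated]) (use x in simp)
  then show ?thesis using y x by (intro bexI[of _ "y / x"]) auto
qed

text \<open>A ball is the disjoint union of its subballs, and averaging over the subballs instead of
  summing accounts for k. On the group side the average of psi(- c t) over c in p^N is the indicator
  function of p^(1-N), which cuts the integral over p^(1-N') down to the smaller group.\<close>

lemma spec_split:
  assumes "N \<le> N'"
  shows "\<exists>k. k \<noteq> 0 \<and> (\<forall>b x. avg N (\<lambda>c. spec (b + c) N' x) = k *s spec b N x)"
proof -
  obtain k where k: "k \<noteq> 0"
    "\<And>f M. lconst (1 - N) M f \<Longrightarrow> avg (1 - N') (\<lambda>x. if x \<in> pp (1 - N) then f x else 0) = k *s avg (1 - N) f"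
    using avg_restrict[of "1 - N'" "1 - N"] assms by auto
  have "avg N (\<lambda>c. spec (b + c) N' x) = k *s spec b N x" for b x
  proof -
    obtain M where M: "lconst (1 - N') M (\<lambda>t. psi (- (b * t)) *s rU t x)" using lconst_psiU by blast
    define f where "f c t = psi (- (c * t)) *s (psi (- (b * t)) *s rU t x)" for c t
    have fe: "psi (- ((b + c) * t)) *s rU t x = f c t" for c t
      by (simp add: f_def psi_add[symmetric] algebra_simps)
    have "avg N (\<lambda>c. spec (b + c) N' x) = avg N (\<lambda>c. avg (1 - N') (f c))"
      unfolding spec_def fe ..
    also have "\<dots> = avg (1 - N') (\<lambda>t. avg N (\<lambda>c. f c t))"
    proof (rule avg_fubini)
      \<comment> \<open>A common level for c and t: \<open>N'\<close> brings (c - c') * t into p^1,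
        \<open>1 - N\<close> does so for c' * (t - t'), and \<open>M\<close> handles the
        vector.\<close>
      let ?M = "max (max M N') (max (1 - N) (1 - N'))"
      show "N \<le> ?M" "1 - N' \<le> ?M" using assms by auto
      fix c c' t t' assume a: "c \<in> pp N" "c' \<in> pp N" "t \<in> pp (1 - N')" "t' \<in> pp (1 - N')"
        "c - c' \<in> pp ?M" "t - t' \<in> pp ?M"
      have "(c - c') * t \<in> pp (N' + (1 - N'))"
        by (rule pp_mult[OF pp_mono[OF _ a(5)] a(3)]) simp
      moreover have "c' * (t - t') \<in> pp (N + (1 - N))"
        by (rule pp_mult[OF a(2) pp_mono[OF _ a(6)]]) simp
      ultimately have "(c - c') * t + c' * (t - t') \<in> pp 1" using pp_add by simp
      then have "psi (- (c * t)) = psi (- (c' * t'))"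
        by (intro psi_eq) (simp add: algebra_simps flip: pp_uminus[of "c' * t' - c * t"])
      moreover have "psi (- (b * t)) *s rU t x = psi (- (b * t')) *s rU t' x"
        by (rule lconstD[OF M a(3,4) pp_mono[OF _ a(6)]]) simp
      ultimately show "f c t = f c' t'" by (simp add: f_def)
    qed
    also have "\<dots> = avg (1 - N') (\<lambda>t. if t \<in> pp (1 - N) then psi (- (b * t)) *s rU t x else 0)"
    proof (rule avg_cong)
      fix t assume t: "t \<in> pp (1 - N')"
      show "avg N (\<lambda>c. f c t) = (if t \<in> pp (1 - N) then psi (- (b * t)) *s rU t x else 0)"
      proof (cases "t \<in> pp (1 - N)")
        case True
        then have "psi (- (c * t)) = 1" if "c \<in> pp N" for c
          using pp_mult[OF that True] by (intro psi_triv) simp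
        then show ?thesis using True by (auto simp: f_def intro!: avg_const')
      next
        case False
        obtain c where c: "c \<in> pp N" "psi (t * c) \<noteq> 1" using psi_detect[OF False] by auto
        obtain M' where M': "lconst N M' (\<lambda>c. psi (- t * c))" using lconst_psi by blast
        have "avg N (\<lambda>c. psi (- t * c) *s (psi (- (b * t)) *s rU t x)) = 0"
        proof (rule avg_character_zero[OF M' _ c(1)])
          show "psi (- t * (x + y)) = psi (- t * x) * psi (- t * y)" for x y
            by (simp add: psi_add[symmetric] algebra_simps)
          show "psi (- t * c) \<noteq> 1" using c(2) by (simp add: psi_uminus)
        qed
        then show ?thesis using False by (simp add: f_def mult.commute)
      qed
    qed
    also have "\<dots> = k *s spec b N x"
      unfolding spec_def
    proof (rule k(2))
      show "lconst (1 - N) (max M (1 - N)) (\<lambda>t. psi (- (b * t)) *s rU t x)"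
      proof (rule lconstI)
        fix s t assume "s \<in> pp (1 - N)" "t \<in> pp (1 - N)" "s - t \<in> pp (max M (1 - N))"
        then show "psi (- (b * s)) *s rU s x = psi (- (b * t)) *s rU t x"
          by (intro lconstD[OF M]) (auto intro: pp_mono[rotated] simp: assms)
      qed simp
    qed
    finally show ?thesis .
  qed
  then show ?thesis using k(1) by blast
qed

section \<open>The idempotent attached to the ball 1 + p^N\<close>

definition avgT :: "int \<Rightarrow> 'v \<Rightarrow> 'v" where
  "avgT N x = avg N (\<lambda>c. rT (1 + c) x)"

text \<open>The idempotent of the compact group of matrices with rows (u, t) and (0, 1), u in 1 +
  p^N and t in p^(1-N), for its character psi(t). This is a character because (u - 1) * t lies in
  p^1.\<close>

definition proj :: "int \<Rightarrow> 'v \<Rightarrow> 'v" where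
  "proj N x = avgT N (spec 1 N x)"

context
  fixes N :: int
  assumes N: "1 \<le> N"
begin

lemma unit_nz: "c \<in> pp N \<Longrightarrow> 1 + c \<noteq> 0"
  using one_unit_nz[OF N] .

lemma lconst_T_ex: "\<exists>M. lconst N M (\<lambda>c. rT (1 + c) x)"
  using fixed_at_exists[of x] lconst_T[OF _ N] by blast

lemma linmap_of_avgT: "linmap L \<Longrightarrow> L (avgT N x) = avg N (\<lambda>c. L (rT (1 + c) x))"
  unfolding avgT_def using avg_linmap lconst_T_ex[of x] by metis

lemma linmap_avgT [simp]: "linmap (avgT N)"
  unfolding avgT_def[abs_def] by (rule linmap_avg[OF linmap_T lconst_T_ex]) (rule unit_nz)

lemma avgT_T:
  assumes c: "c \<in> pp N"
  shows "avgT N (rT (1 + c) x) = avgT N x"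
proof -
  obtain M where M: "lconst N M (\<lambda>c. rT (1 + c) x)" using lconst_T_ex by blast
  have "avgT N (rT (1 + c) x) = avg N (\<lambda>d. rT (1 + ((1 + c) * d + c)) x)"
    unfolding avgT_def
  proof (rule avg_cong)
    fix d assume "d \<in> pp N"
    then have "rT (1 + d) (rT (1 + c) x) = rT ((1 + d) * (1 + c)) x"
      using unit_nz c by (simp add: T_mult)
    also have "(1 + d) * (1 + c) = 1 + ((1 + c) * d + c)" by (simp add: algebra_simps)
    finally show "rT (1 + d) (rT (1 + c) x) = rT (1 + ((1 + c) * d + c)) x" .
  qed
  also have "\<dots> = avgT N x"
    unfolding avgT_def
    by (rule avg_affine[OF M]) (use c unit_nz one_unit_v[OF N] in auto)
  finally show ?thesis .
qed

lemma T_avgT: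
  assumes c: "c \<in> pp N"
  shows "rT (1 + c) (avgT N x) = avgT N x"
proof -
  have "rT (1 + c) (avgT N x) = avg N (\<lambda>d. rT (1 + c) (rT (1 + d) x))"
    using linmap_of_avgT linmap_T unit_nz c by blast
  also have "\<dots> = avgT N (rT (1 + c) x)"
    unfolding avgT_def by (rule avg_cong) (simp add: T_mult unit_nz c mult.commute)
  finally show ?thesis using avgT_T[OF c] by simp
qed

lemma avgT_id: "(\<And>c. c \<in> pp N \<Longrightarrow> rT (1 + c) x = x) \<Longrightarrow> avgT N x = x"
  unfolding avgT_def by (rule avg_const')

text \<open>Multiplication by an element of 1 + p^N permutes the dual ball 1 + p^N, so the centre
  can be moved back to 1.\<close>

lemma T_spec_unit:
  assumes c: "c \<in> pp N"
  shows "rT (1 + c) (spec 1 N x) = spec 1 N (rT (1 + c) x)"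
proof -
  have "1 / (1 + c) - 1 = - (c / (1 + c))" using unit_nz[OF c] by (simp add: field_simps)
  then have "1 / (1 + c) - 1 \<in> pp N" using one_unit_div_iff[OF N c] c by simp
  then show ?thesis
    using T_spec[OF unit_nz[OF c], of 1 N x] one_unit_v[OF N c] spec_center by simp
qed

lemma avgT_spec: "avgT N (spec 1 N x) = spec 1 N (avgT N x)"
proof -
  have "spec 1 N (avgT N x) = avg N (\<lambda>c. spec 1 N (rT (1 + c) x))"
    by (rule linmap_of_avgT) simp
  also have "\<dots> = avgT N (spec 1 N x)"
    unfolding avgT_def by (rule avg_cong) (simp add: T_spec_unit)
  finally show ?thesis by simp
qed

lemma linmap_proj [simp]: "linmap (proj N)"
  unfolding proj_def by (rule linmap_comp) simp_all

lemma avgT_idem: "avgT N (avgT N x) = avgT N x"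
  by (rule avgT_id) (rule T_avgT)

lemma avgT_proj: "avgT N (proj N x) = proj N x"
  by (simp add: proj_def avgT_idem)

lemma spec_proj: "spec 1 N (proj N x) = proj N x"
  by (simp add: proj_def avgT_spec spec_idem)

lemma proj_idem: "proj N (proj N x) = proj N x"
  by (subst proj_def) (simp add: spec_proj avgT_proj)

lemma proj_T: "c \<in> pp N \<Longrightarrow> proj N (rT (1 + c) x) = proj N x"
  by (simp add: proj_def avgT_spec[symmetric] flip: T_spec_unit) (simp add: avgT_T)

text \<open>The translates of the small ball 1 + p^N' under the units 1 + p^N sweep out the large
  ball 1 + p^N. Thus \<open>proj N\<close> can be computed, up to a nonzero factor, from an
  arbitrarily fine \<open>spec 1 N'\<close>, on which unipotents of any prescribed size act by
  scalars.\<close>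

lemma avgT_spec_fine:
  assumes "N \<le> N'"
  shows "\<exists>k. k \<noteq> 0 \<and> (\<forall>x. avgT N (spec 1 N' (avgT N x)) = k *s proj N x)"
proof -
  obtain k where k: "k \<noteq> 0" "\<And>b x. avg N (\<lambda>c. spec (b + c) N' x) = k *s spec b N x"
    using spec_split[OF assms] by blast
  have "avgT N (spec 1 N' (avgT N x)) = k *s proj N x" for x
  proof -
    define y where "y = avgT N x"
    have "avgT N (spec 1 N' y) = avg N (\<lambda>c. spec (1 / (1 + c)) N' y)"
      unfolding avgT_def
    proof (rule avg_cong)
      fix c assume c: "c \<in> pp N"
      show "rT (1 + c) (spec 1 N' y) = spec (1 / (1 + c)) N' y"
        using T_spec[OF unit_nz[OF c], of 1 N' y] one_unit_v[OF N c] T_avgT[OF c, of x]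
        by (simp add: y_def)
    qed
    also have "\<dots> = avg N (\<lambda>c. spec (1 + c) N' y)"
    proof (rule avg_units_inverse[OF _ N])
      show "lconst N N' (\<lambda>c. spec (1 + c) N' y)"
        by (rule lconstI[OF assms], rule spec_center) simp
    qed
    also have "\<dots> = k *s spec 1 N y" using k(2) .
    also have "spec 1 N y = proj N x" by (simp add: y_def proj_def avgT_spec)
    finally show ?thesis by (simp add: y_def)
  qed
  then show ?thesis using k(1) by blast
qed

end

end

section \<open>Uniqueness of Whittaker vectors up to intertwiners\<close>

text \<open>Transposition followed by conjugation with the antidiagonal permutation matrix. It
  reverses products and fixes each upper unipotent matrix.\<close>

fun swap_diag :: "'e mat2 \<Rightarrow> 'e mat2" where
  "swap_diag (a, b, c, d) = (d, b, c, a)"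

lemma swap_diag_mmult: "swap_diag (mmult g h) = mmult (swap_diag h) (swap_diag g)"
  by (cases g; cases h) (simp add: algebra_simps)

lemma mmult_assoc: "mmult (mmult g h) m = mmult g (mmult h m)"
  by (cases g; cases h; cases m) (simp add: algebra_simps)

locale gl2_rep_level = gl2_rep v smul rho psi
  for v :: "'e::field \<Rightarrow> int" and smul :: "'k::field \<Rightarrow> 'v::ab_group_add \<Rightarrow> 'v" (infixr \<open>*s\<close> 75)
    and rho :: "'e mat2 \<Rightarrow> 'v \<Rightarrow> 'v" and psi :: "'e \<Rightarrow> 'k" +
  fixes N :: int
  assumes N: "1 \<le> N" and central: "\<And>c x. c \<in> pp N \<Longrightarrow> rZ (1 + c) x = x"
begin

section \<open>The anti-involution and the compressed group elements\<close>

lemma swap_diag_GL2 [simp]: "g \<in> GL2 \<Longrightarrow> swap_diag g \<in> GL2"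
  by (cases g) (simp add: mult.commute)

lemmas linmap_proj' [simp] = linmap_proj[OF N] and linmap_avgT' [simp] = linmap_avgT[OF N]
  and nz = unit_nz[OF N]

lemma psi_one_plus: "psi (b * s) = psi (b * s') \<Longrightarrow> psi ((1 + s) * b) = psi ((1 + s') * b)"
  using psi_add[of b "b * s"] psi_add[of b "b * s'"] by (simp add: algebra_simps)

lemma T_locally_constant:
  "\<exists>M\<ge>N. \<forall>c\<in>pp N. \<forall>c'\<in>pp N. \<forall>d\<in>pp N. \<forall>d'\<in>pp N. c - c' \<in> pp M \<longrightarrow> d - d' \<in> pp M \<longrightarrow>
     rT ((1 + c) * (1 + d)) y = rT ((1 + c') * (1 + d')) y"
proof -
  obtain n where "fixed_at n y" using fixed_at_exists by blast
  then have l: "lconst N (max N n) (\<lambda>c. rT (1 + c) y)" using lconst_T N by blast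
  show ?thesis
  proof (intro exI[of _ "max N n"] conjI ballI impI)
    fix c c' d d' assume a: "c \<in> pp N" "c' \<in> pp N" "d \<in> pp N" "d' \<in> pp N"
      "c - c' \<in> pp (max N n)" "d - d' \<in> pp (max N n)"
    have "rT ((1 + c) * (1 + d)) y = rT (1 + c) (rT (1 + d) y)"
      using nz a by (simp add: T_mult)
    also have "\<dots> = rT (1 + c) (rT (1 + d') y)" using lconstD[OF l a(3,4,6)] by simp
    also have "\<dots> = rT (1 + d') (rT (1 + c) y)" using nz a by (simp add: T_mult mult.commute)
    also have "\<dots> = rT (1 + d') (rT (1 + c') y)" using lconstD[OF l a(1,2,5)] by simp
    also have "\<dots> = rT ((1 + c') * (1 + d')) y"
      using nz a by (simp add: T_mult mult.commute)
    finally show "rT ((1 + c) * (1 + d)) y = rT ((1 + c') * (1 + d')) y" .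
  qed simp
qed

text \<open>Both projections are refined to level \<open>N'\<close>, each at the cost of one factor
  k. Then \<open>al\<close> and \<open>be\<close> stand next to a \<open>spec 1 N'\<close> and turn
  into scalars, which leaves an integral of Kloosterman type over the two torus averages. Its
  integrand is unchanged when (s, al) and (t, be) are exchanged.\<close>

lemma proj_U_W_U:
  assumes c: "c \<noteq> 0" and N': "N \<le> N'" and al: "al \<in> pp (1 - N')" and be: "be \<in> pp (1 - N')"
    and k: "\<And>x. avgT N (spec 1 N' (avgT N x)) = k *s proj N x" and x: "proj N x = x"
  shows "(k * k) *s proj N (rU al (rT c (rW (rU be x)))) =
     avg N (\<lambda>s. avg N (\<lambda>t. (psi ((1 + s) * al) * psi ((1 + t) * be)) *s
        avgT N (spec 1 N' (rT c (rT ((1 + s) * (1 + t)) (rW (spec 1 N' x)))))))"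
proof -
  define z where "z = spec 1 N' x"
  define y where "y = rW z"
  define G where "G w = rU al (rT c (rW (rU be w)))" for w
  define P where "P w = avgT N (spec 1 N' w)" for w
  have G [simp]: "linmap G"
    unfolding G_def
    by (rule linmap_comp[OF linmap_U], rule linmap_comp[OF linmap_T[OF c]], rule linmap_comp[OF linmap_W])
      (rule linmap_U)
  have P [simp]: "linmap P"
    unfolding P_def by (rule linmap_comp) simp_all
  have psi_z: "rU t z = psi t *s z" if "t \<in> pp (1 - N')" for t
    using U_spec[OF that, of 1 x] by (simp add: z_def)
  have P_U: "P (rU t w) = psi t *s P w" if "t \<in> pp (1 - N')" for t w
    using spec_U[OF that, of 1 w] by (simp add: P_def linmap_scale[OF linmap_avgT'])
  have Ex: "avgT N x = x" using avgT_proj[OF N, of x] x by simp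
  have kx: "k *s x = avgT N z" using k[of x] x Ex by (simp add: z_def)
  \<comment> \<open>One factor k replaces x by the average of the fine vector z, the other replaces
    the outer projection by \<open>P\<close> after a torus average.\<close>
  have "(k * k) *s proj N (G x) = k *s proj N (G (k *s x))"
    by (simp add: linmap_scale[OF G] linmap_scale[OF linmap_proj'])
  also have "\<dots> = P (avgT N (G (avgT N z)))" by (simp add: k[symmetric] P_def kx)
  also have "\<dots> = avg N (\<lambda>s. P (rT (1 + s) (G (avgT N z))))"
    by (rule linmap_of_avgT[OF N P])
  also have "\<dots> = avg N (\<lambda>s. avg N (\<lambda>t. P (rT (1 + s) (G (rT (1 + t) z)))))"
  proof (rule avg_cong)
    fix s assume "s \<in> pp N"
    then have "linmap (\<lambda>w. P (rT (1 + s) (G w)))"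
      by (intro linmap_comp[OF P] linmap_comp[OF linmap_T G] nz)
    then show "P (rT (1 + s) (G (avgT N z))) = avg N (\<lambda>t. P (rT (1 + s) (G (rT (1 + t) z))))"
      by (rule linmap_of_avgT[OF N])
  qed
  also have "\<dots> = avg N (\<lambda>s. avg N (\<lambda>t. (psi ((1 + s) * al) * psi ((1 + t) * be)) *s
        P (rT c (rT ((1 + s) * (1 + t)) y))))"
  proof (rule avg_cong)
    fix s assume s: "s \<in> pp N"
    define f where "f u = (psi ((1 + s) * al) * psi (u * be)) *s P (rT c (rT ((1 + s) * u) y))" for u
    \<comment> \<open>Moving rT (1 + t) to the left past \<open>rU be\<close> divides be by 1 + t,
      and passing the Weyl element inverts 1 + t. The integrand depends on t through 1 / (1 + t) in
      both places, so one substitution in the unit group restores 1 + t.\<close>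
    have "avg N (\<lambda>t. P (rT (1 + s) (G (rT (1 + t) z)))) = avg N (\<lambda>t. f (1 / (1 + t)))"
    proof (rule avg_cong)
      fix t assume t: "t \<in> pp N"
      have tz: "1 + t \<noteq> 0" "1 + s \<noteq> 0" using nz s t by auto
      have be': "be / (1 + t) \<in> pp (1 - N')" using one_unit_div_iff[OF N t] be by simp
      have al': "(1 + s) * al \<in> pp (1 - N')" using one_unit_mult_iff[OF N s] al by simp
      have "rU be (rT (1 + t) z) = rT (1 + t) (rU (be / (1 + t)) z)"
        using T_U[OF tz(1), of "be / (1 + t)" z] tz by simp
      also have "\<dots> = psi (be / (1 + t)) *s rT (1 + t) z"
        by (simp add: psi_z[OF be'] linmap_scale[OF linmap_T] tz)
      finally have "rW (rU be (rT (1 + t) z)) = psi (be / (1 + t)) *s rT (1 / (1 + t)) y"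
        by (simp add: linmap_scale[OF linmap_W] W_T tz central t y_def)
      then have "rT (1 + s) (G (rT (1 + t) z))
         = psi (be / (1 + t)) *s rU ((1 + s) * al) (rT (1 + s) (rT c (rT (1 / (1 + t)) y)))"
        by (simp add: G_def linmap_scale[OF linmap_T] linmap_scale[OF linmap_U] tz c T_U)
      also have "rT (1 + s) (rT c (rT (1 / (1 + t)) y)) = rT c (rT ((1 + s) * (1 / (1 + t))) y)"
        using tz c by (simp add: T_mult mult.left_commute mult.commute)
      finally show "P (rT (1 + s) (G (rT (1 + t) z))) = f (1 / (1 + t))"
        by (simp only: f_def linmap_scale[OF P] P_U[OF al'] scale_scale times_divide_eq_left
            mult_1_left mult.commute[of "psi (be / (1 + t))"])
    qed
    also have "\<dots> = avg N (\<lambda>t. f (1 + t))"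
    proof -
      obtain M where M: "M \<ge> N" "\<And>d d'. d \<in> pp N \<Longrightarrow> d' \<in> pp N \<Longrightarrow> d - d' \<in> pp M \<Longrightarrow>
         rT ((1 + s) * (1 + d)) y = rT ((1 + s) * (1 + d')) y"
        using T_locally_constant[of y] s by (metis diff_self pp_zero)
      obtain M' where M': "lconst N M' (\<lambda>t. psi (be * t))" using lconst_psi by blast
      have "lconst N (max M M') (\<lambda>t. f (1 + t))"
      proof (rule lconstI)
        fix d d' assume d: "d \<in> pp N" "d' \<in> pp N" "d - d' \<in> pp (max M M')"
        have "rT ((1 + s) * (1 + d)) y = rT ((1 + s) * (1 + d')) y"
          by (rule M(2)[OF d(1,2) pp_mono[OF _ d(3)]]) simp
        moreover have "psi ((1 + d) * be) = psi ((1 + d') * be)"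
          by (rule psi_one_plus, rule lconstD[OF M' d(1,2) pp_mono[OF _ d(3)]]) simp
        ultimately show "f (1 + d) = f (1 + d')"
          by (simp only: f_def)
      qed (use M in simp)
      then show ?thesis by (rule avg_units_inverse[OF _ N])
    qed
    finally show "avg N (\<lambda>t. P (rT (1 + s) (G (rT (1 + t) z)))) =
      avg N (\<lambda>t. (psi ((1 + s) * al) * psi ((1 + t) * be)) *s P (rT c (rT ((1 + s) * (1 + t)) y)))"
      by (simp add: f_def)
  qed
  finally show ?thesis by (simp add: G_def P_def y_def z_def)
qed

text \<open>The formula of \<open>proj_U_W_U\<close> for (al, be) and for (be, al) is the same
  double average in opposite orders. \<open>N'\<close> is chosen so that both parameters lie in
  p^(1-N').\<close>

lemma proj_U_W_U_symmetric:
  assumes c: "c \<noteq> 0" and x: "proj N x = x"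
  shows "proj N (rU al (rT c (rW (rU be x)))) = proj N (rU be (rT c (rW (rU al x))))"
proof -
  obtain i j where ij: "al \<in> pp i" "be \<in> pp j" using pp_exists by blast
  define N' where "N' = max N (max (1 - i) (1 - j))"
  have N': "N \<le> N'" by (simp add: N'_def)
  have al: "al \<in> pp (1 - N')" by (rule pp_mono[OF _ ij(1)]) (simp add: N'_def)
  have be: "be \<in> pp (1 - N')" by (rule pp_mono[OF _ ij(2)]) (simp add: N'_def)
  obtain k where k: "k \<noteq> 0" "\<And>x. avgT N (spec 1 N' (avgT N x)) = k *s proj N x"
    using avgT_spec_fine[OF N N'] by blast
  define y where "y = rW (spec 1 N' x)"
  define f where "f s t = (psi ((1 + s) * al) * psi ((1 + t) * be)) *s
        avgT N (spec 1 N' (rT c (rT ((1 + s) * (1 + t)) y)))" for s t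
  obtain M where M: "M \<ge> N" "\<And>c c' d d'. c \<in> pp N \<Longrightarrow> c' \<in> pp N \<Longrightarrow> d \<in> pp N \<Longrightarrow> d' \<in> pp N \<Longrightarrow>
     c - c' \<in> pp M \<Longrightarrow> d - d' \<in> pp M \<Longrightarrow> rT ((1 + c) * (1 + d)) y = rT ((1 + c') * (1 + d')) y"
    using T_locally_constant[of y] by metis
  obtain M1 where M1: "lconst N M1 (\<lambda>t. psi (al * t))" using lconst_psi by blast
  obtain M2 where M2: "lconst N M2 (\<lambda>t. psi (be * t))" using lconst_psi by blast
  have "avg N (\<lambda>s. avg N (f s)) = avg N (\<lambda>t. avg N (\<lambda>s. f s t))"
  proof (rule avg_fubini)
    let ?M = "max M (max M1 M2)"
    show "N \<le> ?M" "N \<le> ?M" using M(1) by auto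
    fix s s' t t' assume a: "s \<in> pp N" "s' \<in> pp N" "t \<in> pp N" "t' \<in> pp N" "s - s' \<in> pp ?M" "t - t' \<in> pp ?M"
    have "rT ((1 + s) * (1 + t)) y = rT ((1 + s') * (1 + t')) y"
      by (rule M(2)[OF a(1-4) pp_mono[OF _ a(5)] pp_mono[OF _ a(6)]]) auto
    moreover have "psi ((1 + s) * al) = psi ((1 + s') * al)"
      by (rule psi_one_plus, rule lconstD[OF M1 a(1,2) pp_mono[OF _ a(5)]]) simp
    moreover have "psi ((1 + t) * be) = psi ((1 + t') * be)"
      by (rule psi_one_plus, rule lconstD[OF M2 a(3,4) pp_mono[OF _ a(6)]]) simp
    ultimately show "f s t = f s' t'"
      by (simp only: f_def)
  qed
  moreover have "(k * k) *s proj N (rU al (rT c (rW (rU be x)))) = avg N (\<lambda>s. avg N (f s))"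
    using proj_U_W_U[OF c N' al be k(2) x] by (simp only: f_def[abs_def] y_def)
  moreover have "(k * k) *s proj N (rU be (rT c (rW (rU al x)))) = avg N (\<lambda>t. avg N (\<lambda>s. f s t))"
    using proj_U_W_U[OF c N' be al k(2) x] by (simp only: f_def y_def mult.commute)
  ultimately have "(k * k) *s proj N (rU al (rT c (rW (rU be x))))
     = (k * k) *s proj N (rU be (rT c (rW (rU al x))))" by metis
  then show ?thesis using k(1) by simp
qed

text \<open>diag(r,1) moves the dual ball 1 + p^N to (1 / r) * (1 + p^N), which is disjoint from it
  unless r lies in 1 + p^N. Concretely, one unipotent element acts on the result by two different
  scalars.\<close>

lemma spec_T_spec_zero:
  assumes r: "r \<noteq> 0" "r - 1 \<notin> pp N"
  shows "spec 1 N (rT r (spec 1 N x)) = 0"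
proof -
  define y where "y = spec 1 N (rT r (spec 1 N x))"
  have key: "psi t *s y = psi (r * t) *s y" if "t \<in> pp (1 - N)" "r * t \<in> pp (1 - N)" for t
  proof -
    have "spec 1 N (rT r (rU t (spec 1 N x))) = psi t *s y"
      using U_spec[OF that(1), of 1 x]
      by (simp add: y_def linmap_scale[OF linmap_T[OF r(1)]] linmap_scale[OF linmap_spec])
    moreover have "spec 1 N (rT r (rU t (spec 1 N x))) = psi (r * t) *s y"
      using spec_U[OF that(2), of 1] by (simp add: y_def T_U[OF r(1)])
    ultimately show ?thesis by metis
  qed
  have "\<exists>t. t \<in> pp (1 - N) \<and> r * t \<in> pp (1 - N) \<and> psi t \<noteq> psi (r * t)"
  \<comment> \<open>Both t and r * t must lie in p^(1-N). For integral r a point detecting r - 1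
    serves as t; otherwise 1 / r is integral and the detecting point is r * t.\<close>
  proof (cases "v r \<ge> 0")
    case True
    obtain t where t: "t \<in> pp (1 - N)" "psi ((r - 1) * t) \<noteq> 1" using psi_detect[OF r(2)] by blast
    have "psi ((r - 1) * t) * psi t = psi (r * t)" by (simp add: psi_add[symmetric] algebra_simps)
    then have "psi t \<noteq> psi (r * t)" using t(2) psi_nz[of t] by auto
    moreover have "r * t \<in> pp (1 - N)" using pp_mult_int[of r t] True t(1) by (simp add: pp_def)
    ultimately show ?thesis using t by blast
  next
    case False
    have "1 / r - 1 \<notin> pp N"
    proof
      assume "1 / r - 1 \<in> pp N"
      then have "v (1 + (1 / r - 1)) = 0" by (rule one_unit_v[OF N])
      then show False using False r(1) v_divide[of 1 r] by simp
    qed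
    then obtain t where t: "t \<in> pp (1 - N)" "psi ((1 / r - 1) * t) \<noteq> 1" using psi_detect by blast
    have "psi ((1 / r - 1) * t) * psi t = psi (t / r)" by (simp add: psi_add[symmetric] algebra_simps)
    then have "psi (t / r) \<noteq> psi t" using t(2) psi_nz[of t] by auto
    moreover have "t / r \<in> pp (1 - N)"
      using pp_mult_int[of "1 / r" t] False t(1) r(1) v_divide[of 1 r] by (simp add: pp_def)
    ultimately show ?thesis using t r(1) by (intro exI[of _ "t / r"]) auto
  qed
  then show ?thesis using key unfolding y_def[symmetric] by (metis scale_cancel_right)
qed

text \<open>Bruhat decomposition. On the big cell the swap exchanges the two unipotent parameters a
  / c and d / c, so \<open>proj_U_W_U_symmetric\<close> applies. On the Borel subgroup either a / d
  lies in 1 + p^N, and torus and central invariance absorb the swap, or both sides vanish because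
  the balls are disjoint.\<close>

lemma proj_swap_diag:
  assumes g: "g \<in> GL2" and x: "proj N x = x"
  shows "proj N (rho g x) = proj N (rho (swap_diag g) x)"
proof -
  obtain a b c d where g': "g = (a, b, c, d)" by (cases g)
  then have det: "a * d - b * c \<noteq> 0" using g by simp
  have sx: "spec 1 N x = x" using spec_proj[OF N, of x] x by simp
  show ?thesis
  proof (cases "c = 0")
    case False
    \<comment> \<open>The torus coordinate of the big cell: g is the scalar matrix - c times U(a /
      c) diag(e,1) W U(d / c). The swap keeps c and the determinant, hence e.\<close>
    define e where "e = (a * d - b * c) / (c * c)"
    have e: "e \<noteq> 0" using det False by (simp add: e_def)
    have Zc: "linmap (rZ (- c))" using False by simp
    have dec: "rho g x = rZ (- c) (rU (a / c) (rT e (rW (rU (d / c) x))))"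
      if "g = (a, b, c, d)" "e = (a * d - b * c) / (c * c)" for g a d
      using False that e
      by (simp add: rZ_def rU_def rT_def rW_def rho_mmult) (simp add: field_simps)
    have Zp: "proj N (rZ (- c) w) = rZ (- c) (proj N w)" for w
    proof -
      have "rZ (- c) (proj N w) = avg N (\<lambda>s. rZ (- c) (rT (1 + s) (spec 1 N w)))"
        unfolding proj_def by (rule linmap_of_avgT[OF N Zc])
      also have "\<dots> = avg N (\<lambda>s. rT (1 + s) (spec 1 N (rZ (- c) w)))"
      proof (rule avg_cong)
        fix s assume s: "s \<in> pp N"
        show "rZ (- c) (rT (1 + s) (spec 1 N w)) = rT (1 + s) (spec 1 N (rZ (- c) w))"
          using False nz[OF s] by (simp add: rT_def Z_rho flip: Z_spec)
      qed
      finally show ?thesis by (simp add: proj_def avgT_def)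
    qed
    have "rho g x = rZ (- c) (rU (a / c) (rT e (rW (rU (d / c) x))))"
      by (rule dec[OF g' e_def])
    moreover have "rho (swap_diag g) x = rZ (- c) (rU (d / c) (rT e (rW (rU (a / c) x))))"
      by (rule dec) (simp_all add: g' e_def mult.commute)
    ultimately show ?thesis using proj_U_W_U_symmetric[OF e x] Zp by simp
  next
    case True
    then have ad: "a \<noteq> 0" "d \<noteq> 0" using det by auto
    define s where "s = b / a"
    have e1: "rho g x = rT (a / d) (rZ d (rU s x))"
      using ad True by (simp add: g' s_def rT_def rZ_def rU_def rho_mmult)
    have e2: "rho (swap_diag g) x = rU s (rT (d / a) (rZ a x))"
      using ad True by (simp add: g' s_def rT_def rZ_def rU_def rho_mmult)
    have sU: "spec 1 N (rU t x) = rU t x" for t by (simp add: U_spec_commute[symmetric] sx)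
    have sZ: "spec 1 N (rZ r w) = rZ r w" if "r \<noteq> 0" "spec 1 N w = w" for r w
      using that by (simp flip: Z_spec)
    show ?thesis
    proof (cases "a / d - 1 \<in> pp N")
      case True
      define u where "u = a / d - 1"
      have u: "u \<in> pp N" "1 + u = a / d" using True by (simp_all add: u_def)
      define u' where "u' = d / a - 1"
      have "u' = - (u / (1 + u))" using ad unfolding u'_def u(2) by (simp add: u_def field_simps)
      then have u': "u' \<in> pp N"
        using one_unit_div_iff[OF N u(1), of u N] u(1) by simp
      have u'1: "1 + u' = d / a" by (simp add: u'_def)
      have "proj N (rho g x) = proj N (rZ d (rU s x))"
        unfolding e1 u(2)[symmetric] by (rule proj_T[OF N u(1)])
      moreover have "rT (d / a) (rZ a x) = rZ a (rT (1 + u') x)"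
        unfolding u'1 rT_def by (rule Z_rho[symmetric]) (use ad in auto)
      moreover have "rT (1 + u') x = x" using T_avgT[OF N u', of x] avgT_proj[OF N, of x] x by simp
      moreover have "rU s (rZ a x) = rZ a (rU s x)" unfolding rU_def by (rule Z_rho[symmetric]) (use ad in auto)
      moreover have "rZ a w = rZ d w" for w
      proof -
        have "rZ a w = rZ d (rZ (1 + u) w)" unfolding u(2) using ad by (simp add: rZ_def rho_mmult)
        then show ?thesis using central[OF u(1)] by simp
      qed
      ultimately show ?thesis using e2 by simp
    next
      case False
      have "d / a - 1 \<notin> pp N"
      proof
        assume u': "d / a - 1 \<in> pp N"
        have "a / d - 1 = - ((d / a - 1) / (1 + (d / a - 1)))" using ad by (simp add: field_simps)
        then show False using one_unit_div_iff[OF N u', of "d / a - 1" N] u' False by simp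
      qed
      then have "spec 1 N (rT (d / a) (spec 1 N (rZ a x))) = 0"
        by (intro spec_T_spec_zero) (use ad in auto)
      then have "spec 1 N (rho (swap_diag g) x) = 0"
        using sZ[OF ad(1) sx] by (simp add: e2 U_spec_commute[symmetric] linmap_0[OF linmap_U])
      moreover have "spec 1 N (rT (a / d) (spec 1 N (rZ d (rU s x)))) = 0"
        by (intro spec_T_spec_zero) (use ad False in auto)
      then have "spec 1 N (rho g x) = 0"
        using sZ[OF ad(2) sU] by (simp add: e1)
      ultimately show ?thesis by (simp add: proj_def)
    qed
  qed
qed

text \<open>Gelfand's trick: the projection is an average of group elements permuted by the
  anti-involution.\<close>

lemma proj_commute:
  assumes g: "g \<in> GL2" and h: "h \<in> GL2" and x: "proj N x = x"
  shows "proj N (rho g (proj N (rho h x))) = proj N (rho h (proj N (rho g x)))"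
proof -
  define y where "y = rho h x"
  define y' where "y' = rho (swap_diag g) x"
  define L where "L w = proj N (rho g w)" for w
  define L' where "L' w = proj N (rho (swap_diag h) w)" for w
  have L: "linmap L" unfolding L_def by (rule linmap_comp) (simp_all add: g)
  have L': "linmap L'" unfolding L'_def by (rule linmap_comp) (simp_all add: h)
  \<comment> \<open>The swapped m is U(t) diag(1, 1 + c), that is U(t) diag(1 / (1 + c), 1) times a
    scalar in 1 + p^N, which acts trivially. What remains is to invert the unit under the average
    and to commute the two averages.\<close>
  have key: "L (rT (1 + c) (rU t y)) = L' (rU t (rT (1 / (1 + c)) y'))" if c: "c \<in> pp N" for c t
  proof -
    define m where "m = mmult (1 + c, 0, 0, 1) (1, t, 0, 1)"
    have m: "m \<in> GL2" using nz[OF c] by (simp add: m_def)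
    have "rT (1 + c) (rU t y) = rho m y"
      unfolding rT_def rU_def m_def by (rule rho_mmult) (use nz[OF c] in simp_all)
    then have "L (rT (1 + c) (rU t y)) = proj N (rho (mmult g (mmult m h)) x)"
      using g h m by (simp add: L_def y_def rho_mmult)
    also have "\<dots> = proj N (rho (swap_diag (mmult g (mmult m h))) x)"
      by (rule proj_swap_diag) (use g h m x in auto)
    also have "\<dots> = proj N (rho (swap_diag h) (rho (swap_diag m) y'))"
      using g h m by (simp add: swap_diag_mmult rho_mmult y'_def mmult_assoc)
    also have "rho (swap_diag m) y' = rU t (rT (1 / (1 + c)) (rZ (1 + c) y'))"
      using nz[OF c] by (simp add: m_def rZ_def rT_def rU_def rho_mmult mult.commute)
    finally show ?thesis by (simp add: L'_def central[OF c])
  qed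
  have "L (proj N y) = avg N (\<lambda>c. L (rT (1 + c) (spec 1 N y)))"
    unfolding proj_def by (rule linmap_of_avgT[OF N L])
  also have "\<dots> = avg N (\<lambda>c. L' (spec 1 N (rT (1 / (1 + c)) y')))"
  proof (rule avg_cong)
    fix c assume c: "c \<in> pp N"
    have "linmap (\<lambda>w. L (rT (1 + c) w))" by (rule linmap_comp[OF L]) (simp add: nz[OF c])
    then have "L (rT (1 + c) (spec 1 N y)) = avg (1 - N) (\<lambda>t. psi (- (1 * t)) *s L (rT (1 + c) (rU t y)))"
      by (rule linmap_of_spec)
    also have "\<dots> = L' (spec 1 N (rT (1 / (1 + c)) y'))"
      by (simp add: key[OF c] linmap_of_spec[OF L'])
    finally show "L (rT (1 + c) (spec 1 N y)) = L' (spec 1 N (rT (1 / (1 + c)) y'))" .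
  qed
  also have "\<dots> = avg N (\<lambda>c. L' (spec 1 N (rT (1 + c) y')))"
  proof -
    obtain M where M: "lconst N M (\<lambda>c. rT (1 + c) y')" using lconst_T_ex[OF N] by blast
    have "lconst N M (\<lambda>c. L' (spec 1 N (rT (1 + c) y')))"
      by (rule lconst_comp[OF M])
    then show ?thesis by (rule avg_units_inverse[OF _ N])
  qed
  also have "\<dots> = L' (spec 1 N (avgT N y'))"
    by (rule linmap_of_avgT[OF N, symmetric]) (rule linmap_comp[OF L' linmap_spec])
  also have "\<dots> = L' (proj N y')" by (simp add: proj_def avgT_spec[OF N])
  \<comment> \<open>The outer h is swapped back, which is legitimate because
    \<open>proj N y'\<close> is fixed by the projection; the inner g is swapped back on x.\<close>
  also have "\<dots> = proj N (rho h (proj N y'))"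
    unfolding L'_def by (rule proj_swap_diag[OF h, symmetric]) (rule proj_idem[OF N])
  also have "proj N y' = proj N (rho g x)"
    unfolding y'_def by (rule proj_swap_diag[OF g x, symmetric])
  finally show ?thesis by (simp add: L_def y_def)
qed

text \<open>The subrepresentation of V x V generated by (x1, x2), in the manner of Goursat's lemma.
  The intertwiner is constructed as a relation, so that well-definedness becomes the single
  statement that (0, z) in the relation forces z = 0.\<close>

inductive_set graph :: "'v \<Rightarrow> 'v \<Rightarrow> ('v \<times> 'v) set" for x1 x2 where
  graph_0: "(0, 0) \<in> graph x1 x2"
| graph_add: "(y, z) \<in> graph x1 x2 \<Longrightarrow> g \<in> GL2 \<Longrightarrow> (y + c *s rho g x1, z + c *s rho g x2) \<in> graph x1 x2"

lemma graph_plus: "(y, z) \<in> graph x1 x2 \<Longrightarrow> (y', z') \<in> graph x1 x2 \<Longrightarrow> (y' + y, z' + z) \<in> graph x1 x2"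
  by (induction rule: graph.induct) (auto simp: add.assoc[symmetric] intro: graph_add)

lemma graph_scale: "(y, z) \<in> graph x1 x2 \<Longrightarrow> (d *s y, d *s z) \<in> graph x1 x2"
  by (induction rule: graph.induct) (auto simp: scale_right_distrib intro: graph.intros)

lemma graph_rho:
  assumes "(y, z) \<in> graph x1 x2" and h: "h \<in> GL2"
  shows "(rho h y, rho h z) \<in> graph x1 x2"
  using assms(1)
proof (induction rule: graph.induct)
  case (graph_add y z g c)
  have "(rho h y + c *s rho (mmult h g) x1, rho h z + c *s rho (mmult h g) x2) \<in> graph x1 x2"
    by (rule graph.graph_add) (use graph_add h in auto)
  then show ?case
    using graph_add h by (simp add: linmap_add[of "rho h"] linmap_scale[of "rho h"] rho_mmult)
qed (simp add: linmap_0 h graph_0)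

lemma graph_base: "g \<in> GL2 \<Longrightarrow> (rho g x1, rho g x2) \<in> graph x1 x2"
  using graph_add[OF graph_0, of g 1 x1 x2] by simp

lemma graph_swap: "(y, z) \<in> graph x1 x2 \<Longrightarrow> (z, y) \<in> graph x2 x1"
  by (induction rule: graph.induct) (auto intro: graph.intros)

text \<open>The first projection of the relation is a subrepresentation containing x1, hence
  everything.\<close>

lemma graph_total:
  assumes "x1 \<noteq> 0"
  shows "\<exists>z. (y, z) \<in> graph x1 x2"
proof -
  have "{y. \<exists>z. (y, z) \<in> graph x1 x2} = UNIV"
  proof (rule irr_eq_UNIV)
    show "subspace {y. \<exists>z. (y, z) \<in> graph x1 x2}"
      unfolding subspace_def using graph_0 graph_plus graph_scale by blast
    show "x1 \<in> {y. \<exists>z. (y, z) \<in> graph x1 x2}" using graph_base[of "(1,0,0,1)" x1 x2] by auto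
    show "rho g y \<in> {y. \<exists>z. (y, z) \<in> graph x1 x2}"
      if "g \<in> GL2" "y \<in> {y. \<exists>z. (y, z) \<in> graph x1 x2}" for g y
      using that graph_rho by blast
  qed (rule assms)
  then show ?thesis by blast
qed

text \<open>The operator p moving x1 to x2 is a combination of operators commuting with the compressions
  of all group elements, so it transports the vanishing of y to all compressions of z.\<close>

lemma graph_functional:
  assumes x1: "proj N x1 = x1" "x1 \<noteq> 0" and x2: "proj N x2 = x2" "x2 \<noteq> 0"
    and "(0, z) \<in> graph x1 x2"
  shows "z = 0"
proof -
  define A where "A = {p. linmap p \<and> (\<forall>w. proj N w = w \<longrightarrow> (\<forall>g\<in>GL2. p (proj N (rho g w)) = proj N (rho g (p w))))}"
  have A: "\<exists>p\<in>A. proj N y = p x1" if "(y, z) \<in> graph x1 x2" for y z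
    using that
  proof (induction rule: graph.induct)
    case graph_0
    have "(\<lambda>_. 0) \<in> A" by (simp add: A_def linmap_def linmap_0[OF linmap_proj'])
    then show ?case by (intro bexI[of _ "\<lambda>_. 0"]) (auto simp: linmap_0[OF linmap_proj'])
  next
    case (graph_add y z g c)
    then obtain p where p: "p \<in> A" "proj N y = p x1" by blast
    define q where "q w = p w + c *s proj N (rho g w)" for w
    have lp: "linmap p" using p by (simp add: A_def)
    have g: "g \<in> GL2" by fact
    have "linmap (\<lambda>w. proj N (rho g w))" by (rule linmap_comp) (simp_all add: g)
    then have "linmap q" using lp
      by (auto simp: linmap_def q_def algebra_simps)
    moreover have "q (proj N (rho h w)) = proj N (rho h (q w))" if "proj N w = w" "h \<in> GL2" for w h
    proof -
      have "p (proj N (rho h w)) = proj N (rho h (p w))" using p that by (simp add: A_def)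
      then show ?thesis
        using proj_commute[OF g that(2,1)] that(2)
        by (simp add: q_def linmap_add[of "rho h"] linmap_scale[of "rho h"] linmap_add[OF linmap_proj']
            linmap_scale[OF linmap_proj'])
    qed
    ultimately have "q \<in> A" by (simp add: A_def)
    moreover have "proj N (y + c *s rho g x1) = q x1"
      using p by (simp add: q_def linmap_add[OF linmap_proj'] linmap_scale[OF linmap_proj'])
    ultimately show ?case by blast
  qed
  \<comment> \<open>By totality x2 is a combination of translates of x1; projecting that
    combination, and using that x2 is fixed by the projection, gives the operator p with p x1 =
    x2.\<close>
  obtain z' where "(x2, z') \<in> graph x1 x2" using graph_total x1(2) by blast
  then obtain p where p: "p \<in> A" "x2 = p x1" using A x2(1) by metis
  have lp: "linmap p" using p by (simp add: A_def)
  have pz: "proj N z = p (proj N y)" if "(y, z) \<in> graph x1 x2" for y z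
    using that
  proof (induction rule: graph.induct)
    case graph_0
    then show ?case by (simp add: linmap_0[OF lp] linmap_0[OF linmap_proj'])
  next
    case (graph_add y z g c)
    have "proj N (rho g x2) = p (proj N (rho g x1))"
      using p x1(1) graph_add.hyps(2) by (simp add: A_def)
    then show ?case using graph_add.IH
      by (simp add: linmap_add[OF linmap_proj'] linmap_scale[OF linmap_proj'] linmap_add[OF lp] linmap_scale[OF lp])
  qed
  \<comment> \<open>The largest subrepresentation inside the kernel of the projection. It misses x2,
    so irreducibility makes it zero.\<close>
  define S where "S = {z. \<forall>g\<in>GL2. proj N (rho g z) = 0}"
  have "z \<in> S"
    unfolding S_def
  proof (intro CollectI ballI)
    fix g :: "'e mat2" assume g: "g \<in> GL2"
    have "(rho g 0, rho g z) \<in> graph x1 x2" by (rule graph_rho[OF assms(5) g])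
    then have "proj N (rho g z) = p (proj N (rho g 0))" by (rule pz)
    then show "proj N (rho g z) = 0" by (simp add: linmap_0[OF lp] linmap_0[OF linmap_proj'] g)
  qed
  moreover have "invariant_subspace smul rho GL2 S"
    unfolding invariant_subspace_def
  proof (intro conjI ballI)
    show "subspace S"
      unfolding subspace_def S_def
      by (auto simp: linmap_0[OF linmap_proj'] linmap_add[of "rho _"] linmap_scale[of "rho _"]
          linmap_add[OF linmap_proj'] linmap_scale[OF linmap_proj'])
    show "rho h w \<in> S" if "h \<in> GL2" "w \<in> S" for h w
      using that by (auto simp: S_def rho_mmult)
  qed
  moreover have "x2 \<notin> S"
  proof
    assume "x2 \<in> S"
    then have "proj N (rho (1, 0, 0, 1) x2) = 0" unfolding S_def by (simp del: rho_one)
    then show False using x2 by simp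
  qed
  ultimately show ?thesis using irr[of S] by blast
qed

text \<open>The hypotheses are symmetric in x1 and x2, and the converse of
  \<open>graph x1 x2\<close> is \<open>graph x2 x1\<close>. Totality and single-valuedness in both
  directions make the relation the graph of a bijection.\<close>

theorem intertwiner_exists:
  assumes x1: "proj N x1 = x1" "x1 \<noteq> 0" and x2: "proj N x2 = x2" "x2 \<noteq> 0"
  shows "\<exists>A. bij A \<and> linmap A \<and> (\<forall>g\<in>GL2. \<forall>x. A (rho g x) = rho g (A x)) \<and> A x1 = x2"
proof -
  have uniq: "z = z'" if "(y, z) \<in> graph x1 x2" "(y, z') \<in> graph x1 x2" for y z z'
  proof -
    have "((- 1) *s y + y, (- 1) *s z' + z) \<in> graph x1 x2"
      using graph_plus[OF that(1) graph_scale[OF that(2)]] .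
    then have "(0, z - z') \<in> graph x1 x2" by simp
    then have "z - z' = 0" by (rule graph_functional[OF x1 x2])
    then show ?thesis by simp
  qed
  have uniq': "y = y'" if "(y, z) \<in> graph x1 x2" "(y', z) \<in> graph x1 x2" for y y' z
  proof -
    have "((- 1) *s z + z, (- 1) *s y' + y) \<in> graph x2 x1"
      using graph_plus[OF graph_swap[OF that(1)] graph_scale[OF graph_swap[OF that(2)]]] .
    then have "(0, y - y') \<in> graph x2 x1" by simp
    then have "y - y' = 0" by (rule graph_functional[OF x2 x1])
    then show ?thesis by simp
  qed
  define A where "A y = (SOME z. (y, z) \<in> graph x1 x2)" for y
  have A: "(y, A y) \<in> graph x1 x2" for y
    unfolding A_def by (rule someI_ex) (rule graph_total[OF x1(2)])
  have A_eq: "A y = z" if "(y, z) \<in> graph x1 x2" for y z using uniq[OF A that] .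
  show ?thesis
  proof (intro exI[of _ A] conjI ballI allI)
    show "bij A"
    proof (rule bijI)
      show "inj A" by (rule injI) (metis A uniq')
      show "surj A"
        by (rule surjI[of A "\<lambda>z. SOME y. (z, y) \<in> graph x2 x1"])
          (metis A_eq graph_swap graph_total[OF x2(2)] someI_ex)
    qed
    show "linmap A"
      unfolding linmap_def by (auto intro!: A_eq graph_plus graph_scale A)
    show "A (rho g x) = rho g (A x)" if "g \<in> GL2" for g x
      by (rule A_eq, rule graph_rho[OF A that])
    show "A x1 = x2" using graph_base[of "(1,0,0,1)" x1 x2] by (intro A_eq) simp
  qed
qed

end

section \<open>A Nullstellensatz in two variables\<close>

lemma infinite_alg_closed:
  assumes "\<And>q :: 'k::field poly. degree q > 0 \<Longrightarrow> \<exists>x. poly q x = 0"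
  shows "infinite (UNIV :: 'k set)"
proof
  assume fin: "finite (UNIV :: 'k set)"
  define q :: "'k poly" where "q = (\<Prod>a\<in>UNIV. [:- a, 1:])"
  have r: "poly q x = 0" for x
    using fin by (auto simp: q_def poly_prod prod_zero_iff)
  have "degree q = card (UNIV :: 'k set)"
    unfolding q_def by (subst degree_prod_eq_sum_degree) auto
  also have "\<dots> > 0" using fin by (simp add: card_gt_0_iff)
  finally have "degree (q + 1) > 0" by (simp add: degree_add_eq_left)
  then obtain x where "poly (q + 1) x = 0" using assms by blast
  then show False using r[of x] by simp
qed

lemma dvd_power_diff: "(x - y) dvd (x ^ n - y ^ n)" for x y :: "'a::comm_ring_1"
proof (induction n)
  case (Suc n)
  have "x ^ Suc n - y ^ Suc n = (x - y) * x ^ n + y * (x ^ n - y ^ n)"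
    by (simp add: algebra_simps)
  then show ?case using Suc by (metis dvd_add dvd_triv_left dvd_mult)
qed simp

text \<open>The ideal I is thought of as a maximal ideal in Laurent polynomials in x and y. The last
  assumption says that x - a is invertible modulo I for every a in k.
  With D in I of minimal degree in y, the elements y^i below that degree are independent over k[x],
  which contradicts the invertibility of x - a for general a.\<close>

lemma nullstellensatz2:
  fixes I :: "'k::field poly poly set"
  assumes alg_closed: "\<And>q :: 'k poly. degree q > 0 \<Longrightarrow> \<exists>x. poly q x = 0"
    and add: "\<And>P Q. P \<in> I \<Longrightarrow> Q \<in> I \<Longrightarrow> P + Q \<in> I" and mult: "\<And>P Q. P \<in> I \<Longrightarrow> Q * P \<in> I"
    and one: "1 \<notin> I"
    and x_cancel: "\<And>a P. smult [:- a, 1:] P \<in> I \<Longrightarrow> P \<in> I"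
    and y_cancel: "\<And>P. pCons 0 P \<in> I \<Longrightarrow> P \<in> I"
    and inv: "\<And>a. \<exists>P m n. smult [:- a, 1:] P - monom ([:0, 1:] ^ m) n \<in> I"
  shows False
proof -
  have smult_in: "smult q P \<in> I" if "P \<in> I" for q P using mult[OF that, of "[:q:]"] by simp
  have diff: "P - Q \<in> I" if "P \<in> I" "Q \<in> I" for P Q
    using add[OF that(1) mult[OF that(2), of "-1"]] by simp
  have cancel: "P \<in> I" if "q \<noteq> 0" "smult q P \<in> I" for q P
    using that
  proof (induction "degree q" arbitrary: q)
    case 0
    then obtain c where c: "q = [:c:]" by (metis degree_eq_zeroE)
    then have "smult [:inverse c:] (smult q P) = P" using 0 by (simp add: one_pCons[symmetric])
    then show ?case using smult_in[OF 0(3), of "[:inverse c:]"] by simp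
  next
    case (Suc n)
    obtain x where "poly q x = 0" using alg_closed[of q] Suc(2) by auto
    then obtain r where r: "q = [:- x, 1:] * r" by (metis poly_eq_0_iff_dvd dvdE)
    then have "r \<noteq> 0" using Suc.prems by auto
    then have "degree q = Suc (degree r)" unfolding r by (subst degree_mult_eq) auto
    moreover have "smult r P \<in> I"
      using Suc.prems(2) x_cancel[of x "smult r P"] by (simp only: r smult_smult)
    ultimately show ?case using Suc.hyps(1)[of r] Suc.hyps(2) \<open>r \<noteq> 0\<close> by simp
  qed
  \<comment> \<open>The value a = 1 exhibits a nonzero element of I: evaluated at x = 1, its
    coefficient of index n0 is - 1.\<close>
  obtain P0 m0 n0 where P0: "smult [:- 1, 1:] P0 - monom ([:0, 1:] ^ m0) n0 \<in> I" using inv by blast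
  have "smult [:- 1, 1:] P0 - monom ([:0, 1:] ^ m0) n0 \<noteq> 0"
  proof
    assume "smult [:- 1, 1:] P0 - monom ([:0, 1:] ^ m0) n0 = 0"
    then have "poly (coeff (smult [:- 1, 1:] P0 - monom ([:0, 1:] ^ m0) n0) n0) 1 = 0" by simp
    then show False by simp
  qed
  then obtain D where D: "D \<in> I" "D \<noteq> 0" and D_min: "\<And>P. P \<in> I \<Longrightarrow> P \<noteq> 0 \<Longrightarrow> degree D \<le> degree P"
    using P0 arg_min_nat_lemma[of "\<lambda>P. P \<in> I \<and> P \<noteq> 0" _ degree] by blast
  have small: "P = 0" if "P \<in> I" "P = 0 \<or> degree P < degree D" for P
    using D_min[OF that(1)] that(2) by fastforce
  have d: "degree D > 0"
  proof (rule ccontr)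
    assume "\<not> ?thesis"
    then obtain q where q: "D = [:q:]" by (metis degree_eq_zeroE gr0I)
    then have "smult q 1 \<in> I" "q \<noteq> 0" using D by auto
    then show False using cancel one by blast
  qed
  \<comment> \<open>D = p0 + y * U, so modulo I the product y * U equals - p0. Thus U stands in for
    an inverse of y up to a polynomial in x.\<close>
  obtain p0 U where pU: "D = pCons p0 U" by (metis pCons_cases)
  have p0: "p0 \<noteq> 0"
  proof
    assume z: "p0 = 0"
    then have "U \<in> I" using D(1) pU y_cancel by simp
    moreover have "degree U < degree D" "U \<noteq> 0" using d pU z by (auto split: if_splits)
    ultimately show False using D_min by fastforce
  qed
  define ld where "ld = lead_coeff D"
  have ld: "ld \<noteq> 0" using D by (simp add: ld_def)
  \<comment> \<open>With a outside the zeros of x, of p0 and of the leading coefficient, every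
    factor collected below stays nonzero at x = a.\<close>
  obtain a where a: "poly ([:0, 1:] * (p0 * ld)) a \<noteq> 0"
  proof -
    have "finite {x. poly ([:0, 1:] * (p0 * ld)) x = 0}"
      by (rule poly_roots_finite) (use p0 ld in auto)
    then have "{x. poly ([:0, 1:] * (p0 * ld)) x = 0} \<noteq> UNIV"
      using infinite_alg_closed[OF alg_closed] by metis
    then show ?thesis using that by blast
  qed
  obtain P m n where P: "smult [:- a, 1:] P - monom ([:0, 1:] ^ m) n \<in> I" using inv by blast
  define xm :: "'k poly" where "xm = [:0, 1:] ^ m"
  \<comment> \<open>Multiplying by U^n trades the power y^n for (- p0)^n modulo D, which leaves only
    the polynomial c in x.\<close>
  define V where "V = P * U ^ n"
  define c where "c = xm * (- p0) ^ n"
  have "smult [:- a, 1:] V - smult c 1 \<in> I"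
  proof -
    have "U ^ n * (smult [:- a, 1:] P - monom xm n) \<in> I" using P mult unfolding xm_def by blast
    also have "U ^ n * (smult [:- a, 1:] P - monom xm n) = smult [:- a, 1:] V - smult xm ((pCons 0 U) ^ n)"
    proof -
      have "pCons 0 U = monom 1 1 * U" by (simp add: monom_altdef)
      then have e: "(pCons 0 U) ^ n = monom 1 n * U ^ n" by (simp add: power_mult_distrib monom_power)
      have "monom xm n = smult xm (monom 1 n)" by (simp add: smult_monom)
      then show ?thesis unfolding V_def e by (simp add: right_diff_distrib mult.commute)
    qed
    finally have 1: "smult [:- a, 1:] V - smult xm ((pCons 0 U) ^ n) \<in> I" .
    have "pCons 0 U - [:- p0:] dvd (pCons 0 U) ^ n - [:- p0:] ^ n" by (rule dvd_power_diff)
    moreover have "pCons 0 U - [:- p0:] = D" by (simp add: pU)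
    ultimately have "(pCons 0 U) ^ n - [:- p0:] ^ n \<in> I"
      using mult[OF D(1)] by (metis dvdE mult.commute)
    then have "smult xm ((pCons 0 U) ^ n - [:- p0:] ^ n) \<in> I" by (rule smult_in)
    then have "(smult [:- a, 1:] V - smult xm ((pCons 0 U) ^ n)) + smult xm ((pCons 0 U) ^ n - [:- p0:] ^ n) \<in> I"
      using 1 add by blast
    moreover have "[:- p0:] ^ n = smult ((- p0) ^ n) 1" by (simp add: poly_const_pow)
    ultimately show ?thesis
      by (simp only: c_def smult_diff_right smult_smult add_diff_eq diff_add_cancel)
  qed
  \<comment> \<open>Pseudo-division stays inside k[x][y]: V is scaled by a power s of the leading
    coefficient instead of dividing by it.\<close>
  moreover obtain A R where AR: "pseudo_divmod V D = (A, R)" by fastforce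
  define s where "s = ld ^ (Suc (degree V) - degree D)"
  have dm: "smult s V = D * A + R" "R = 0 \<or> degree R < degree D"
    using pseudo_divmod[OF D(2) AR] by (simp_all add: s_def ld_def)
  have "D * A \<in> I" using mult[OF D(1), of A] by (simp add: mult.commute)
  ultimately have "smult s (smult [:- a, 1:] V - smult c 1) - smult [:- a, 1:] (D * A) \<in> I"
    using smult_in diff by blast
  also have "smult s (smult [:- a, 1:] V - smult c 1) - smult [:- a, 1:] (D * A)
      = smult [:- a, 1:] (smult s V) - smult [:- a, 1:] (D * A) - smult (s * c) 1"
    by (simp only: smult_diff_right smult_smult mult.commute) simp
  also have "\<dots> = smult [:- a, 1:] R - smult (s * c) 1"
    unfolding dm(1) by (simp only: smult_add_right) simp
  finally have S: "smult [:- a, 1:] R - smult (s * c) 1 \<in> I" .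
  have "smult [:- a, 1:] R - smult (s * c) 1 = 0 \<or> degree (smult [:- a, 1:] R - smult (s * c) 1) < degree D"
  proof -
    have "degree (smult [:- a, 1:] R) < degree D" using dm(2) d by (auto simp: degree_smult_eq)
    moreover have "degree (smult (s * c) (1 :: 'k poly poly)) = 0" by (simp add: degree_smult_eq)
    ultimately show ?thesis using d
      by (metis degree_diff_le_max le_less_trans max_less_iff_conj)
  qed
  then have "smult [:- a, 1:] R - smult (s * c) 1 = 0" using small[OF S] by blast
  \<comment> \<open>At x = a the multiple of x - a disappears and the constant term in y leaves s *
    c, which was arranged to be nonzero there.\<close>
  then have "poly (coeff (smult [:- a, 1:] R - smult (s * c) 1) 0) a = 0" by simp
  then have "poly (s * c) a = 0" by simp
  then show False using a by (simp add: s_def c_def xm_def)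
qed

section \<open>Actions of polynomials by commuting operators\<close>

context avg_space
begin

definition poly_act :: "('v \<Rightarrow> 'v) \<Rightarrow> 'v \<Rightarrow> 'k poly \<Rightarrow> 'v" where
  "poly_act X l p = fold_coeffs (\<lambda>c y. c *s l + X y) p 0"

text \<open>P(X, Y) applied to l in Horner form: the outer variable acts by Y, and the coefficients
  are polynomials in X.\<close>

definition poly_act2 :: "('v \<Rightarrow> 'v) \<Rightarrow> ('v \<Rightarrow> 'v) \<Rightarrow> 'v \<Rightarrow> 'k poly poly \<Rightarrow> 'v" where
  "poly_act2 X Y l P = fold_coeffs (\<lambda>q y. poly_act X l q + Y y) P 0"

lemma poly_act_0 [simp]: "poly_act X l 0 = 0"
  by (simp add: poly_act_def)

lemma poly_act_pCons [simp]: "linmap X \<Longrightarrow> poly_act X l (pCons c p) = c *s l + X (poly_act X l p)"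
  by (cases "p = 0 \<and> c = 0") (auto simp: poly_act_def linmap_0)

lemma poly_act2_0 [simp]: "poly_act2 X Y l 0 = 0"
  by (simp add: poly_act2_def)

lemma poly_act2_pCons [simp]:
  "linmap Y \<Longrightarrow> poly_act2 X Y l (pCons q P) = poly_act X l q + Y (poly_act2 X Y l P)"
  by (cases "P = 0 \<and> q = 0") (auto simp: poly_act2_def linmap_0)

lemma poly_act_add: "linmap X \<Longrightarrow> poly_act X l (p + q) = poly_act X l p + poly_act X l q"
proof (induction p q rule: poly_induct2)
  case (pCons a p b q)
  then show ?case by (simp add: linmap_add scale_left_distrib algebra_simps)
qed simp

lemma poly_act_smult: "linmap X \<Longrightarrow> poly_act X l (smult c p) = c *s poly_act X l p"
  by (induction p) (simp_all add: linmap_scale scale_right_distrib)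

lemma poly_act2_add:
  "linmap X \<Longrightarrow> linmap Y \<Longrightarrow> poly_act2 X Y l (P + Q) = poly_act2 X Y l P + poly_act2 X Y l Q"
proof (induction P Q rule: poly_induct2)
  case (pCons a p b q)
  then show ?case by (simp add: linmap_add poly_act_add algebra_simps)
qed simp

lemma poly_act2_smult_const:
  "linmap X \<Longrightarrow> linmap Y \<Longrightarrow> poly_act2 X Y l (smult [:c:] P) = c *s poly_act2 X Y l P"
  by (induction P) (simp_all add: linmap_scale scale_right_distrib poly_act_smult)

lemma poly_act2_smult_x:
  assumes X: "linmap X" and Y: "linmap Y" and XY: "\<And>z. X (Y z) = Y (X z)"
  shows "poly_act2 X Y l (smult (pCons 0 q) P) = X (poly_act2 X Y l (smult q P))"
proof (induction P)
  case (pCons r P)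
  have "pCons 0 q * r = pCons 0 (q * r)" by simp
  then show ?case using pCons X Y by (simp add: linmap_add XY)
qed (simp add: linmap_0[OF X])

lemma poly_act2_smult_pCons:
  assumes X: "linmap X" and Y: "linmap Y" and XY: "\<And>z. X (Y z) = Y (X z)"
  shows "poly_act2 X Y l (smult (pCons c q) P) = c *s poly_act2 X Y l P + X (poly_act2 X Y l (smult q P))"
proof -
  have "smult (pCons c q) P = smult [:c:] P + smult (pCons 0 q) P"
    by (simp add: smult_add_left[symmetric])
  then show ?thesis
    by (simp only: poly_act2_add[OF X Y] poly_act2_smult_const[OF X Y] poly_act2_smult_x[OF assms])
qed

lemma poly_act2_smult_linear:
  assumes X: "linmap X" and Y: "linmap Y" and XY: "\<And>z. X (Y z) = Y (X z)"
  shows "poly_act2 X Y l (smult [:- c, 1:] P) = X (poly_act2 X Y l P) - c *s poly_act2 X Y l P"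
proof -
  have "smult [:1:] P = P" by (simp add: one_pCons[symmetric])
  then show ?thesis by (simp only: poly_act2_smult_pCons[OF assms]) simp
qed

lemma poly_act2_mult_in:
  assumes X: "linmap X" and Y: "linmap Y" and XY: "\<And>z. X (Y z) = Y (X z)"
    and M: "subspace M" "\<And>z. z \<in> M \<Longrightarrow> X z \<in> M" "\<And>z. z \<in> M \<Longrightarrow> Y z \<in> M"
    and P: "poly_act2 X Y l P \<in> M"
  shows "poly_act2 X Y l (Q * P) \<in> M"
proof (induction Q)
  case (pCons q Q)
  have "poly_act2 X Y l (smult q P) \<in> M"
  proof (induction q)
    case (pCons c q)
    then show ?case
      unfolding poly_act2_smult_pCons[OF X Y XY] using M P by (simp add: subspace_add subspace_scale)
  qed (simp add: subspace_0 M)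
  then show ?case using pCons.IH M X Y
    by (simp add: mult_pCons_left poly_act2_add subspace_add)
qed (simp add: subspace_0 M)

lemma poly_act2_monom:
  assumes X: "linmap X" and Y: "linmap Y"
  shows "poly_act2 X Y l (monom ([:0, 1:] ^ m) n) = (Y ^^ n) ((X ^^ m) l)"
proof (induction n)
  case 0
  have "poly_act X l ([:0, 1:] ^ m) = (X ^^ m) l"
    by (induction m) (simp_all add: X one_pCons linmap_0)
  then show ?case by (simp add: monom_0 Y linmap_0)
next
  case (Suc n)
  then show ?case by (simp add: monom_Suc Y)
qed

end

section \<open>The Jacquet module of a supercuspidal representation vanishes\<close>

locale gl2_rep_closed = gl2_rep v smul rho psi
  for v :: "'e::field \<Rightarrow> int" and smul :: "'k::field \<Rightarrow> 'v::ab_group_add \<Rightarrow> 'v" (infixr \<open>*s\<close> 75)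
    and rho :: "'e mat2 \<Rightarrow> 'v \<Rightarrow> 'v" and psi :: "'e \<Rightarrow> 'k" +
  assumes alg_closed: "degree (q :: 'k poly) > 0 \<Longrightarrow> \<exists>x. poly q x = 0"
begin

text \<open>The kernel of the projection to the Jacquet module: for b = 0 the operator \<open>spec b N\<close>
  is the plain average over a compact subgroup of the unipotent radical.\<close>

definition jac :: "'v set" where
  "jac = {x. \<exists>N. spec 0 N x = 0}"

text \<open>A larger exponent means a smaller ball on the dual side; restricting to a ball and then
  to a concentric smaller one is restriction to the smaller one.\<close>

lemma spec_spec:
  assumes "N \<le> N'"
  shows "spec b N' (spec b N x) = spec b N' x"
proof -
  have "spec b N' (spec b N x) = avg (1 - N) (\<lambda>t. psi (- (b * t)) *s spec b N' (rU t x))"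
    by (rule linmap_of_spec) simp
  also have "\<dots> = spec b N' x"
  proof (rule avg_const')
    fix t assume "t \<in> pp (1 - N)"
    then have "t \<in> pp (1 - N')" by (rule pp_mono[rotated]) (use assms in simp)
    then show "psi (- (b * t)) *s spec b N' (rU t x) = spec b N' x"
      by (simp add: spec_U psi_uminus psi_nz)
  qed
  finally show ?thesis .
qed

lemma spec_0_mono: "N \<le> N' \<Longrightarrow> spec 0 N x = 0 \<Longrightarrow> spec 0 N' x = 0"
  using spec_spec[of N N' 0 x] linmap_0[OF linmap_spec] by simp

lemma subspace_jac: "subspace jac"
  unfolding subspace_def jac_def
proof (intro conjI allI ballI)
  show "0 \<in> {x. \<exists>N. spec 0 N x = 0}" by (simp add: linmap_0[OF linmap_spec])
  fix x assume x: "x \<in> {x. \<exists>N. spec 0 N x = 0}"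
  show "c *s x \<in> {x. \<exists>N. spec 0 N x = 0}" for c
    using x by (auto simp: linmap_scale[OF linmap_spec])
  fix y assume "y \<in> {x. \<exists>N. spec 0 N x = 0}"
  then obtain N N' where "spec 0 N x = 0" "spec 0 N' y = 0" using x by blast
  then have "spec 0 (max N N') x = 0" "spec 0 (max N N') y = 0"
    using spec_0_mono[of N "max N N'"] spec_0_mono[of N' "max N N'"] by auto
  then show "x + y \<in> {x. \<exists>N. spec 0 N x = 0}"
    by (intro CollectI exI[of _ "max N N'"]) (simp add: linmap_add[OF linmap_spec])
qed

text \<open>With t in p^m the exponent \<open>1 - m\<close> puts t into the group over which
  \<open>spec 0 (1 - m)\<close> averages, so the two averages agree.\<close>

lemma U_diff_jac: "rU t x - x \<in> jac"
proof -
  obtain m where "t \<in> pp m" using pp_exists by blast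
  then have "spec 0 (1 - m) (rU t x) = spec 0 (1 - m) x" by (subst spec_U) auto
  then show ?thesis unfolding jac_def by (auto simp: linmap_diff[OF linmap_spec])
qed

lemma T_jac: "a \<noteq> 0 \<Longrightarrow> x \<in> jac \<Longrightarrow> rT a x \<in> jac"
proof -
  assume a: "a \<noteq> 0" "x \<in> jac"
  then obtain N where "spec 0 N x = 0" by (auto simp: jac_def)
  then have "spec 0 (N - v a) (rT a x) = 0"
    using T_spec[OF a(1), of 0 N x] linmap_0[OF linmap_T[OF a(1)]] by simp
  then show ?thesis by (auto simp: jac_def)
qed

lemma Z_jac: "a \<noteq> 0 \<Longrightarrow> x \<in> jac \<Longrightarrow> rZ a x \<in> jac"
  by (clarsimp simp: jac_def Z_spec[symmetric]) (metis linmap_0 linmap_Z)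

lemma Z_mult: "a \<noteq> 0 \<Longrightarrow> b \<noteq> 0 \<Longrightarrow> rZ a (rZ b x) = rZ (a * b) x"
  by (simp add: rZ_def rho_mmult)

lemma Z_1 [simp]: "rZ 1 x = x"
  by (simp add: rZ_def)

lemma T_Z: "a \<noteq> 0 \<Longrightarrow> b \<noteq> 0 \<Longrightarrow> rT a (rZ b x) = rZ b (rT a x)"
  by (simp add: rT_def Z_rho)

section \<open>Torus-stable subspaces above the Jacquet kernel\<close>

lemma borel_decompose: "a \<noteq> 0 \<Longrightarrow> d \<noteq> 0 \<Longrightarrow> rho (a, x, 0, d) z = rU (x / d) (rT (a / d) (rZ d z))"
  by (simp add: rU_def rT_def rZ_def rho_mmult)

text \<open>These are the torus submodules of the Jacquet module, pulled back to V. Stability under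
  the unipotent radical is automatic, since each rU t x - x already lies in
  \<open>jac\<close>.\<close>

definition tstab :: "'v set \<Rightarrow> bool" where
  "tstab M \<longleftrightarrow> subspace M \<and> jac \<subseteq> M \<and> (\<forall>a x. a \<noteq> 0 \<longrightarrow> x \<in> M \<longrightarrow> rT a x \<in> M \<and> rZ a x \<in> M)"

lemma tstabD:
  assumes "tstab M"
  shows "subspace M" "jac \<subseteq> M" "\<And>a x. a \<noteq> 0 \<Longrightarrow> x \<in> M \<Longrightarrow> rT a x \<in> M"
    "\<And>a x. a \<noteq> 0 \<Longrightarrow> x \<in> M \<Longrightarrow> rZ a x \<in> M"
  using assms unfolding tstab_def by blast+

lemma tstab_U: "tstab M \<Longrightarrow> x \<in> M \<Longrightarrow> rU t x \<in> M"
proof -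
  assume M: "tstab M" "x \<in> M"
  then have "(rU t x - x) + x \<in> M" using U_diff_jac tstabD[OF M(1)] subspace_add by blast
  then show ?thesis by simp
qed

text \<open>By the Iwasawa decomposition the translates of one vector by a compact set generate the
  representation over the Borel subgroup, and by smoothness there are finitely many of them.\<close>

lemma finite_borel_generators:
  "\<exists>S. finite S \<and> (\<forall>M. tstab M \<longrightarrow> S \<subseteq> M \<longrightarrow> M = UNIV)"
proof (cases "\<exists>x::'v. x \<noteq> 0")
  case False
  then have "M = UNIV" if "tstab M" for M :: "'v set"
    using subspace_0[OF tstabD(1)[OF that]] by (metis UNIV_eq_I)
  then show ?thesis by (intro exI[of _ "{}"]) auto
next
  case True
  then obtain x :: 'v where x: "x \<noteq> 0" by blast
  obtain n where n: "fixed_at n x" using fixed_at_exists by blast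
  define l where "l s = rho (1, 0, s, 1) x" for s
  define u where "u s = rW (rU s x)" for s
  have "l s = l t" if "s - t \<in> pp n" for s t
  proof -
    have "rho (1, 0, s - t, 1) x = x" by (rule fixed_atD[OF n]) (use that in auto)
    then have "rho (1, 0, t, 1) (rho (1, 0, s - t, 1) x) = l t" by (simp add: l_def)
    then show ?thesis by (simp add: rho_mmult l_def)
  qed
  then have fl: "finite (l ` pp 0)" using pp_finite_image[of 0 n l] by blast
  have "u s = u t" if "s \<in> pp 0" "t \<in> pp 0" "s - t \<in> pp n" for s t
  proof -
    have "rU s x = rU t x"
      by (rule lconstD[OF lconst_U[OF n, of 0] that(1,2)]) (use that n in \<open>auto simp: fixed_at_def max_def\<close>)
    then show ?thesis by (simp add: u_def)
  qed
  then have fu: "finite (u ` pp 0)" using pp_finite_image[of 0 n u] by blast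
  show ?thesis
  proof (intro exI[of _ "l ` pp 0 \<union> u ` pp 0"] conjI allI impI)
    show "finite (l ` pp 0 \<union> u ` pp 0)" using fl fu by simp
    fix M assume M: "tstab M" and S: "l ` pp 0 \<union> u ` pp 0 \<subseteq> M"
    note MD = tstabD[OF M]
    have borel: "rho (a, b, 0, d) y \<in> M" if "a \<noteq> 0" "d \<noteq> 0" "y \<in> M" for a b d y
      using that MD(3,4) tstab_U[OF M] by (simp add: borel_decompose)
    have in_M: "rho g x \<in> M" if g: "g \<in> GL2" for g
    proof -
      obtain a b c d where g': "g = (a, b, c, d)" by (cases g)
      then have det: "a * d - b * c \<noteq> 0" using g by simp
      \<comment> \<open>Cosets of the Borel subgroup are points (c : d) of the projective line,
        which is covered by the two charts where c / d or d / c is integral. The families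
        \<open>l\<close> and \<open>u\<close> represent these charts.\<close>
      show ?thesis
      proof (cases "d \<noteq> 0 \<and> c / d \<in> pp 0")
        case True
        have "g = mmult ((a * d - b * c) / d, b, 0, d) (1, 0, c / d, 1)"
          using True by (simp add: g' field_simps)
        then have "rho g x = rho ((a * d - b * c) / d, b, 0, d) (l (c / d))"
          using True det by (simp add: l_def rho_mmult del: mmult.simps)
        then show ?thesis using borel S True det by auto
      next
        case False
        have c: "c \<noteq> 0 \<and> d / c \<in> pp 0"
          using False det v_divide[of c d] v_divide[of d c] by (cases "d = 0"; cases "c = 0") (auto simp: pp_def)
        have "rho g x = rho (b - a * d / c, - a, 0, - c) (u (d / c))"
          using c det by (simp add: u_def rW_def rU_def rho_mmult g' field_simps)
        moreover have "b - a * d / c \<noteq> 0" using c det by (simp add: field_simps)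
        ultimately show ?thesis using borel S c by auto
      qed
    qed
    \<comment> \<open>The largest subrepresentation contained in M; it contains x and is therefore
      everything.\<close>
    define Q where "Q = {y. \<forall>g\<in>GL2. rho g y \<in> M}"
    have "Q = UNIV"
    proof (rule irr_eq_UNIV)
      show "subspace Q" unfolding subspace_def Q_def
        using MD(1) by (auto simp: linmap_add[OF rho_linmap] linmap_scale[OF rho_linmap]
            subspace_0 subspace_add subspace_scale)
      show "rho h y \<in> Q" if "h \<in> GL2" "y \<in> Q" for h y
        using that by (auto simp: Q_def rho_mmult)
      show "x \<in> Q" using in_M by (simp add: Q_def)
    qed (rule x)
    show "M = UNIV"
    proof (rule UNIV_eq_I[symmetric])
      fix y
      have "y \<in> Q" using \<open>Q = UNIV\<close> by simp
      then have "rho (1, 0, 0, 1) y \<in> M" unfolding Q_def by (simp del: rho_one)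
      then show "y \<in> M" by simp
    qed
  qed
qed

text \<open>Zorn's lemma applies because finite generation keeps the union of a chain proper: a
  finite generating set inside the union would lie in one member.\<close>

lemma maximal_tstab:
  assumes "jac \<noteq> UNIV"
  shows "\<exists>M. tstab M \<and> M \<noteq> UNIV \<and> (\<forall>M'. tstab M' \<longrightarrow> M \<subseteq> M' \<longrightarrow> M' = M \<or> M' = UNIV)"
proof -
  obtain S where S: "finite S" "\<And>M. tstab M \<Longrightarrow> S \<subseteq> M \<Longrightarrow> M = UNIV"
    using finite_borel_generators by blast
  let ?A = "{M. tstab M \<and> M \<noteq> UNIV}"
  have "\<exists>M\<in>?A. \<forall>X\<in>?A. M \<subseteq> X \<longrightarrow> X = M"
  proof (rule subset_Zorn_nonempty)
    have "tstab jac" unfolding tstab_def using subspace_jac T_jac Z_jac by blast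
    then show "?A \<noteq> {}" using assms by blast
    fix \<C> assume C: "\<C> \<noteq> {}" "subset.chain ?A \<C>"
    then have CA: "\<And>M. M \<in> \<C> \<Longrightarrow> tstab M \<and> M \<noteq> UNIV"
      and total: "\<And>M M'. M \<in> \<C> \<Longrightarrow> M' \<in> \<C> \<Longrightarrow> M \<subseteq> M' \<or> M' \<subseteq> M"
      by (auto simp: subset_chain_def)
    have sub: "subspace (\<Union>\<C>)"
      unfolding subspace_def
    proof (intro conjI ballI allI)
      show "0 \<in> \<Union>\<C>" using C(1) CA tstabD(1) subspace_0 by blast
      show "c *s x \<in> \<Union>\<C>" if "x \<in> \<Union>\<C>" for c x
        using that CA tstabD(1) subspace_scale by blast
      fix x y assume "x \<in> \<Union>\<C>" "y \<in> \<Union>\<C>"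
      then obtain X Y where XY: "X \<in> \<C>" "Y \<in> \<C>" "x \<in> X" "y \<in> Y" by blast
      then obtain Z where "Z \<in> \<C>" "x \<in> Z" "y \<in> Z" using total by blast
      then show "x + y \<in> \<Union>\<C>" using CA tstabD(1) subspace_add by blast
    qed
    have st: "tstab (\<Union>\<C>)"
      unfolding tstab_def
    proof (intro conjI allI impI)
      show "jac \<subseteq> \<Union>\<C>" using C(1) CA tstabD(2) by blast
      show "rT a x \<in> \<Union>\<C>" "rZ a x \<in> \<Union>\<C>" if "a \<noteq> 0" "x \<in> \<Union>\<C>" for a x
        using that CA tstabD(3,4) by blast+
    qed (rule sub)
    have "\<Union>\<C> \<noteq> UNIV"
    proof
      assume "\<Union>\<C> = UNIV"
      then obtain B where "B \<in> \<C>" "S \<subseteq> B"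
        using finite_subset_Union_chain[OF S(1) _ C(1,2)] by auto
      then show False using S(2) CA by blast
    qed
    then show "\<Union>\<C> \<in> ?A" using st by blast
  qed
  then show ?thesis by blast
qed

end

text \<open>V / M is a simple torus module. It is not formed as a type; equality in the quotient is
  written as membership of a difference in \<open>M\<close>.\<close>

locale borel_quotient = gl2_rep_closed v smul rho psi
  for v :: "'e::field \<Rightarrow> int" and smul :: "'k::field \<Rightarrow> 'v::ab_group_add \<Rightarrow> 'v" (infixr \<open>*s\<close> 75)
    and rho :: "'e mat2 \<Rightarrow> 'v \<Rightarrow> 'v" and psi :: "'e \<Rightarrow> 'k" +
  fixes M :: "'v set"
  assumes M: "tstab M" and proper: "M \<noteq> UNIV"
    and maxi: "\<And>M'. tstab M' \<Longrightarrow> M \<subseteq> M' \<Longrightarrow> M' = M \<or> M' = UNIV"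
begin

lemma subM: "subspace M"
  by (rule tstabD(1)[OF M])

lemmas M_add = subspace_add[OF subM] and M_diff = subspace_diff[OF subM]
  and M_scale = subspace_scale[OF subM] and M_0 = subspace_0[OF subM]

definition torus_op :: "('v \<Rightarrow> 'v) \<Rightarrow> bool" where
  "torus_op h \<longleftrightarrow> linmap h \<and> (\<forall>x\<in>M. h x \<in> M) \<and>
     (\<forall>a x. a \<noteq> 0 \<longrightarrow> h (rT a x) = rT a (h x) \<and> h (rZ a x) = rZ a (h x))"

definition scalar_op :: "('v \<Rightarrow> 'v) \<Rightarrow> bool" where
  "scalar_op h \<longleftrightarrow> (\<exists>c. \<forall>x. h x - c *s x \<in> M)"

lemma torus_opD:
  assumes "torus_op h"
  shows "linmap h" "\<And>x. x \<in> M \<Longrightarrow> h x \<in> M" "\<And>a x. a \<noteq> 0 \<Longrightarrow> h (rT a x) = rT a (h x)"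
    "\<And>a x. a \<noteq> 0 \<Longrightarrow> h (rZ a x) = rZ a (h x)"
  using assms unfolding torus_op_def by blast+

lemma torus_op_T: "a \<noteq> 0 \<Longrightarrow> torus_op (rT a)"
  unfolding torus_op_def using tstabD[OF M] by (simp add: T_mult T_Z mult.commute)

lemma torus_op_Z: "a \<noteq> 0 \<Longrightarrow> torus_op (rZ a)"
  unfolding torus_op_def using tstabD[OF M] by (simp add: Z_mult T_Z mult.commute)

lemma linmap_diff_scale: "linmap h \<Longrightarrow> linmap (\<lambda>x. h x - c *s x)"
  by (simp add: linmap_def scale_right_distrib scale_right_diff_distrib mult.commute)

lemma tstab_kernel:
  assumes h: "torus_op h"
  shows "tstab {x. h x - c *s x \<in> M}"
  unfolding tstab_def
proof (intro conjI allI impI)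
  note hD = torus_opD[OF h]
  show "subspace {x. h x - c *s x \<in> M}"
    by (rule subspace_linmap_vimage[OF linmap_diff_scale[OF hD(1)] subM])
  have "x \<in> {x. h x - c *s x \<in> M}" if "x \<in> M" for x
    using that hD(2) M_diff M_scale by simp
  then show "jac \<subseteq> {x. h x - c *s x \<in> M}" using tstabD(2)[OF M] by blast
  fix a :: 'e and x assume a: "a \<noteq> 0" and x: "x \<in> {x. h x - c *s x \<in> M}"
  have "h (rT a x) - c *s rT a x = rT a (h x - c *s x)"
    using a by (simp add: hD(3) linmap_diff[OF linmap_T] linmap_scale[OF linmap_T])
  then show "rT a x \<in> {x. h x - c *s x \<in> M}" using x tstabD(3)[OF M a] by simp
  have "h (rZ a x) - c *s rZ a x = rZ a (h x - c *s x)"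
    using a by (simp add: hD(4) linmap_diff[OF linmap_Z] linmap_scale[OF linmap_Z])
  then show "rZ a x \<in> {x. h x - c *s x \<in> M}" using x tstabD(4)[OF M a] by simp
qed

text \<open>The first half of Schur's lemma: the kernel of h - c on V / M is zero or everything, and
  the second case would make h scalar.\<close>

lemma torus_op_injective:
  assumes h: "torus_op h" and ns: "\<not> scalar_op h" and x: "h x - c *s x \<in> M"
  shows "x \<in> M"
proof -
  have "M \<subseteq> {x. h x - c *s x \<in> M}"
    using torus_opD(2)[OF h] M_diff M_scale by auto
  then have "{x. h x - c *s x \<in> M} = M \<or> {x. h x - c *s x \<in> M} = UNIV"
    using maxi[OF tstab_kernel[OF h]] by blast
  then show ?thesis using ns x unfolding scalar_op_def by blast
qed

lemma torus_op_surjective: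
  assumes h: "torus_op h" and ns: "\<not> scalar_op h"
  shows "\<exists>x. h x - c *s x - y \<in> M"
proof -
  note hD = torus_opD[OF h]
  let ?R = "{y. \<exists>x. h x - c *s x - y \<in> M}"
  have sub: "subspace ?R"
    by (rule subspace_range_mod[OF linmap_diff_scale[OF hD(1)] subM])
  have MR: "M \<subseteq> ?R"
  proof
    fix y assume "y \<in> M"
    then have "h 0 - c *s 0 - y \<in> M" using M_scale[of y "-1"] by (simp add: linmap_0[OF hD(1)])
    then show "y \<in> ?R" by blast
  qed
  have "tstab ?R"
    unfolding tstab_def
  proof (intro conjI allI impI)
    show "jac \<subseteq> ?R" using MR tstabD(2)[OF M] by blast
    fix a :: 'e and y assume a: "a \<noteq> 0" and "y \<in> ?R"
    then obtain x where x: "h x - c *s x - y \<in> M" by blast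
    have "h (rT a x) - c *s rT a x - rT a y = rT a (h x - c *s x - y)"
      using a by (simp add: hD(3) linmap_diff[OF linmap_T] linmap_scale[OF linmap_T])
    then show "rT a y \<in> ?R" using tstabD(3)[OF M a x] by (metis (mono_tags, lifting) mem_Collect_eq)
    have "h (rZ a x) - c *s rZ a x - rZ a y = rZ a (h x - c *s x - y)"
      using a by (simp add: hD(4) linmap_diff[OF linmap_Z] linmap_scale[OF linmap_Z])
    then show "rZ a y \<in> ?R" using tstabD(4)[OF M a x] by (metis (mono_tags, lifting) mem_Collect_eq)
  qed (rule sub)
  then consider "?R = M" | "?R = UNIV" using maxi MR by blast
  then show ?thesis
  proof cases
    case 1
    have "h x - c *s x \<in> M" for x
    proof -
      have "h x - c *s x \<in> ?R" using M_0 by (auto intro!: exI[of _ x])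
      then show ?thesis using 1 by blast
    qed
    then show ?thesis using ns unfolding scalar_op_def by blast
  qed blast
qed

text \<open>X^m - 1 splits into linear factors over k. If h were not scalar each factor would be
  injective on V / M, although their product is zero there.\<close>

lemma scalar_op_periodic:
  assumes h: "torus_op h" and m: "m > 0" and per: "\<And>x. (h ^^ m) x - x \<in> M"
  shows "scalar_op h"
proof (rule ccontr)
  assume ns: "\<not> scalar_op h"
  have h': "linmap h" using torus_opD(1)[OF h] .
  have cancel: "x \<in> M" if "q \<noteq> 0" "poly_act h x q \<in> M" for x q
    using that
  proof (induction "degree q" arbitrary: q)
    case 0
    then obtain c where c: "q = [:c:]" by (metis degree_eq_zeroE)
    then have "c *s x \<in> M" "c \<noteq> 0" using 0 h' by (simp_all add: linmap_0)
    then show ?case using M_scale[of "c *s x" "inverse c"] by simp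
  next
    case (Suc n)
    obtain a where "poly q a = 0" using alg_closed[of q] Suc(2) by auto
    then obtain r where r: "q = [:- a, 1:] * r" by (metis poly_eq_0_iff_dvd dvdE)
    then have r0: "r \<noteq> 0" using Suc.prems by auto
    then have "degree q = Suc (degree r)" unfolding r by (subst degree_mult_eq) auto
    moreover have "poly_act h x q = h (poly_act h x r) - a *s poly_act h x r"
    proof -
      have e: "q = smult (- a) r + pCons 0 r" by (simp add: r)
      show ?thesis
        unfolding e poly_act_add[OF h'] poly_act_smult[OF h'] poly_act_pCons[OF h'] by simp
    qed
    then have "h (poly_act h x r) - a *s poly_act h x r \<in> M" using Suc.prems(2) by metis
    then have "poly_act h x r \<in> M" by (rule torus_op_injective[OF h ns])
    ultimately show ?case using Suc.hyps(1)[of r] Suc.hyps(2) r0 by simp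
  qed
  have "x \<in> M" for x
  proof (rule cancel)
    have mon: "poly_act h x (monom 1 m) = (h ^^ m) x" for m
      by (induction m) (simp_all add: monom_0 monom_Suc h' linmap_0)
    have e: "monom 1 m - [:1:] = monom 1 m + smult (- 1) (monom (1 :: 'k) 0)" by (simp add: monom_0)
    have "poly_act h x (monom 1 m - [:1:]) = (h ^^ m) x - x"
      unfolding e poly_act_add[OF h'] poly_act_smult[OF h'] mon by simp
    then show "poly_act h x (monom 1 m - [:1:]) \<in> M" using per by simp
    have "coeff (monom 1 m - [:1 :: 'k:]) m = 1" using m by (cases m) simp_all
    then show "monom 1 m - [:1 :: 'k:] \<noteq> 0" by (metis coeff_0 zero_neq_one)
  qed
  then show False using proper by blast
qed

text \<open>Pigeonhole on the powers of u modulo p^n, followed by cancelling a power of the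
  unit.\<close>

lemma unit_power:
  assumes u: "u \<noteq> 0" "v u = 0" and n: "0 \<le> n"
  shows "\<exists>m>0. u ^ m - 1 \<in> pp n"
proof -
  obtain C where C: "transversal 0 n C" using transversal_exists[OF n] by blast
  define f where "f i = (SOME c. c \<in> C \<and> u ^ i - c \<in> pp n)" for i :: nat
  have f: "f i \<in> C \<and> u ^ i - f i \<in> pp n" for i
  proof -
    have "u ^ i \<in> pp 0" using u v_power[of u i] by (simp add: pp_def)
    then show ?thesis unfolding f_def using transversalD(3)[OF C] by (metis (mono_tags, lifting) someI_ex)
  qed
  have "\<not> inj f"
  proof
    assume "inj f"
    moreover have "finite (range f)" using f transversalD(1)[OF C] by (meson finite_subset image_subsetI)
    ultimately show False using finite_imageD infinite_UNIV_nat by blast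
  qed
  then obtain i j where ij: "i < j" "f i = f j" unfolding inj_def by (metis linorder_neqE_nat)
  have "u ^ j - u ^ i \<in> pp n" using pp_diff f[of j] f[of i] ij(2) by fastforce
  moreover have "u ^ j - u ^ i = u ^ i * (u ^ (j - i) - 1)"
    using ij(1) by (simp add: algebra_simps flip: power_add)
  ultimately have "u ^ (j - i) - 1 \<in> pp n"
    using pp_mult_iff[of "u ^ i" "u ^ (j - i) - 1" n] u v_power[of u i] by simp
  then show ?thesis using ij(1) by (intro exI[of _ "j - i"]) simp
qed

text \<open>A congruence level fixing the finitely many generators works for all vectors, because
  the kernel of h - 1 on V / M is again torus-stable.\<close>

lemma one_units_trivial: "\<exists>n\<ge>1. \<forall>c\<in>pp n. \<forall>x. rT (1 + c) x - x \<in> M \<and> rZ (1 + c) x - x \<in> M"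
proof -
  obtain S where S: "finite S" "\<And>M. tstab M \<Longrightarrow> S \<subseteq> M \<Longrightarrow> M = UNIV"
    using finite_borel_generators by blast
  have "\<exists>n\<ge>1. \<forall>x\<in>S. fixed_at n x"
    using S(1)
  proof (induction S)
    case (insert x S)
    then obtain n where n: "n \<ge> 1" "\<forall>x\<in>S. fixed_at n x" by blast
    obtain n' where n': "fixed_at n' x" using fixed_at_exists by blast
    show ?case
      using n fixed_at_mono[of n _ "max n n'"] fixed_at_mono[OF n', of "max n n'"]
      by (intro exI[of _ "max n n'"]) auto
  qed auto
  then obtain n where n: "n \<ge> 1" "\<And>x. x \<in> S \<Longrightarrow> fixed_at n x" by blast
  have key: "h x - x \<in> M" if "torus_op h" "\<And>x. x \<in> S \<Longrightarrow> h x = x" for h x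
  proof -
    have "{x. h x - 1 *s x \<in> M} = UNIV"
      by (rule S(2)[OF tstab_kernel[OF that(1)]]) (use that(2) M_0 in auto)
    then show ?thesis by auto
  qed
  show ?thesis
  proof (intro exI[of _ n] conjI ballI allI)
    fix c x assume c: "c \<in> pp n"
    have nz: "1 + c \<noteq> 0" using one_unit_nz n(1) c by blast
    show "rT (1 + c) x - x \<in> M" using key[OF torus_op_T[OF nz]] fixed_at_T[OF n(2) c] by blast
    show "rZ (1 + c) x - x \<in> M" using key[OF torus_op_Z[OF nz]] fixed_at_Z[OF n(2) c] by blast
  qed (rule n(1))
qed

lemma scalar_op_unit:
  assumes u: "u \<noteq> 0" "v u = 0"
  shows "scalar_op (rT u)" "scalar_op (rZ u)"
proof -
  obtain n where n: "n \<ge> 1"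
    "\<And>c x. c \<in> pp n \<Longrightarrow> rT (1 + c) x - x \<in> M" "\<And>c x. c \<in> pp n \<Longrightarrow> rZ (1 + c) x - x \<in> M"
    using one_units_trivial by blast
  obtain m where m: "m > 0" "u ^ m - 1 \<in> pp n" using unit_power[OF u, of n] n(1) by auto
  have "(rT u ^^ m) x = rT (u ^ m) x" for x m
    by (induction m) (simp_all add: T_mult u)
  then have "(rT u ^^ m) x - x \<in> M" for x using n(2)[OF m(2), of x] by simp
  then show "scalar_op (rT u)" using scalar_op_periodic torus_op_T u m by blast
  have "(rZ u ^^ m) x = rZ (u ^ m) x" for x m
    by (induction m) (simp_all add: Z_mult u)
  then have "(rZ u ^^ m) x - x \<in> M" for x using n(3)[OF m(2), of x] by simp
  then show "scalar_op (rZ u)" using scalar_op_periodic torus_op_Z u m by blast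
qed

end

context borel_quotient
begin

section \<open>From two torus generators to codimension 1\<close>

lemma linmap_funpow: "linmap X \<Longrightarrow> linmap (X ^^ m)"
  by (induction m) (auto simp: linmap_def)

lemma funpow_in_M: "torus_op X \<Longrightarrow> x \<in> M \<Longrightarrow> (X ^^ m) x \<in> M"
  by (induction m) (auto dest: torus_opD(2))

lemma funpow_commute': "(\<And>z. X (Y z) = Y (X z)) \<Longrightarrow> X ((Y ^^ n) z) = (Y ^^ n) (X z)"
  by (induction n) auto

text \<open>If X were not scalar, \<open>torus_op_injective\<close> and
  \<open>torus_op_surjective\<close> would make each X - a bijective on V / M, and the annihilator
  of l in k[x, y] would contradict \<open>nullstellensatz2\<close>. Hypothesis \<open>gen\<close>
  says that l generates V / M over the Laurent polynomials in X and Y.\<close>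

lemma scalar_op_of_generators:
  assumes X: "torus_op X" and Y: "torus_op Y" and XY: "\<And>z. X (Y z) = Y (X z)"
    and Y_cancel: "\<And>z. Y z \<in> M \<Longrightarrow> z \<in> M" and l: "l \<notin> M"
    and gen: "\<And>G. subspace G \<Longrightarrow> M \<subseteq> G \<Longrightarrow> l \<in> G \<Longrightarrow> (\<And>z. X z \<in> G \<longleftrightarrow> z \<in> G) \<Longrightarrow>
      (\<And>z. Y z \<in> G \<longleftrightarrow> z \<in> G) \<Longrightarrow> G = UNIV"
  shows "scalar_op X"
proof (rule ccontr)
  assume ns: "\<not> scalar_op X"
  have LX: "linmap X" and LY: "linmap Y" using torus_opD(1) X Y by auto
  define act where "act = poly_act2 X Y l"
  define L where "L m n z = (Y ^^ n) ((X ^^ m) z)" for m n z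
  have LL: "linmap (L m n)" for m n
    unfolding L_def by (rule linmap_comp) (rule linmap_funpow[OF LY], rule linmap_funpow[OF LX])
  have LM: "z \<in> M \<Longrightarrow> L m n z \<in> M" for m n z
    unfolding L_def by (intro funpow_in_M X Y)
  have LS: "L (Suc m) n z = X (L m n z)" "L m (Suc n) z = Y (L m n z)" for m n z
    using funpow_commute'[of X Y n] XY by (simp_all add: L_def)
  have LX': "L m n (X z) = X (L m n z)" and LY': "L m n (Y z) = Y (L m n z)" for m n z
    using funpow_commute'[of X X m] funpow_commute'[of X Y n] funpow_commute'[of Y Y n] funpow_commute'[of Y X m] XY
    by (simp_all add: L_def)
  have act_X: "X (act P) = act (smult [:0, 1:] P)" for P
    using poly_act2_smult_linear[OF LX LY XY, of l 0 P] by (simp add: act_def)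
  have act_Y: "Y (act P) = act (pCons 0 P)" for P
    by (simp add: act_def LY)
  have act_add: "act (P + Q) = act P + act Q" and act_scale: "act (smult [:c:] P) = c *s act P" for P Q c
    unfolding act_def by (rule poly_act2_add[OF LX LY], rule poly_act2_smult_const[OF LX LY])
  have act_1: "act 1 = l" using poly_act2_monom[OF LX LY, of l 0 0] by (simp add: act_def)
  define K where "K = {y. \<exists>P. act P - y \<in> M}"
  have KI: "y \<in> K" if "act P - y \<in> M" for y P using that unfolding K_def by blast
  have K: "subspace K"
    unfolding subspace_def
  proof (intro conjI ballI allI)
    show "0 \<in> K" by (rule KI[of 0]) (simp add: act_def M_0)
    fix y assume "y \<in> K"
    then obtain P where P: "act P - y \<in> M" unfolding K_def by blast
    show "c *s y \<in> K" for c
      using M_scale[OF P, of c] by (intro KI[of "smult [:c:] P"]) (simp only: act_scale scale_right_diff_distrib)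
    fix y' assume "y' \<in> K"
    then obtain P' where P': "act P' - y' \<in> M" unfolding K_def by blast
    show "y + y' \<in> K"
      using M_add[OF P P'] by (intro KI[of "P + P'"]) (simp add: act_add algebra_simps)
  qed
  have KX: "X y \<in> K" and KY: "Y y \<in> K" if "y \<in> K" for y
  proof -
    obtain P where P: "act P - y \<in> M" using \<open>y \<in> K\<close> unfolding K_def by blast
    show "X y \<in> K"
      using torus_opD(2)[OF X P] by (intro KI[of "smult [:0, 1:] P"]) (simp only: act_X linmap_diff[OF LX])
    show "Y y \<in> K"
      using torus_opD(2)[OF Y P] by (intro KI[of "pCons 0 P"]) (simp only: act_Y linmap_diff[OF LY])
  qed
  \<comment> \<open>\<open>K\<close> is the polynomial orbit of l plus M. Its saturation
    \<open>G\<close> is also closed under the inverses of X and Y, with monomials clearing the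
    denominators.\<close>
  define G where "G = {z. \<exists>m n. L m n z \<in> K}"
  have GI: "z \<in> G" if "L m n z \<in> K" for m n z using that unfolding G_def by blast
  have up: "L (m + m') (n + n') z \<in> K" if "L m n z \<in> K" for m n m' n' z
  proof (induction m')
    case 0
    show ?case by (induction n') (use that KY in \<open>simp_all add: LS\<close>)
  qed (use KX in \<open>simp add: LS\<close>)
  have L0: "L 0 0 z = z" for z by (simp add: L_def)
  have "G = UNIV"
  proof (rule gen)
    show "subspace G"
      unfolding subspace_def
    proof (intro conjI ballI allI)
      show "0 \<in> G" by (rule GI[of 0 0]) (simp add: L0 subspace_0[OF K])
      fix z assume "z \<in> G"
      then obtain m n where z: "L m n z \<in> K" unfolding G_def by blast
      show "c *s z \<in> G" for c
        by (rule GI[of m n]) (simp add: linmap_scale[OF LL] subspace_scale[OF K z])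
      fix w assume "w \<in> G"
      then obtain m' n' where w: "L m' n' w \<in> K" unfolding G_def by blast
      show "z + w \<in> G"
        using subspace_add[OF K up[OF z, of m' n'] up[OF w, of m n]]
        by (intro GI[of "m + m'" "n + n'"]) (simp add: linmap_add[OF LL] add.commute)
    qed
    show "M \<subseteq> G"
    proof
      fix z assume "z \<in> M"
      then have "act 0 - z \<in> M" using M_scale[of z "-1"] by (simp add: act_def)
      then show "z \<in> G" using KI by (intro GI[of 0 0]) (simp add: L0)
    qed
    have "act 1 - l \<in> M" by (simp add: act_1 M_0)
    then show "l \<in> G" using KI by (intro GI[of 0 0]) (simp add: L0)
    show "X z \<in> G \<longleftrightarrow> z \<in> G" for z
      unfolding G_def mem_Collect_eq LX' using KX by (metis LS(1))
    show "Y z \<in> G \<longleftrightarrow> z \<in> G" for z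
      unfolding G_def mem_Collect_eq LY' using KY by (metis LS(2))
  qed
  have act_lin: "act (smult [:- a, 1:] P) = X (act P) - a *s act P" for a P
    unfolding act_def by (rule poly_act2_smult_linear[OF LX LY XY])
  show False
  proof (rule nullstellensatz2[of "{P. act P \<in> M}"])
    show "degree q > 0 \<Longrightarrow> \<exists>x. poly q x = 0" for q :: "'k poly" by (rule alg_closed)
    show "P + Q \<in> {P. act P \<in> M}" if "P \<in> {P. act P \<in> M}" "Q \<in> {P. act P \<in> M}" for P Q
      using that M_add by (simp add: act_add)
    show "Q * P \<in> {P. act P \<in> M}" if "P \<in> {P. act P \<in> M}" for P Q
      using poly_act2_mult_in[OF LX LY XY subM torus_opD(2)[OF X] torus_opD(2)[OF Y]] that
      by (simp add: act_def)
    show "1 \<notin> {P. act P \<in> M}" using l act_1 by simp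
    show "P \<in> {P. act P \<in> M}" if "smult [:- a, 1:] P \<in> {P. act P \<in> M}" for a P
    proof -
      have "X (act P) - a *s act P \<in> M" using that unfolding act_lin[symmetric] by blast
      then have "act P \<in> M" by (rule torus_op_injective[OF X ns])
      then show ?thesis by blast
    qed
    show "P \<in> {P. act P \<in> M}" if "pCons 0 P \<in> {P. act P \<in> M}" for P
      using that Y_cancel by (simp add: act_Y[symmetric])
    show "\<exists>P m n. smult [:- a, 1:] P - monom ([:0, 1:] ^ m) n \<in> {P. act P \<in> M}" for a
    proof -
      \<comment> \<open>z is (X - a)^-1 l modulo M; a monomial in X and Y makes it polynomial in l.
        This is where the monomial in the invertibility condition comes from.\<close>
      obtain z where z: "X z - a *s z - l \<in> M" using torus_op_surjective[OF X ns] by blast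
      obtain m n P where P: "act P - L m n z \<in> M" using \<open>G = UNIV\<close> unfolding G_def K_def by blast
      have "L m n (X z - a *s z - l) \<in> M" by (rule LM[OF z])
      then have 1: "X (L m n z) - a *s L m n z - L m n l \<in> M"
        by (simp add: linmap_diff[OF LL] linmap_scale[OF LL] LX')
      have "X (act P - L m n z) - a *s (act P - L m n z) \<in> M"
        using torus_opD(2)[OF X P] M_scale[OF P] M_diff by blast
      from M_add[OF 1 this] have "(X (act P) - a *s act P) - L m n l \<in> M"
        by (simp add: linmap_diff[OF LX] scale_right_diff_distrib algebra_simps)
      also have "(X (act P) - a *s act P) - L m n l = act (smult [:- a, 1:] P - monom ([:0, 1:] ^ m) n)"
      proof -
        have "smult [:- a, 1:] P - monom ([:0, 1:] ^ m) n
           = smult [:- a, 1:] P + smult [:- 1:] (monom ([:0, 1:] ^ m) n)"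
          by (simp add: smult_monom minus_monom)
        then have "act (smult [:- a, 1:] P - monom ([:0, 1:] ^ m) n)
            = act (smult [:- a, 1:] P) + (- 1) *s act (monom ([:0, 1:] ^ m) n)"
          by (simp only: act_add act_scale)
        moreover have "act (monom ([:0, 1:] ^ m) n) = L m n l"
          unfolding act_def L_def by (rule poly_act2_monom[OF LX LY])
        ultimately show ?thesis unfolding act_lin by simp
      qed
      finally show ?thesis by blast
    qed
  qed
qed

text \<open>Every nonzero element of the field is a unit times a power of w, and units act by
  scalars on V / M. Stability is an equivalence so that negative powers of w are covered.\<close>

lemma generators:
  assumes l: "l \<notin> M" and w: "w \<noteq> 0" "v w = 1"
    and G: "subspace G" "M \<subseteq> G" "l \<in> G"
    and TG: "\<And>z. rT w z \<in> G \<longleftrightarrow> z \<in> G" and ZG: "\<And>z. rZ w z \<in> G \<longleftrightarrow> z \<in> G"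
  shows "G = UNIV"
proof -
  have sc: "h z \<in> G" if h: "scalar_op h" and z: "z \<in> G" for h z
  proof -
    obtain c where "h z - c *s z \<in> M" using h unfolding scalar_op_def by blast
    then have "(h z - c *s z) + c *s z \<in> G"
      using G z by (intro subspace_add[OF G(1)] subspace_scale[OF G(1)]) auto
    then show ?thesis by simp
  qed
  have dec: "\<exists>u k. u \<noteq> 0 \<and> v u = 0 \<and> (a = u * w ^ k \<or> a * w ^ k = u)" if a: "a \<noteq> 0" for a
  proof (cases "v a \<ge> 0")
    case True
    have "v (a / w ^ nat (v a)) = 0" using v_divide[OF a, of "w ^ nat (v a)"] v_power[of w "nat (v a)"] w True by simp
    then show ?thesis using a w
      by (intro exI[of _ "a / w ^ nat (v a)"] exI[of _ "nat (v a)"]) simp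
  next
    case False
    have "v (a * w ^ nat (- v a)) = 0" using v_mult[OF a, of "w ^ nat (- v a)"] v_power[of w "nat (- v a)"] w False by simp
    then show ?thesis using a w
      by (intro exI[of _ "a * w ^ nat (- v a)"] exI[of _ "nat (- v a)"]) simp
  qed
  have torus: "h a z \<in> G"
    if h: "\<And>a b z. a \<noteq> 0 \<Longrightarrow> b \<noteq> 0 \<Longrightarrow> h a (h b z) = h (a * b) z" "\<And>z. h w z \<in> G \<longleftrightarrow> z \<in> G"
      "\<And>z. h 1 z = z" "\<And>u. u \<noteq> 0 \<Longrightarrow> v u = 0 \<Longrightarrow> scalar_op (h u)"
      and a: "a \<noteq> 0" and z: "z \<in> G" for h and a :: 'e and z
  proof -
    have pow: "h (w ^ k) z \<in> G \<longleftrightarrow> z \<in> G" for k z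
      by (induction k) (use h(2,3) w in \<open>simp_all flip: h(1)\<close>)
    obtain u k where u: "u \<noteq> 0" "v u = 0" "a = u * w ^ k \<or> a * w ^ k = u" using dec[OF a] by blast
    from u(3) show ?thesis
    proof
      assume "a = u * w ^ k"
      then have "h a z = h u (h (w ^ k) z)" using h(1)[of u "w ^ k" z] u(1) w(1) by simp
      then show ?thesis using sc[OF h(4)[OF u(1,2)]] pow z by simp
    next
      assume "a * w ^ k = u"
      then have "h (w ^ k) (h a z) = h u z" using h(1)[of "w ^ k" a z] a w(1) by (simp add: mult.commute)
      then show ?thesis using sc[OF h(4)[OF u(1,2)] z] pow by metis
    qed
  qed
  have "tstab G"
    unfolding tstab_def
    using tstabD(2)[OF M] G(1,2) torus[of rT, OF T_mult TG T_1 scalar_op_unit(1)]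
      torus[of rZ, OF Z_mult ZG Z_1 scalar_op_unit(2)] by blast
  then show ?thesis using maxi[of G] G l by blast
qed

lemma T_in_M: "a \<noteq> 0 \<Longrightarrow> rT a z \<in> M \<longleftrightarrow> z \<in> M"
  using tstabD(3)[OF M, of a z] tstabD(3)[OF M, of "1 / a" "rT a z"] by (auto simp: T_mult)

lemma Z_in_M: "a \<noteq> 0 \<Longrightarrow> rZ a z \<in> M \<longleftrightarrow> z \<in> M"
  using tstabD(4)[OF M, of a z] tstabD(4)[OF M, of "1 / a" "rZ a z"] by (auto simp: Z_mult)

text \<open>The two generators take the role of X in \<open>scalar_op_of_generators\<close> in turn.
  When both are scalar, the span of l plus M is torus-stable and so equals V.\<close>

lemma codim_1:
  assumes l: "l \<notin> M"
  shows "\<exists>c. z - c *s l \<in> M"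
proof -
  obtain w where w: "w \<noteq> 0" "v w = 1" using uniformizer by blast
  have sT: "scalar_op (rT w)"
  proof (rule scalar_op_of_generators[OF torus_op_T[OF w(1)] torus_op_Z[OF w(1)] _ _ l])
    show "rT w (rZ w z) = rZ w (rT w z)" for z by (rule T_Z[OF w(1) w(1)])
    show "z \<in> M" if "rZ w z \<in> M" for z using that Z_in_M[OF w(1)] by blast
  qed (rule generators[OF l w])
  have sZ: "scalar_op (rZ w)"
  proof (rule scalar_op_of_generators[OF torus_op_Z[OF w(1)] torus_op_T[OF w(1)] _ _ l])
    show "rZ w (rT w z) = rT w (rZ w z)" for z by (rule T_Z[OF w(1) w(1), symmetric])
    show "z \<in> M" if "rT w z \<in> M" for z using that T_in_M[OF w(1)] by blast
  qed (rule generators[OF l w])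
  define G where "G = {x + y |x y. x \<in> span {l} \<and> y \<in> M}"
  have subG: "subspace G"
    unfolding G_def by (rule subspace_sums[OF subspace_span subM])
  have MG: "M \<subseteq> G" and lG: "l \<in> G"
    unfolding G_def using span_zero[of "{l}"] span_base[of l "{l}"] M_0 by force+
  have sG: "h z \<in> G \<longleftrightarrow> z \<in> G" if h: "scalar_op h" "\<And>z. h z \<in> M \<longleftrightarrow> z \<in> M" for h z
  proof -
    obtain c where c: "\<And>z. h z - c *s z \<in> M" using h(1) unfolding scalar_op_def by blast
    have "c \<noteq> 0"
    proof
      assume "c = 0"
      then have "h l \<in> M" using c[of l] by simp
      then show False using h(2) l by blast
    qed
    have sh: "x + y \<in> G \<longleftrightarrow> y \<in> G" if "x \<in> G" for x y
      using subspace_add[OF subG that, of y] subspace_diff[OF subG _ that, of "x + y"] by auto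
    have "h z \<in> G \<longleftrightarrow> c *s z \<in> G" using sh[of "h z - c *s z" "c *s z"] c[of z] MG by auto
    also have "c *s z \<in> G \<longleftrightarrow> z \<in> G"
      using subspace_scale[OF subG, of z c] subspace_scale[OF subG, of "c *s z" "inverse c"] \<open>c \<noteq> 0\<close> by auto
    finally show ?thesis .
  qed
  have "G = UNIV"
    by (rule generators[OF l w subG MG lG]) (use sG[OF sT] sG[OF sZ] T_in_M Z_in_M w in auto)
  then obtain x y where "z = x + y" "x \<in> span {l}" "y \<in> M" unfolding G_def by blast
  moreover from this obtain k where "x = k *s l" by (auto simp: span_singleton)
  ultimately have "z - k *s l \<in> M" by simp
  then show ?thesis ..
qed

lemma torus_character:
  "\<exists>mu chi1 chi2. smooth_char v chi1 \<and> smooth_char v chi2 \<and>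
     (\<forall>x y. mu (x + y) = mu x + mu y) \<and> (\<forall>c x. mu (c *s x) = c * mu x) \<and> (\<exists>x. mu x \<noteq> 0) \<and>
     (\<forall>a d x z. a \<noteq> 0 \<longrightarrow> d \<noteq> 0 \<longrightarrow> mu (rho (a, x, 0, d) z) = chi1 a * chi2 d * mu z)"
proof -
  obtain l where l: "l \<notin> M" using proper by blast
  define mu where "mu z = (THE c. z - c *s l \<in> M)" for z
  have mu_eq: "mu z = c" if "z - c *s l \<in> M" for z c
    unfolding mu_def
  proof (rule the_equality[where P = "\<lambda>c. z - c *s l \<in> M", OF that])
    fix d assume "z - d *s l \<in> M"
    then have "(z - c *s l) - (z - d *s l) \<in> M" using that M_diff by blast
    then have dl: "(d - c) *s l \<in> M" by (simp add: scale_left_diff_distrib)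
    show "d = c"
      using M_scale[OF dl, of "inverse (d - c)"] l by (cases "d = c") auto
  qed
  have mu: "z - mu z *s l \<in> M" for z
    using codim_1[OF l, of z] mu_eq by blast
  have mu_add: "mu (x + y) = mu x + mu y" for x y
    using M_add[OF mu mu, of x y] by (intro mu_eq) (simp add: scale_left_distrib algebra_simps)
  have mu_scale: "mu (c *s x) = c * mu x" for c x
    using M_scale[OF mu, of c x] by (intro mu_eq) (simp add: scale_right_diff_distrib)
  have mu_l: "mu l = 1" by (rule mu_eq) (simp add: M_0)
  have mu_M: "mu z = 0 \<longleftrightarrow> z \<in> M" for z
    using mu[of z] mu_eq[of z 0] by auto
  have mu_T: "mu (rT a z) = mu (rT a l) * mu z" if "a \<noteq> 0" for a z
  proof -
    have "rT a (z - mu z *s l) \<in> M" using tstabD(3)[OF M that mu] .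
    then have "mu (rT a z - mu z *s rT a l) = 0"
      using mu_M that by (simp add: linmap_diff[OF linmap_T] linmap_scale[OF linmap_T])
    then have "mu (rT a z + (- mu z) *s rT a l) = 0" by simp
    then show ?thesis unfolding mu_add mu_scale by (simp add: mult.commute)
  qed
  have mu_Z: "mu (rZ a z) = mu (rZ a l) * mu z" if "a \<noteq> 0" for a z
  proof -
    have "rZ a (z - mu z *s l) \<in> M" using tstabD(4)[OF M that mu] .
    then have "mu (rZ a z - mu z *s rZ a l) = 0"
      using mu_M that by (simp add: linmap_diff[OF linmap_Z] linmap_scale[OF linmap_Z])
    then have "mu (rZ a z + (- mu z) *s rZ a l) = 0" by simp
    then show ?thesis unfolding mu_add mu_scale by (simp add: mult.commute)
  qed
  have mu_U: "mu (rU t z) = mu z" for t z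
  proof -
    have "mu (rU t z - z) = 0" using mu_M U_diff_jac tstabD(2)[OF M] by blast
    then have "mu (rU t z + (- 1) *s z) = 0" by simp
    then show ?thesis unfolding mu_add mu_scale by simp
  qed
  \<comment> \<open>diag(a,d) is diag(a / d, 1) times the scalar matrix d, which is why chi2
    contains the torus value at 1 / d.\<close>
  define chi1 where "chi1 a = mu (rT a l)" for a
  define chi2 where "chi2 d = mu (rT (1 / d) l) * mu (rZ d l)" for d
  have Tm: "mu (rT (a * b) l) = mu (rT a l) * mu (rT b l)" if "a \<noteq> 0" "b \<noteq> 0" for a b
    using mu_T[OF that(1), of "rT b l"] that by (simp add: T_mult)
  have Zm: "mu (rZ (a * b) l) = mu (rZ a l) * mu (rZ b l)" if "a \<noteq> 0" "b \<noteq> 0" for a b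
    using mu_Z[OF that(1), of "rZ b l"] that by (simp add: Z_mult)
  have nzT: "mu (rT a l) \<noteq> 0" "mu (rZ a l) \<noteq> 0" if "a \<noteq> 0" for a
    using that l mu_M T_in_M Z_in_M by auto
  obtain n where n: "fixed_at n l" using fixed_at_exists by blast
  have n1: "1 \<le> n" by (rule fixed_at_ge_1[OF n])
  have one: "rT x l = l" "rZ x l = l" "x \<noteq> 0" "rT (1 / x) l = l" if "x - 1 \<in> pp n" for x
  proof -
    show T: "rT x l = l" and "rZ x l = l" using fixed_at_T[OF n that] fixed_at_Z[OF n that] by simp_all
    show x: "x \<noteq> 0" using one_unit_nz[OF n1 that] by simp
    have "rT (1 / x) (rT x l) = l" using x by (simp add: T_mult)
    then show "rT (1 / x) l = l" using T by simp
  qed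
  have "smooth_char v chi1"
    unfolding smooth_char_def vge_iff_pp
    using nzT Tm one n1 mu_l by (auto simp: chi1_def intro!: exI[of _ n])
  moreover have "smooth_char v chi2"
    unfolding smooth_char_def vge_iff_pp
  proof (intro conjI allI impI)
    show "chi2 x \<noteq> 0" if "x \<noteq> 0" for x using nzT that by (simp add: chi2_def)
    show "chi2 (x * y) = chi2 x * chi2 y" if "x \<noteq> 0" "y \<noteq> 0" for x y
      using Tm[of "1 / x" "1 / y"] Zm[OF that] that by (simp add: chi2_def)
    show "\<exists>n\<ge>1. \<forall>x. x - 1 \<in> pp n \<longrightarrow> chi2 x = 1"
      using one n1 mu_l by (auto simp: chi2_def intro!: exI[of _ n])
  qed
  moreover have "mu (rho (a, x, 0, d) z) = chi1 a * chi2 d * mu z" if "a \<noteq> 0" "d \<noteq> 0" for a d x z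
  proof -
    have "mu (rho (a, x, 0, d) z) = mu (rT (a * (1 / d)) l) * (mu (rZ d l) * mu z)"
      using that mu_T[of "a / d" "rZ d z"] mu_Z[of d z] by (simp add: borel_decompose mu_U)
    also have "mu (rT (a * (1 / d)) l) = chi1 a * mu (rT (1 / d) l)"
      using that by (subst Tm) (auto simp: chi1_def)
    finally show ?thesis by (simp add: chi2_def)
  qed
  moreover have "\<exists>x. mu x \<noteq> 0" using mu_l by (intro exI[of _ l]) simp
  ultimately show ?thesis using mu_add mu_scale by blast
qed

end

context gl2_rep_closed
begin

text \<open>Frobenius reciprocity: z goes to the function h |-> mu (rho h z). Its kernel is a proper
  subrepresentation, so V embeds in the induced space, and the required surjection is the inverse on
  the image.\<close>

lemma subquotient_of_indI:
  assumes add: "\<And>x y. mu (x + y) = mu x + mu y" and scale: "\<And>c x. mu (c *s x) = c * mu x"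
    and nz: "\<exists>x. mu x \<noteq> 0"
    and equiv: "\<And>a d x z. a \<noteq> 0 \<Longrightarrow> d \<noteq> 0 \<Longrightarrow> mu (rho (a, x, 0, d) z) = chi1 a * chi2 d * mu z"
  shows "subquotient_of_ind v smul rho chi1 chi2"
proof -
  define f where "f z h = (if h \<in> GL2 then mu (rho h z) else 0)" for z h
  have mu0: "mu 0 = 0" using scale[of 0 0] by simp
  have f_add: "(\<lambda>h. f x h + f y h) = f (x + y)" for x y
    by (auto simp: f_def fun_eq_iff add linmap_add[OF rho_linmap])
  have f_scale: "(\<lambda>h. c * f x h) = f (c *s x)" for c x
    by (auto simp: f_def fun_eq_iff scale linmap_scale[OF rho_linmap])
  have f_zero: "(\<lambda>_. 0) = f 0" by (auto simp: f_def fun_eq_iff mu0)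
  have f_trans: "right_trans g (f x) = f (rho g x)" if g: "g \<in> GL2" for g x
  proof
    fix h
    have "mmult h g \<in> GL2 \<longleftrightarrow> h \<in> GL2" using g by (simp add: GL2_def mdet_mmult)
    then show "right_trans g (f x) h = f (rho g x) h"
      using g by (auto simp: right_trans_def f_def rho_mmult)
  qed
  have inj: "inj f"
  proof (rule injI)
    fix x y assume e: "f x = f y"
    define S where "S = {z. \<forall>g\<in>GL2. mu (rho g z) = 0}"
    have "invariant_subspace smul rho GL2 S"
      unfolding invariant_subspace_def subspace_def S_def
      by (auto simp: mu0 linmap_add[OF rho_linmap] linmap_scale[OF rho_linmap] add scale rho_mmult)
    moreover have "S \<noteq> UNIV"
    proof
      assume S: "S = UNIV"
      obtain z where z: "mu z \<noteq> 0" using nz by blast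
      have "z \<in> S" using S by blast
      then have "mu (rho (1, 0, 0, 1) z) = 0" unfolding S_def by (simp del: rho_one)
      then show False using z by simp
    qed
    moreover have "x - y \<in> S"
      unfolding S_def
    proof (intro CollectI ballI)
      fix g :: "'e mat2" assume g: "g \<in> GL2"
      have "mu (rho g x) = mu (rho g y)" using fun_cong[OF e, of g] g by (simp add: f_def)
      moreover have "mu (rho g x) = mu (rho g (x - y)) + mu (rho g y)"
        using g by (simp add: add[symmetric] linmap_diff[OF rho_linmap])
      ultimately show "mu (rho g (x - y)) = 0" by simp
    qed
    ultimately show "x = y" using irr[of S] by auto
  qed
  have in_ind: "f z \<in> ind_space v chi1 chi2" for z
    unfolding ind_space_def
  proof (intro CollectI conjI allI impI)
    show "f z g = 0" if "g \<notin> GL2" for g using that by (simp add: f_def)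
    show "f z (mmult (a, x, 0, d) g) = chi1 a * chi2 d * f z g" if "a \<noteq> 0" "d \<noteq> 0" "g \<in> GL2" for a x d g
    proof -
      have b: "(a, x, 0, d) \<in> GL2" using that by simp
      show ?thesis using that GL2_mmult[OF b that(3)] equiv[of a d x "rho g z"] rho_mmult[OF b that(3), of z]
        by (simp add: f_def del: GL2_mmult)
    qed
    obtain n where n: "fixed_at n z" using fixed_at_exists by blast
    show "\<exists>n\<ge>1. \<forall>k\<in>congr_subgroup v n. \<forall>g\<in>GL2. f z (mmult g k) = f z g"
    proof (intro exI[of _ n] conjI ballI)
      show "1 \<le> n" by (rule fixed_at_ge_1[OF n])
      fix k g :: "'e mat2" assume k: "k \<in> congr_subgroup v n" and g: "g \<in> GL2"
      have kG: "k \<in> GL2" using k by (auto simp: congr_subgroup_def GL2_def)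
      have "rho k z = z" using n k by (auto simp: fixed_at_def)
      then show "f z (mmult g k) = f z g" using g kG rho_mmult[OF g kG, of z] by (simp add: f_def)
    qed
  qed
  define T where "T = inv_into UNIV f"
  have T: "T (f z) = z" for z unfolding T_def using inj by simp
  show ?thesis
    unfolding subquotient_of_ind_def
  proof (intro exI[of _ "range f"] exI[of _ T] conjI ballI allI)
    show "range f \<subseteq> ind_space v chi1 chi2" using in_ind by blast
    show "(\<lambda>_. 0) \<in> range f" using f_zero by blast
    show "(\<lambda>h. p h + q h) \<in> range f" if "p \<in> range f" "q \<in> range f" for p q
      using that f_add by auto
    show "(\<lambda>h. c * p h) \<in> range f" if "p \<in> range f" for c p
      using that f_scale by auto
    show "right_trans g p \<in> range f" if "g \<in> GL2" "p \<in> range f" for g p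
      using that(2) f_trans[OF that(1)] by auto
    show "T (\<lambda>h. p h + q h) = T p + T q" if "p \<in> range f" "q \<in> range f" for p q
      using that f_add by (auto simp: T)
    show "T (\<lambda>h. c * p h) = c *s T p" if "p \<in> range f" for c p
      using that f_scale by (auto simp: T)
    show "T ` range f = UNIV" by (auto simp: image_image T)
    show "T (right_trans g p) = rho g (T p)" if "g \<in> GL2" "p \<in> range f" for g p
      using that(2) f_trans[OF that(1)] by (auto simp: T)
  qed
qed

theorem jac_eq_UNIV:
  assumes "supercuspidal v smul rho"
  shows "jac = UNIV"
proof (rule ccontr)
  assume "jac \<noteq> UNIV"
  then obtain M where M: "tstab M" "M \<noteq> UNIV" "\<And>M'. tstab M' \<Longrightarrow> M \<subseteq> M' \<Longrightarrow> M' = M \<or> M' = UNIV"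
    using maximal_tstab by blast
  interpret borel_quotient v smul rho psi M
    by unfold_locales (use M in auto)
  show False
    using torus_character subquotient_of_indI assms unfolding supercuspidal_def by metis
qed

end

section \<open>Distinguished components\<close>

context gl2_rep_closed
begin

section \<open>Linear forms given on a subspace\<close>

lemma linear_form_onD:
  assumes "linear_form_on smul S lam" "subspace S"
  shows "\<And>x y. x \<in> S \<Longrightarrow> y \<in> S \<Longrightarrow> lam (x + y) = lam x + lam y"
    "\<And>c x. x \<in> S \<Longrightarrow> lam (c *s x) = c * lam x" "lam 0 = 0"
    "\<And>f C. (\<And>c. c \<in> C \<Longrightarrow> f c \<in> S) \<Longrightarrow> lam (sum f C) = (\<Sum>c\<in>C. lam (f c))"
proof -
  show add: "\<And>x y. x \<in> S \<Longrightarrow> y \<in> S \<Longrightarrow> lam (x + y) = lam x + lam y"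
    and sc: "\<And>c x. x \<in> S \<Longrightarrow> lam (c *s x) = c * lam x"
    using assms(1) unfolding linear_form_on_def by blast+
  show z: "lam 0 = 0" using sc[of 0 0] subspace_0[OF assms(2)] by simp
  show "lam (sum f C) = (\<Sum>c\<in>C. lam (f c))" if "\<And>c. c \<in> C \<Longrightarrow> f c \<in> S" for f :: "'z \<Rightarrow> 'v" and C
    using that
    by (induction C rule: infinite_finite_induct) (simp_all add: z add subspace_sum[OF assms(2)])
qed

lemma avg_in_subspace:
  assumes f: "lconst m M f" "\<And>x. x \<in> pp m \<Longrightarrow> f x \<in> S" and S: "subspace S"
  shows "avg m f \<in> S"
proof -
  obtain C where C: "transversal m M C" "C \<subseteq> pp m" "avg m f = inverse (of_nat (card C)) *s sum f C"
    using avg_obtain[OF f(1)] .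
  have "sum f C \<in> S" by (rule subspace_sum[OF S]) (use C(2) f(2) in blast)
  then show ?thesis using C(3) subspace_scale[OF S] by simp
qed

text \<open>\<open>lam\<close> is linear only on S, so it is carried through an explicit finite sum
  with terms in S instead of through \<open>avg_linmap\<close>.\<close>

lemma form_avg:
  assumes f: "lconst m M f" "\<And>x. x \<in> pp m \<Longrightarrow> f x \<in> S" and S: "subspace S"
    and lam: "linear_form_on smul S lam"
  shows "\<exists>C. C \<subseteq> pp m \<and> of_nat (card C) \<noteq> (0 :: 'k) \<and>
    lam (avg m f) = inverse (of_nat (card C)) * (\<Sum>c\<in>C. lam (f c))"
proof -
  note L = linear_form_onD[OF lam S]
  obtain C where C: "transversal m M C" "C \<subseteq> pp m" "of_nat (card C) \<noteq> (0 :: 'k)"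
    "avg m f = inverse (of_nat (card C)) *s sum f C"
    using avg_obtain[OF f(1)] .
  have fC: "f c \<in> S" if "c \<in> C" for c using that C(2) f(2) by blast
  have "sum f C \<in> S" by (rule subspace_sum[OF S fC])
  then have "lam (avg m f) = inverse (of_nat (card C)) * (\<Sum>c\<in>C. lam (f c))"
    using C(4) L(2) L(4)[of C f, OF fC] by simp
  then show ?thesis using C(2,3) by blast
qed

lemma avg_form_nonzero:
  assumes "lconst m M f" "\<And>x. x \<in> pp m \<Longrightarrow> f x \<in> S" "subspace S"
    and "linear_form_on smul S lam" "lam (avg m f) \<noteq> 0"
  shows "\<exists>c\<in>pp m. lam (f c) \<noteq> 0"
proof -
  obtain C where C: "C \<subseteq> pp m" "lam (avg m f) = inverse (of_nat (card C)) * (\<Sum>c\<in>C. lam (f c))"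
    using form_avg[OF assms(1-4)] by blast
  then have "(\<Sum>c\<in>C. lam (f c)) \<noteq> 0" using assms(5) by auto
  then obtain c where "c \<in> C" "lam (f c) \<noteq> 0" by (meson sum.neutral)
  then show ?thesis using C(1) by blast
qed

lemma avg_form_const:
  assumes "lconst m M f" "\<And>x. x \<in> pp m \<Longrightarrow> f x \<in> S" "subspace S"
    and "linear_form_on smul S lam" and d: "\<And>x. x \<in> pp m \<Longrightarrow> lam (f x) = d"
  shows "lam (avg m f) = d"
proof -
  obtain C where C: "C \<subseteq> pp m" "of_nat (card C) \<noteq> (0 :: 'k)"
    "lam (avg m f) = inverse (of_nat (card C)) * (\<Sum>c\<in>C. lam (f c))"
    using form_avg[OF assms(1-4)] by blast
  have "(\<Sum>c\<in>C. lam (f c)) = (\<Sum>c\<in>C. d)" by (rule sum.cong) (use C(1) d in auto)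
  then show ?thesis using C(2,3) by simp
qed

lemma spec_in_subspace:
  assumes S: "subspace S" "\<And>t x. x \<in> S \<Longrightarrow> rU t x \<in> S" and x: "x \<in> S"
  shows "spec b N x \<in> S"
proof -
  obtain M where M: "lconst (1 - N) M (\<lambda>t. psi (- (b * t)) *s rU t x)" using lconst_psiU by blast
  show ?thesis unfolding spec_def
    by (rule avg_in_subspace[OF M _ S(1)]) (use S x subspace_scale in blast)
qed

text \<open>A form invariant under the F-points of the unipotent radical is supported on the characters
  trivial on F. Nested balls carrying the form shrink to such a character, and
  it is nontrivial because the Jacquet module vanishes.\<close>

lemma invariant_form_support:
  assumes complete: "\<And>s :: nat \<Rightarrow> 'e. (\<forall>N. \<exists>M. \<forall>m\<ge>M. \<forall>n\<ge>M. s m - s n \<in> pp N) \<Longrightarrow>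
      \<exists>L. \<forall>N. \<exists>M. \<forall>m\<ge>M. s m - L \<in> pp N"
    and F: "quadratic_ext F" and psi_F: "\<And>x. x \<in> F \<Longrightarrow> psi x = 1" and jac: "jac = UNIV"
    and S: "subspace S" "\<And>t x. x \<in> S \<Longrightarrow> rU t x \<in> S"
    and lam: "linear_form_on smul S lam" "\<And>t x. t \<in> F \<Longrightarrow> x \<in> S \<Longrightarrow> lam (rU t x) = lam x"
    and w: "w \<in> S" "lam w \<noteq> 0"
  shows "\<exists>b N0. b \<in> F \<and> b \<noteq> 0 \<and> (\<forall>N\<ge>N0. spec b N w \<noteq> 0)"
proof -
  note L = linear_form_onD[OF lam(1) S(1)]
  have sS: "spec b N w \<in> S" for b N by (rule spec_in_subspace[OF S w(1)])
  obtain n where n: "fixed_at n w" using fixed_at_exists by blast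
  \<comment> \<open>Unipotents with parameter in p^n fix w, so w is supported on the dual ball
    p^(1-n).\<close>
  define N0 where "N0 = 1 - n"
  have start: "spec 0 N0 w = w"
    by (rule spec_eigen) (simp add: fixed_at_U[OF n] N0_def)
  have step: "\<exists>b'. lam (spec b' (N + 1) w) \<noteq> 0 \<and> b' - b \<in> pp N" if "lam (spec b N w) \<noteq> 0" for b N
  proof -
    obtain k where k: "k \<noteq> 0" "\<And>b x. avg N (\<lambda>c. spec (b + c) (N + 1) x) = k *s spec b N x"
      using spec_split[of N "N + 1"] by auto
    have lc: "lconst N (N + 1) (\<lambda>c. spec (b + c) (N + 1) w)"
      by (rule lconstI) (simp, rule spec_center, simp)
    have "lam (avg N (\<lambda>c. spec (b + c) (N + 1) w)) = k * lam (spec b N w)"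
      unfolding k(2) by (rule L(2)[OF sS])
    then have "lam (avg N (\<lambda>c. spec (b + c) (N + 1) w)) \<noteq> 0" using k(1) that by simp
    then obtain c where "c \<in> pp N" "lam (spec (b + c) (N + 1) w) \<noteq> 0"
      using avg_form_nonzero[OF lc sS S(1) lam(1)] by blast
    then show ?thesis by (intro exI[of _ "b + c"]) simp
  qed
  have "\<exists>s. \<forall>i. lam (spec (s i) (N0 + int i) w) \<noteq> 0 \<and> s (Suc i) - s i \<in> pp (N0 + int i)"
  proof (rule dependent_nat_choice[where P = "\<lambda>i b. lam (spec b (N0 + int i) w) \<noteq> 0"
        and Q = "\<lambda>i b b'. b' - b \<in> pp (N0 + int i)"])
    show "\<exists>b. lam (spec b (N0 + int 0) w) \<noteq> 0" using start w(2) by (intro exI[of _ 0]) simp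
    show "\<exists>b'. lam (spec b' (N0 + int (Suc i)) w) \<noteq> 0 \<and> b' - b \<in> pp (N0 + int i)"
      if "lam (spec b (N0 + int i) w) \<noteq> 0" for b i
      using step[OF that] by (simp add: algebra_simps)
  qed
  then obtain s where s: "\<And>i. lam (spec (s i) (N0 + int i) w) \<noteq> 0" "\<And>i. s (Suc i) - s i \<in> pp (N0 + int i)"
    by blast
  have s_le: "s (i + j) - s i \<in> pp (N0 + int i)" for i j
  proof (induction j)
    case (Suc j)
    have "s (Suc (i + j)) - s (i + j) \<in> pp (N0 + int i)"
      by (rule pp_mono[OF _ s(2)]) simp
    then have "(s (Suc (i + j)) - s (i + j)) + (s (i + j) - s i) \<in> pp (N0 + int i)"
      using Suc pp_add by blast
    then show ?case by simp
  qed simp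
  have "\<exists>b. \<forall>N. \<exists>M. \<forall>m\<ge>M. s m - b \<in> pp N"
  proof (rule complete, intro allI)
    fix N
    define i where "i = nat (N - N0)"
    have "s m - s k \<in> pp N" if "m \<ge> i" "k \<ge> i" for m k
    proof -
      have "(s m - s i) - (s k - s i) \<in> pp (N0 + int i)"
        using s_le[of i "m - i"] s_le[of i "k - i"] that by (intro pp_diff[of "s m - s i" _ "s k - s i"]) auto
      then show ?thesis by (intro pp_mono[of N "N0 + int i"]) (auto simp: i_def)
    qed
    then show "\<exists>M. \<forall>m\<ge>M. \<forall>k\<ge>M. s m - s k \<in> pp N" by blast
  qed
  then obtain b where b: "\<And>N. \<exists>M. \<forall>m\<ge>M. s m - b \<in> pp N" by blast
  have b_near: "b - s i \<in> pp (N0 + int i)" for i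
  proof -
    obtain K where "\<forall>m\<ge>K. s m - b \<in> pp (N0 + int i)" using b by blast
    then have "s (i + K) - b \<in> pp (N0 + int i)" by simp
    then have "(s (i + K) - s i) - (s (i + K) - b) \<in> pp (N0 + int i)" using s_le pp_diff by blast
    then show ?thesis by simp
  qed
  have nz: "lam (spec b N w) \<noteq> 0" if N: "N \<ge> N0" for N
    using s(1)[of "nat (N - N0)"] spec_center[OF b_near[of "nat (N - N0)"], of w] N by simp
  have "b \<noteq> 0"
  proof
    assume b0: "b = 0"
    obtain N where "spec 0 N w = 0" using jac unfolding jac_def by blast
    then have "spec 0 (max N N0) w = 0" using spec_0_mono[of N "max N N0"] by simp
    then show False using nz[of "max N N0"] b0 L(3) by simp
  qed
  \<comment> \<open>N is enlarged until t acts on \<open>spec b N w\<close> by the scalar psi(b *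
    t); the form is invariant and nonzero there, so the scalar is 1.\<close>
  have psi_b: "psi (b * t) = 1" if t: "t \<in> F" for t
  proof -
    obtain m where m: "t \<in> pp m" using pp_exists by blast
    define N where "N = max N0 (1 - m)"
    have tN: "t \<in> pp (1 - N)" by (rule pp_mono[OF _ m]) (simp add: N_def)
    have "lam (spec b N w) = lam (rU t (spec b N w))" using lam(2)[OF t sS] by simp
    also have "\<dots> = psi (b * t) * lam (spec b N w)"
      unfolding U_spec[OF tN] by (rule L(2)[OF sS])
    finally show ?thesis using nz[of N] by (simp add: N_def)
  qed
  have sub: "subfield F" using F by (simp add: quadratic_ext_def)
  have F_ops: "x + y \<in> F" "x * y \<in> F" "- x \<in> F" "inverse x \<in> F" "x - y \<in> F" "x / y \<in> F"
    if "x \<in> F" "y \<in> F" for x y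
  proof -
    show "x + y \<in> F" "x * y \<in> F" "- x \<in> F" "inverse x \<in> F"
      using sub that unfolding subfield_def by blast+
    have "x + - y \<in> F" "x * inverse y \<in> F" using sub that unfolding subfield_def by blast+
    then show "x - y \<in> F" "x / y \<in> F" by (simp_all add: divide_inverse)
  qed
  \<comment> \<open>Otherwise F + b * F would be the whole field, and \<open>psi\<close>, trivial on
    F and on b * F, would be trivial.\<close>
  have "b \<in> F"
  proof (rule ccontr)
    assume bF: "b \<notin> F"
    obtain a where a: "\<And>x. \<exists>f g. f \<in> F \<and> g \<in> F \<and> x = f + g * a"
      using F unfolding quadratic_ext_def by blast
    obtain f0 g0 where fg0: "f0 \<in> F" "g0 \<in> F" "b = f0 + g0 * a" using a by blast
    have g0: "g0 \<noteq> 0" using fg0 bF by auto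
    have "psi x = 1" for x
    proof -
      obtain f g where fg: "f \<in> F" "g \<in> F" "x = f + g * a" using a by blast
      have in_F: "f - g * f0 / g0 \<in> F" "g / g0 \<in> F" using fg fg0 F_ops by simp_all
      have "x = (f - g * f0 / g0) + b * (g / g0)" using g0 fg(3) fg0(3) by (simp add: field_simps)
      then have "psi x = psi (f - g * f0 / g0) * psi (b * (g / g0))" by (simp only: psi_add)
      then show ?thesis using psi_F[OF in_F(1)] psi_b[OF in_F(2)] by (simp only: mult_1_left)
    qed
    then show False using psi_nontriv by blast
  qed
  moreover have "spec b N w \<noteq> 0" if "N \<ge> N0" for N using nz[OF that] L(3) by auto
  ultimately show ?thesis using \<open>b \<noteq> 0\<close> by blast
qed

text \<open>Vectors fixed by a central subgroup form a subrepresentation, and smoothness makes it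
  nonzero at some level. This replaces a central character.\<close>

lemma central_trivial: "\<exists>n\<ge>1. \<forall>c\<in>pp n. \<forall>x. rZ (1 + c) x = x"
proof (cases "\<exists>x::'v. x \<noteq> 0")
  case False
  then show ?thesis by (metis order_refl)
next
  case True
  then obtain x :: 'v where x: "x \<noteq> 0" by blast
  obtain n where n: "fixed_at n x" using fixed_at_exists by blast
  note n1 = fixed_at_ge_1[OF n]
  define S where "S = {y. \<forall>c\<in>pp n. rZ (1 + c) y = y}"
  have nz: "1 + c \<noteq> 0" if "c \<in> pp n" for c using one_unit_nz[OF n1 that] .
  have "S = UNIV"
  proof (rule irr_eq_UNIV)
    show "subspace S" unfolding subspace_def S_def
      by (auto simp: linmap_0[OF linmap_Z] linmap_add[OF linmap_Z] linmap_scale[OF linmap_Z] nz)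
    show "rho g y \<in> S" if "g \<in> GL2" "y \<in> S" for g y
      using that(2) Z_rho[OF nz that(1)] by (auto simp: S_def)
    show "x \<in> S" using fixed_at_Z[OF n] by (simp add: S_def)
  qed (rule x)
  then show ?thesis using n1 unfolding S_def by blast
qed

text \<open>A nonzero vector of S on a ball around b is moved by diag(b,1) to a ball around 1 and
  matched there with a vector of Q. S is given as stable under unipotents only, so z is taken before
  this move; the move is undone inside Q, where diag(1/b,1) acts.\<close>

lemma intertwiner_into_generic:
  assumes complete: "\<And>s :: nat \<Rightarrow> 'e. (\<forall>N. \<exists>M. \<forall>m\<ge>M. \<forall>n\<ge>M. s m - s n \<in> pp N) \<Longrightarrow>
      \<exists>L. \<forall>N. \<exists>M. \<forall>m\<ge>M. s m - L \<in> pp N"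
    and F: "quadratic_ext F" and psi_F: "\<And>x. x \<in> F \<Longrightarrow> psi x = 1" and jac: "jac = UNIV"
    and S: "subspace S" "\<And>t x. x \<in> S \<Longrightarrow> rU t x \<in> S"
    and lam: "linear_form_on smul S lam" "\<And>t x. t \<in> F \<Longrightarrow> x \<in> S \<Longrightarrow> lam (rU t x) = lam x"
    and w: "w \<in> S" "lam w \<noteq> 0"
    and Q: "invariant_subspace smul rho (GL2plus F) Q" "generic smul rho psi Q"
  shows "\<exists>A. bij A \<and> linmap A \<and> (\<forall>g\<in>GL2. \<forall>x. A (rho g x) = rho g (A x)) \<and> (\<exists>z\<in>S. z \<noteq> 0 \<and> A z \<in> Q)"
proof -
  obtain b N0 where b: "b \<in> F" "b \<noteq> 0" and N0: "\<And>N. N \<ge> N0 \<Longrightarrow> spec b N w \<noteq> 0"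
    using invariant_form_support[OF complete F psi_F jac S lam w] by metis
  have F1: "1 \<in> F" "inverse b \<in> F" using F b unfolding quadratic_ext_def subfield_def by blast+
  have Qsub: "subspace Q" and Qst: "\<And>g x. g \<in> GL2plus F \<Longrightarrow> x \<in> Q \<Longrightarrow> rho g x \<in> Q"
    using Q(1) unfolding invariant_subspace_def by blast+
  have "unip t \<in> GL2plus F" for t
    using F1 unfolding GL2plus_def unip_def by (auto intro!: exI[of _ 1])
  then have QU: "rU t x \<in> Q" if "x \<in> Q" for t x
    using Qst that unfolding rU_def unip_def by blast
  have QT: "rT (1 / b) x \<in> Q" if "x \<in> Q" for x
  proof -
    have "(1 / b, 0, 0, 1) \<in> GL2plus F"
      unfolding GL2plus_def
      by (intro CollectI exI[of _ "inverse b"] exI[of _ 1]) (simp add: divide_inverse F1 b)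
    then show ?thesis using Qst that unfolding rT_def by blast
  qed
  obtain ps y where ps: "linear_form_on smul Q ps" "\<And>t x. x \<in> Q \<Longrightarrow> ps (rU t x) = psi t * ps x"
    and y: "y \<in> Q" "ps y \<noteq> 0"
    using Q(2) unfolding generic_def rU_def unip_def by blast
  \<comment> \<open>Averaging against the inverse character leaves the value of the Whittaker form
    unchanged, so no ball around 1 kills y.\<close>
  have spy: "spec 1 N y \<noteq> 0" "spec 1 N y \<in> Q" for N
  proof -
    show "spec 1 N y \<in> Q" by (rule spec_in_subspace[OF Qsub QU y(1)])
    obtain M where M: "lconst (1 - N) M (\<lambda>t. psi (- (1 * t)) *s rU t y)" using lconst_psiU by blast
    have "ps (spec 1 N y) = ps y"
      unfolding spec_def
    proof (rule avg_form_const[OF M _ Qsub ps(1)])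
      fix t
      show "psi (- (1 * t)) *s rU t y \<in> Q" using QU y(1) subspace_scale[OF Qsub] by blast
      show "ps (psi (- (1 * t)) *s rU t y) = ps y"
        using linear_form_onD(2)[OF ps(1) Qsub QU[OF y(1)]] ps(2)[OF y(1)] by (simp add: psi_uminus psi_nz)
    qed
    then show "spec 1 N y \<noteq> 0" using y(2) linear_form_onD(3)[OF ps(1) Qsub] by auto
  qed
  obtain n0 where n0: "n0 \<ge> 1" "\<And>c x. c \<in> pp n0 \<Longrightarrow> rZ (1 + c) x = x" using central_trivial by blast
  obtain n1 where n1: "fixed_at n1 (rT b w)" using fixed_at_exists by blast
  obtain n2 where n2: "fixed_at n2 y" using fixed_at_exists by blast
  \<comment> \<open>\<open>n0\<close> makes the scalars in 1 + p^N act trivially,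
    \<open>N0 - v b\<close> gives N + v b >= N0, and \<open>n1\<close>, \<open>n2\<close> make both
    vectors invariant under the torus units 1 + p^N.\<close>
  define N where "N = max (max n0 (N0 - v b)) (max n1 n2)"
  interpret gl2_rep_level v smul rho psi N
  proof unfold_locales
    show "1 \<le> N" using n0(1) by (simp add: N_def)
    show "rZ (1 + c) x = x" if "c \<in> pp N" for c x
      by (rule n0(2), rule pp_mono[OF _ that]) (simp add: N_def)
  qed
  define x1 where "x1 = spec 1 N (rT b w)"
  define x2 where "x2 = spec 1 N y"
  have proj_spec_fixed: "proj N (spec 1 N u) = spec 1 N u" if "fixed_at n u" "n \<le> N" for n u
  proof -
    have "avgT N u = u"
      by (rule avgT_id[OF N]) (rule fixed_at_T[OF fixed_at_mono[OF that]])
    then show ?thesis by (simp add: proj_def spec_idem avgT_spec[OF N])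
  qed
  have p1: "proj N x1 = x1" unfolding x1_def by (rule proj_spec_fixed[OF n1]) (simp add: N_def)
  have p2: "proj N x2 = x2" unfolding x2_def by (rule proj_spec_fixed[OF n2]) (simp add: N_def)
  \<comment> \<open>diag(b,1) sends the ball b + p^(N + v b) to 1 + p^N, which accounts for the
    shift of the exponent.\<close>
  define z where "z = spec b (N + v b) w"
  have z: "z \<noteq> 0" "z \<in> S"
    unfolding z_def by (rule N0, simp add: N_def, rule spec_in_subspace[OF S w(1)])
  have x1z: "x1 = rT b z" using T_spec[OF b(2), of b "N + v b" w] b(2) by (simp add: x1_def z_def)
  have zx1: "z = rT (1 / b) x1" unfolding x1z using b(2) by (simp add: T_mult)
  have "x1 \<noteq> 0" using z(1) zx1 linmap_0[OF linmap_T] b(2) by auto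
  then obtain A where A: "bij A" "linmap A" "\<And>g x. g \<in> GL2 \<Longrightarrow> A (rho g x) = rho g (A x)" "A x1 = x2"
    using intertwiner_exists[OF p1 _ p2] spy(1) x2_def by metis
  have "A z = rT (1 / b) x2" unfolding zx1 rT_def using A(3,4) b(2) by simp
  then have "A z \<in> Q" using QT spy(2) x2_def by simp
  then show ?thesis using A z by blast
qed

end

section \<open>Normality of the subgroup cut out by the determinant\<close>

definition minverse :: "'e::field mat2 \<Rightarrow> 'e mat2" where
  "minverse g = (case g of (a, b, c, d) \<Rightarrow>
     (d / mdet g, - b / mdet g, - c / mdet g, a / mdet g))"

lemma minverse:
  assumes "g \<in> GL2"
  shows "mmult g (minverse g) = (1, 0, 0, 1)" "mmult (minverse g) g = (1, 0, 0, 1)"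
    "minverse g \<in> GL2"
proof -
  obtain a b c d where g: "g = (a, b, c, d)" by (cases g)
  have D: "a * d - b * c \<noteq> 0" using assms g by (simp add: GL2_def)
  show 1: "mmult g (minverse g) = (1, 0, 0, 1)" "mmult (minverse g) g = (1, 0, 0, 1)"
    using D by (simp_all add: g minverse_def divide_simps)
  have "mdet g * mdet (minverse g) = 1" using mdet_mmult[of g "minverse g"] 1(1) by simp
  then show "minverse g \<in> GL2" by (auto simp: GL2_def)
qed

lemma mmult_one [simp]: "mmult g (1, 0, 0, 1) = g" "mmult (1, 0, 0, 1) g = g"
  by (cases g; simp)+

lemma GL2plus_subset: "h \<in> GL2plus F \<Longrightarrow> h \<in> GL2"
  by (auto simp: GL2plus_def GL2_def)

lemma GL2plus_conj:
  assumes g: "g \<in> GL2" and h: "h \<in> GL2plus F"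
  shows "\<exists>h'\<in>GL2plus F. mmult g h = mmult h' g" "\<exists>h'\<in>GL2plus F. mmult h g = mmult g h'"
proof -
  have "mdet g * mdet (minverse g) = 1" using mdet_mmult[of g "minverse g"] minverse(1)[OF g] by simp
  then have "mdet (mmult g (mmult h (minverse g))) = mdet h" "mdet (mmult (minverse g) (mmult h g)) = mdet h"
    by (simp_all add: mdet_mmult mult.commute)
  then have *: "mmult g (mmult h (minverse g)) \<in> GL2plus F" "mmult (minverse g) (mmult h g) \<in> GL2plus F"
    using h by (simp_all add: GL2plus_def)
  have "mmult (mmult g (mmult h (minverse g))) g = mmult g h"
    by (simp add: mmult_assoc minverse(2)[OF g])
  moreover have "mmult g (mmult (minverse g) (mmult h g)) = mmult h g"
    by (simp add: mmult_assoc[symmetric] minverse(1)[OF g])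
  ultimately show "\<exists>h'\<in>GL2plus F. mmult g h = mmult h' g" "\<exists>h'\<in>GL2plus F. mmult h g = mmult g h'"
    using * by metis+
qed


theorem theorem6p14:
  fixes v :: "'e::field \<Rightarrow> int"
    and F :: "'e set"
    and p l :: nat
    and psi0 :: "'e \<Rightarrow> 'k::field"
    and smul :: "'k \<Rightarrow> 'v::ab_group_add \<Rightarrow> 'v"
    and rho :: "'e mat2 \<Rightarrow> 'v \<Rightarrow> 'v"
    and Wplus :: "'v set"
  assumes E_local: "nonarch_local_field (UNIV :: 'e set) v"
    and F_local: "nonarch_local_field F v"
    and quad: "quadratic_ext F"
    and char_not_2: "(2::'e) \<noteq> 0"
    and p_prime: "prime p" and resid_char: "vge v (of_nat p) 1"
    and k_field: "alg_closure_Fl l TYPE('k)"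
    and l_odd: "l \<noteq> 2" and l_ne_p: "l \<noteq> p"
    and psi0: "psi0_char v F psi0"
    and rep: "is_rep smul rho" and smooth: "smooth_rep v rho"
    and irred: "irreducible_on smul rho GL2 UNIV"
    and scusp: "supercuspidal v smul rho"
    and dist: "distinguished smul rho (SL2 F) UNIV"
    and plus_comp: "irreducible_on smul rho (GL2plus F) Wplus"
    and plus_generic: "generic smul rho psi0 Wplus"
  shows "distinguished smul rho (SL2 F) Wplus \<and>
    (\<forall>tau. irreducible_on smul rho (SL2 UNIV) tau \<and> distinguished smul rho (SL2 F) tau \<longrightarrow>
       (\<exists>tau'. tau' \<subseteq> Wplus \<and> irreducible_on smul rho (SL2 UNIV) tau' \<and>
               iso_on smul rho (SL2 UNIV) tau tau'))"
proof -
  interpret vf: valued_field v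
  proof
    show "discrete_valuation v" using E_local by (simp add: nonarch_local_field_def)
    show "\<exists>R. finite R \<and> (\<forall>x. vge v x 0 \<longrightarrow> (\<exists>r\<in>R. vge v (x - r) 1))"
      using E_local unfolding nonarch_local_field_def by blast
  qed
  interpret vector_space smul using rep by (simp add: is_rep_def module_iff_vector_space)
  have l: "prime l" "of_nat l = (0 :: 'k)" using k_field by (auto simp: alg_closure_Fl_def)
  interpret gl2_rep_closed v smul rho psi0
  proof unfold_locales
    \<comment> \<open>The index is prime to l, so a Bezout relation read in characteristic l makes
      it invertible.\<close>
    fix m M C assume C: "vf.transversal m M C" "m \<le> M"
    have "\<not> l dvd card C"
    proof (rule vf.transversal_card_coprime[OF C(1) l(1) _ _ C(2)])
      show "of_nat p \<in> vf.pp 1" using resid_char by (simp add: vf.vge_iff_pp)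
      show "coprime l p" using l(1) p_prime l_ne_p by (rule primes_coprime)
    qed
    then have "coprime l (card C)" using l(1) prime_imp_coprime by blast
    then have "coprime (int l) (int (card C))" by simp
    then obtain a b where "a * int l + b * int (card C) = 1"
      by (metis bezout_int coprime_imp_gcd_eq_1)
    then have "(of_int (a * int l + b * int (card C)) :: 'k) = 1" by simp
    then show "of_nat (card C) \<noteq> (0 :: 'k)" using l(2) by auto
  next
    show "S = {0} \<or> S = UNIV" if "invariant_subspace smul rho GL2 S" for S
      using irred that unfolding irreducible_on_def by blast
    show "\<exists>x. poly q x = 0" if "degree q > 0" for q :: "'k poly"
      using k_field that unfolding alg_closure_Fl_def by blast
    show "psi0 (x + y) = psi0 x * psi0 y" "psi0 x \<noteq> 0" for x y
      using psi0 by (auto simp: psi0_char_def)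
    show "psi0 x = 1" if "x \<in> vf.pp 1" for x
      using psi0 that by (auto simp: psi0_char_def vf.vge_iff_pp)
    show "\<exists>x\<in>vf.pp 0. psi0 x \<noteq> 1"
      using psi0 by (auto simp: psi0_char_def vf.vge_iff_pp)
  qed (rule rep smooth)+
  have complete: "\<exists>L. \<forall>N. \<exists>M. \<forall>m\<ge>M. s m - L \<in> vf.pp N"
    if "\<forall>N. \<exists>M. \<forall>m\<ge>M. \<forall>n\<ge>M. s m - s n \<in> vf.pp N" for s :: "nat \<Rightarrow> 'e"
    using E_local that unfolding nonarch_local_field_def vf.vge_iff_pp by blast
  have psi_F: "psi0 x = 1" if "x \<in> F" for x using psi0 that by (simp add: psi0_char_def)
  have jac: "jac = UNIV" by (rule jac_eq_UNIV[OF scusp])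
  have F01: "0 \<in> F" "1 \<in> F" using quad by (auto simp: quadratic_ext_def subfield_def)
  have SL2_GL2: "g \<in> GL2" if "g \<in> SL2 X" for g X
    using that by (cases g) (simp add: SL2_def)
  have SL2_plus: "g \<in> GL2plus F" if "g \<in> SL2 UNIV" for g
    using that F01 by (cases g) (auto simp: SL2_def GL2plus_def intro!: exI[of _ 1])
  have unip_SL2: "(1, t, 0, 1) \<in> SL2 UNIV" for t :: 'e by (simp add: SL2_def)
  have unip_SL2F: "(1, t, 0, 1) \<in> SL2 F" if "t \<in> F" for t using that F01 by (simp add: SL2_def)
  have plus: "invariant_subspace smul rho (GL2plus F) Wplus" "Wplus \<noteq> {0}"
    and plus_min: "\<And>U. invariant_subspace smul rho (GL2plus F) U \<Longrightarrow> U \<subseteq> Wplus \<Longrightarrow> U = {0} \<or> U = Wplus"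
    using plus_comp unfolding irreducible_on_def by blast+
  have Wsub: "subspace Wplus" and Wst: "\<And>h x. h \<in> GL2plus F \<Longrightarrow> x \<in> Wplus \<Longrightarrow> rho h x \<in> Wplus"
    using plus(1) unfolding invariant_subspace_def by blast+
  have into: "\<exists>A. bij A \<and> linmap A \<and> (\<forall>g\<in>GL2. \<forall>x. A (rho g x) = rho g (A x)) \<and>
      (\<exists>z\<in>S. z \<noteq> 0 \<and> A z \<in> Wplus)"
    if "subspace S" "\<And>t x. x \<in> S \<Longrightarrow> rU t x \<in> S" "linear_form_on smul S lam"
      "\<And>t x. t \<in> F \<Longrightarrow> x \<in> S \<Longrightarrow> lam (rU t x) = lam x" "w \<in> S" "lam w \<noteq> 0" for S lam w
    by (rule intertwiner_into_generic[of F S lam w Wplus]; fact)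
  have "distinguished smul rho (SL2 F) Wplus"
  proof -
    obtain lam x where lam: "linear_form_on smul UNIV lam" "lam x \<noteq> 0"
      "\<And>h x. h \<in> SL2 F \<Longrightarrow> lam (rho h x) = lam x"
      using dist unfolding distinguished_def by blast
    note lamD = linear_form_onD(1-3)[OF lam(1) subspace_UNIV, simplified]
    \<comment> \<open>The translates of \<open>Wplus\<close> span V, so the form is nonzero on one
      of them: vectors on whose whole orbit it vanishes form a proper subrepresentation.\<close>
    obtain g w where gw: "g \<in> GL2" "w \<in> Wplus" "lam (rho g w) \<noteq> 0"
    proof (rule ccontr)
      assume none: "\<not> thesis"
      define S where "S = {x. \<forall>g\<in>GL2. lam (rho g x) = 0}"
      obtain w where w: "w \<in> Wplus" "w \<noteq> 0" using plus(2) subspace_0[OF Wsub] by blast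
      have "S = UNIV"
      proof (rule irr_eq_UNIV)
        show "subspace S" unfolding subspace_def S_def
          by (auto simp: linmap_add[OF rho_linmap] linmap_scale[OF rho_linmap] lamD)
        show "rho g y \<in> S" if "g \<in> GL2" "y \<in> S" for g y
          using that by (auto simp: S_def rho_mmult)
        show "w \<in> S" using none that w(1) unfolding S_def by blast
      qed (rule w(2))
      then have "x \<in> S" by blast
      then have "lam (rho (1, 0, 0, 1) x) = 0" unfolding S_def by (simp del: rho_one)
      then show False using lam(2) by simp
    qed
    define S where "S = rho g ` Wplus"
    have Ssub: "subspace S"
      unfolding S_def by (rule subspace_linmap_image[OF rho_linmap[OF gw(1)] Wsub])
    have SU: "rU t y \<in> S" if "y \<in> S" for t y
    proof -
      obtain u where u: "u \<in> Wplus" "y = rho g u" using \<open>y \<in> S\<close> unfolding S_def by blast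
      obtain h where h: "h \<in> GL2plus F" "mmult (1, t, 0, 1) g = mmult g h"
        using GL2plus_conj(2)[OF gw(1) SL2_plus[OF unip_SL2]] by blast
      have "rU t y = rho g (rho h u)"
        unfolding rU_def u(2) using gw(1) GL2plus_subset[OF h(1)] h(2) SL2_GL2[OF unip_SL2]
        by (simp only: rho_mmult)
      then show ?thesis using Wst[OF h(1) u(1)] unfolding S_def by blast
    qed
    obtain A z where A: "bij A" "linmap A" "\<And>g x. g \<in> GL2 \<Longrightarrow> A (rho g x) = rho g (A x)"
      and z: "z \<in> S" "z \<noteq> 0" "A z \<in> Wplus"
    proof -
      have 1: "linear_form_on smul S lam" using lam(1) by (auto simp: linear_form_on_def)
      have 2: "lam (rU t y) = lam y" if "t \<in> F" for t y
        unfolding rU_def using lam(3)[OF unip_SL2F[OF that]] .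
      have 3: "rho g w \<in> S" using gw(2) by (simp add: S_def)
      show ?thesis using into[OF Ssub SU 1 2 3 gw(3)] that by blast
    qed
    obtain w0 where w0: "w0 \<in> Wplus" "z = rho g w0" using z(1) unfolding S_def by blast
    \<comment> \<open>\<open>g\<close> normalises \<open>GL2plus F\<close>, so this condition is
      stable under that group; irreducibility of \<open>Wplus\<close> extends it from the single
      vector \<open>w0\<close> to all of \<open>Wplus\<close>.\<close>
    define U where "U = {u\<in>Wplus. A (rho g u) \<in> Wplus}"
    have "invariant_subspace smul rho (GL2plus F) U"
      unfolding invariant_subspace_def
    proof (intro conjI ballI)
      show "subspace U"
        unfolding subspace_def U_def
        using Wsub gw(1) A(2)
        by (auto simp: linmap_0 linmap_add[OF A(2)] linmap_scale[OF A(2)] linmap_add[OF rho_linmap] linmap_scale[OF rho_linmap]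
            subspace_0 subspace_add subspace_scale)
      fix h u assume h: "h \<in> GL2plus F" and u: "u \<in> U"
      obtain h' where h': "h' \<in> GL2plus F" "mmult g h = mmult h' g"
        using GL2plus_conj(1)[OF gw(1) h] by blast
      have "A (rho g (rho h u)) = rho h' (A (rho g u))"
        using A(3) h' gw(1) GL2plus_subset[OF h] GL2plus_subset[OF h'(1)] by (simp add: rho_mmult)
      then show "rho h u \<in> U" using u Wst h h'(1) by (simp add: U_def)
    qed
    moreover have "w0 \<in> U" "w0 \<noteq> 0" using w0 z rho_0[OF gw(1)] by (auto simp: U_def)
    ultimately have "U = Wplus" using plus_min[of U] by (auto simp: U_def)
    then have Aw: "A (rho g w) \<in> Wplus" using gw(2) by (auto simp: U_def)
    \<comment> \<open>Composing the form with the inverse of A transports it to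
      \<open>Wplus\<close>, where it is nonzero at A (rho g w).\<close>
    define B where "B = inv_into UNIV A"
    have B: "B (A y) = y" "A (B y) = y" for y
      using A(1) unfolding B_def by (simp_all add: bij_is_inj bij_is_surj surj_f_inv_f)
    have Bl: "B (y + y') = B y + B y'" "B (smul c y) = smul c (B y)" for y y' c
      by (metis B linmap_add[OF A(2)], metis B linmap_scale[OF A(2)])
    have Br: "B (rho h y) = rho h (B y)" if "h \<in> GL2" for h y
      by (metis B A(3)[OF that])
    show ?thesis
      unfolding distinguished_def
    proof (intro exI[of _ "\<lambda>y. lam (B y)"] conjI ballI)
      show "linear_form_on smul Wplus (\<lambda>y. lam (B y))"
        unfolding linear_form_on_def by (simp add: Bl lamD)
      show "\<exists>w\<in>Wplus. lam (B w) \<noteq> 0" using Aw gw(3) B by (intro bexI[OF _ Aw]) simp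
      show "lam (B (rho h y)) = lam (B y)" if "h \<in> SL2 F" for h y
        using Br[OF SL2_GL2[OF that]] lam(3)[OF that] by simp
    qed
  qed
  moreover have "\<exists>tau'. tau' \<subseteq> Wplus \<and> irreducible_on smul rho (SL2 UNIV) tau' \<and>
      iso_on smul rho (SL2 UNIV) tau tau'"
    if tau: "irreducible_on smul rho (SL2 UNIV) tau" and dtau: "distinguished smul rho (SL2 F) tau" for tau
  proof -
    have tsub: "subspace tau" and tst: "\<And>h x. h \<in> SL2 UNIV \<Longrightarrow> x \<in> tau \<Longrightarrow> rho h x \<in> tau"
      and tnz: "tau \<noteq> {0}"
      and tmin: "\<And>U. invariant_subspace smul rho (SL2 UNIV) U \<Longrightarrow> U \<subseteq> tau \<Longrightarrow> U = {0} \<or> U = tau"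
      using tau unfolding irreducible_on_def invariant_subspace_def by blast+
    obtain lam w where lam: "linear_form_on smul tau lam" "w \<in> tau" "lam w \<noteq> 0"
      "\<And>h x. h \<in> SL2 F \<Longrightarrow> x \<in> tau \<Longrightarrow> lam (rho h x) = lam x"
      using dtau unfolding distinguished_def by blast
    have tU: "rU t y \<in> tau" if "y \<in> tau" for t y
      unfolding rU_def using tst[OF unip_SL2 that] .
    have lU: "lam (rU t y) = lam y" if "t \<in> F" "y \<in> tau" for t y
      unfolding rU_def using lam(4)[OF unip_SL2F[OF that(1)] that(2)] .
    obtain A z where A: "bij A" "linmap A" "\<And>g x. g \<in> GL2 \<Longrightarrow> A (rho g x) = rho g (A x)"
      and z: "z \<in> tau" "z \<noteq> 0" "A z \<in> Wplus"
      using into[OF tsub tU lam(1) lU lam(2,3)] by blast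
    \<comment> \<open>Applied twice: X = \<open>Wplus\<close> puts A
      \<open>tau inside\<close>Wplus\<open>, and X inside A\<close> tau gives irreducibility of the
      image.\<close>
    have pre: "U = {0} \<or> U = tau"
      if "X = Wplus \<or> X \<subseteq> A ` tau" and X: "invariant_subspace smul rho (SL2 UNIV) X"
        and U: "U = {u\<in>tau. A u \<in> X}" for X U
    proof (rule tmin)
      have Xs: "subspace X" and Xst: "\<And>h x. h \<in> SL2 UNIV \<Longrightarrow> x \<in> X \<Longrightarrow> rho h x \<in> X"
        using X unfolding invariant_subspace_def by blast+
      show "invariant_subspace smul rho (SL2 UNIV) U"
        unfolding invariant_subspace_def
      proof (intro conjI ballI)
        show "subspace U"
          unfolding subspace_def U using tsub Xs A(2)
          by (auto simp: linmap_0 linmap_add[OF A(2)] linmap_scale[OF A(2)] subspace_0 subspace_add subspace_scale)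
        show "rho h u \<in> U" if "h \<in> SL2 UNIV" "u \<in> U" for h u
          using that tst Xst A(3)[OF SL2_GL2[OF that(1)]] by (simp add: U)
      qed
      show "U \<subseteq> tau" by (auto simp: U)
    qed
    have "invariant_subspace smul rho (SL2 UNIV) Wplus"
      unfolding invariant_subspace_def using Wsub Wst SL2_plus by blast
    then have "{u\<in>tau. A u \<in> Wplus} = tau"
      using pre[of Wplus "{u\<in>tau. A u \<in> Wplus}"] z by auto
    then have sub: "A ` tau \<subseteq> Wplus" by blast
    have injA: "inj A" using A(1) by (rule bij_is_inj)
    have inv_A: "invariant_subspace smul rho (SL2 UNIV) (A ` tau)"
      unfolding invariant_subspace_def
    proof (intro conjI ballI)
      show "subspace (A ` tau)" by (rule subspace_linmap_image[OF A(2) tsub])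
      show "rho h y \<in> A ` tau" if h: "h \<in> SL2 UNIV" and y: "y \<in> A ` tau" for h y
      proof -
        obtain u where u: "u \<in> tau" "y = A u" using y by blast
        have "rho h y = A (rho h u)" using A(3)[OF SL2_GL2[OF h]] u(2) by simp
        then show ?thesis using tst[OF h u(1)] by blast
      qed
    qed
    have "irreducible_on smul rho (SL2 UNIV) (A ` tau)"
      unfolding irreducible_on_def
    proof (intro conjI allI impI)
      show "A ` tau \<noteq> {0}"
      proof
        assume "A ` tau = {0}"
        then have "A z = A 0" using z(1) linmap_0[OF A(2)] by auto
        then show False using injA z(2) by (auto dest: injD)
      qed
      fix X assume X: "invariant_subspace smul rho (SL2 UNIV) X \<and> X \<subseteq> A ` tau"
      then have im: "X = A ` {u\<in>tau. A u \<in> X}" by blast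
      define V where "V = {u\<in>tau. A u \<in> X}"
      have "X = A ` V" using im unfolding V_def .
      moreover have "V = {0} \<or> V = tau"
        using pre[of X V] X V_def by blast
      ultimately show "X = {0} \<or> X = A ` tau"
        using linmap_0[OF A(2)] by auto
    qed (rule inv_A)
    moreover have "iso_on smul rho (SL2 UNIV) tau (A ` tau)"
      unfolding iso_on_def
    proof (intro exI[of _ A] conjI)
      show "bij_betw A tau (A ` tau)" using injA by (meson inj_on_imp_bij_betw inj_on_subset subset_UNIV)
      show "\<forall>h\<in>SL2 UNIV. \<forall>w\<in>tau. A (rho h w) = rho h (A w)" using A(3) SL2_GL2 by blast
    qed (use linmap_add[OF A(2)] linmap_scale[OF A(2)] in auto)
    ultimately show ?thesis using sub by blast
  qed
  ultimately show ?thesis by blast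
qed

end
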